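(* Let $L/K$ be a totally ramified extension of degree $n=up^\nu$ with $p\nmid u$. Let $j$ be an integer with $0\le j\le\nu$ and $m:=\min\{v_p(i_j),\nu\}<j$, and assume that the residue field $\overline{K}$ of $K$ satisfies $|\overline{K}|>p^m$. Then for every $r\in\mathbb{Z}$, $\mathcal{O}_K\cdot E_{p^j}(\mathcal{M}_L^r)=\mathcal{M}_K^{\lceil(i_j+rp^j)/n\rceil}$, i.e. $g_{p^j}(r)=\lceil(i_j+rp^j)/n\rceil$.
   Context: $K$ is a field complete with respect to a discrete valuation $v_K$ whose residue field $\overline{K}$ is perfect of characteristic $p$; $K^{sep}$ is a separable closure and $L\subset K^{sep}$ is a finite (separable) totally ramified extension. $\mathcal{O}_K$ is the valuation ring of $K$; $\mathcal{M}_K,\mathcal{M}_L$ are the maximal ideals; $v_L$ is normalized with $v_L=nv_K$ on $K$; $e_L=v_L(p)$ ($=\infty$ if $\mathrm{char}\,K=p$). $\sigma_1,\dots,\sigma_n$ are the $K$-embeddings $L\to K^{sep}$, and $E_h(\alpha)=e_h(\sigma_1(\alpha),\dots,\sigma_n(\alpha))$ where $e_h$ is the $h$th elementary symmetric polynomial; $g_h(r)=\min\{v_K(E_h(\alpha)):\alpha\in\mathcal{M}_L^r\}$. Indices of inseparability: let $\pi_L$ be a uniformizer of $L$ with minimal polynomial $X^n-c_1X^{n-1}+\dots+(-1)^nc_n$ over $K$; with $\overline{v}_p(k)=\min\{v_p(k),\nu\}$, set $i_j^{\pi_L}=\min\{nv_K(c_h)-h:1\le h\le n,\ \overline{v}_p(h)\le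 j\}$ and $i_j=\min\{i_{j'}^{\pi_L}+(j'-j)e_L:j\le j'\le\nu\}$ for $0\le j\le\nu$ (independent of $\pi_L$). *)

theory Defs
  imports
    Complex_Main
    "HOL-Library.Extended"
    "HOL-Library.FuncSet"
    "HOL-Computational_Algebra.Computational_Algebra"
begin

text \<open>
  All fields are subfields of one ambient field, the type \<open>'a\<close>, which plays the role of the
  separable closure. Valuations take values in the integers together with \<open>Pinf\<close>;
  the element \<open>Minf\<close> of type \<open>int extended\<close> is never a value, and values
  outside the field in question are irrelevant.
\<close>

definition is_subfield :: "'a::field set \<Rightarrow> bool" where
  "is_subfield F \<longleftrightarrow> 0 \<in> F \<and> 1 \<in> F \<and>
     (\<forall>x\<in>F. \<forall>y\<in>F. x + y \<in> F \<and> x * y \<in> F) \<and>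
     (\<forall>x\<in>F. - x \<in> F \<and> inverse x \<in> F)"

text \<open>The \<open>k\<close>-fold sum; in particular the zero-fold multiple of \<open>Pinf\<close> is \<open>0\<close>.\<close>

definition nmul :: "nat \<Rightarrow> int extended \<Rightarrow> int extended" where
  "nmul k x = (\<Sum>_<k. x)"

definition the_Fin :: "int extended \<Rightarrow> int" where
  "the_Fin x = (THE a. x = Fin a)"


section \<open>Discretely valued fields\<close>

definition normalized_valuation :: "'a::field set \<Rightarrow> ('a \<Rightarrow> int extended) \<Rightarrow> bool" where
  "normalized_valuation F v \<longleftrightarrow>
     v 0 = Pinf \<and>
     v ` (F - {0}) = range Fin \<and>
     (\<forall>x\<in>F. \<forall>y\<in>F. v (x * y) = v x + v y) \<and>
     (\<forall>x\<in>F. \<forall>y\<in>F. min (v x) (v y) \<le> v (x + y))"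

definition valuation_complete :: "'a::field set \<Rightarrow> ('a \<Rightarrow> int extended) \<Rightarrow> bool" where
  "valuation_complete F v \<longleftrightarrow>
     (\<forall>X :: nat \<Rightarrow> 'a.
        (\<forall>i. X i \<in> F) \<and> (\<forall>N::int. \<exists>M. \<forall>i\<ge>M. \<forall>k\<ge>M. Fin N \<le> v (X i - X k)) \<longrightarrow>
        (\<exists>x\<in>F. \<forall>N::int. \<exists>M. \<forall>i\<ge>M. Fin N \<le> v (X i - x)))"

definition valuation_ring :: "'a::field set \<Rightarrow> ('a \<Rightarrow> int extended) \<Rightarrow> 'a set" where
  "valuation_ring F v = {x \<in> F. 0 \<le> v x}"

definition maximal_ideal :: "'a::field set \<Rightarrow> ('a \<Rightarrow> int extended) \<Rightarrow> 'a set" where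
  "maximal_ideal F v = {x \<in> F. 0 < v x}"

text \<open>The fractional ideal \<open>M\<^sup>r\<close>, where \<open>M\<close> is the maximal ideal and \<open>r\<close> may be negative.\<close>

definition maximal_ideal_pow :: "'a::field set \<Rightarrow> ('a \<Rightarrow> int extended) \<Rightarrow> int \<Rightarrow> 'a set" where
  "maximal_ideal_pow F v r = {x \<in> F. Fin r \<le> v x}"

definition residue_field :: "'a::field set \<Rightarrow> ('a \<Rightarrow> int extended) \<Rightarrow> 'a set set" where
  "residue_field F v = valuation_ring F v //
     {(x, y). x \<in> valuation_ring F v \<and> y \<in> valuation_ring F v \<and> x - y \<in> maximal_ideal F v}"

text \<open>
  In terms of representatives: \<open>p = 0\<close> in the residue field, and the Frobenius map of the
  residue field is surjective.
\<close>

definition perfect_residue_field_char ::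
    "nat \<Rightarrow> 'a::field set \<Rightarrow> ('a \<Rightarrow> int extended) \<Rightarrow> bool" where
  "perfect_residue_field_char p F v \<longleftrightarrow>
     prime p \<and> of_nat p \<in> maximal_ideal F v \<and>
     (\<forall>x\<in>valuation_ring F v. \<exists>y\<in>valuation_ring F v. x - y ^ p \<in> maximal_ideal F v)"


section \<open>Field extensions\<close>

definition poly_over :: "'a::field set \<Rightarrow> 'a poly \<Rightarrow> bool" where
  "poly_over K f \<longleftrightarrow> (\<forall>i. coeff f i \<in> K)"

definition algebraic_over :: "'a::field set \<Rightarrow> 'a \<Rightarrow> bool" where
  "algebraic_over K x \<longleftrightarrow> (\<exists>f. poly_over K f \<and> f \<noteq> 0 \<and> poly f x = 0)"

definition min_poly :: "'a::field set \<Rightarrow> 'a \<Rightarrow> 'a poly" where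
  "min_poly K x = (THE f. poly_over K f \<and> lead_coeff f = 1 \<and> poly f x = 0 \<and>
     (\<forall>g. poly_over K g \<and> g \<noteq> 0 \<and> poly g x = 0 \<longrightarrow> degree f \<le> degree g))"

text \<open>Coprimality of two polynomials does not depend on the field of coefficients.\<close>

definition separable_poly :: "'a::field poly \<Rightarrow> bool" where
  "separable_poly f \<longleftrightarrow> coprime f (pderiv f)"

definition separable_over :: "'a::field set \<Rightarrow> 'a \<Rightarrow> bool" where
  "separable_over K x \<longleftrightarrow> algebraic_over K x \<and> separable_poly (min_poly K x)"

text \<open>The whole type \<open>'a\<close> is a separable closure of \<open>K\<close>.\<close>

definition UNIV_separable_closure :: "'a::field set \<Rightarrow> bool" where
  "UNIV_separable_closure K \<longleftrightarrow>
     (\<forall>x. separable_over K x) \<and>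
     (\<forall>f :: 'a poly. 0 < degree f \<and> separable_poly f \<longrightarrow> (\<exists>x. poly f x = 0))"

text \<open>\<open>L\<close> has a basis with \<open>n\<close> elements over \<open>K\<close>.\<close>

definition extension_degree :: "'a::field set \<Rightarrow> 'a set \<Rightarrow> nat \<Rightarrow> bool" where
  "extension_degree K L n \<longleftrightarrow>
     (\<exists>b :: nat \<Rightarrow> 'a. (\<forall>i<n. b i \<in> L) \<and>
        (\<forall>x\<in>L. \<exists>!c. c \<in> {..<n} \<rightarrow>\<^sub>E K \<and> x = (\<Sum>i<n. c i * b i)))"

text \<open>The ramification index equals the degree \<open>n\<close>; both valuations are normalized.\<close>

definition totally_ramified ::
    "'a::field set \<Rightarrow> ('a \<Rightarrow> int extended) \<Rightarrow> 'a set \<Rightarrow> ('a \<Rightarrow> int extended) \<Rightarrow> nat \<Rightarrow> bool" where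
  "totally_ramified K vK L vL n \<longleftrightarrow>
     is_subfield L \<and> K \<subseteq> L \<and> extension_degree K L n \<and>
     normalized_valuation L vL \<and> (\<forall>x\<in>K. vL x = nmul n (vK x))"

definition embeddings :: "'a::field set \<Rightarrow> 'a set \<Rightarrow> ('a \<Rightarrow> 'a) set" where
  "embeddings K L = {\<sigma> \<in> extensional L.
     (\<forall>x\<in>K. \<sigma> x = x) \<and>
     (\<forall>x\<in>L. \<forall>y\<in>L. \<sigma> (x + y) = \<sigma> x + \<sigma> y \<and> \<sigma> (x * y) = \<sigma> x * \<sigma> y)}"


section \<open>Elementary symmetric polynomials of the conjugates\<close>

text \<open>The \<open>h\<close>-th elementary symmetric polynomial evaluated at the family \<open>(f i)\<close>, \<open>i \<in> I\<close>.\<close>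

definition elem_sym :: "nat \<Rightarrow> 'i set \<Rightarrow> ('i \<Rightarrow> 'a::comm_ring_1) \<Rightarrow> 'a" where
  "elem_sym h I f = (\<Sum>S | S \<subseteq> I \<and> card S = h. \<Prod>i\<in>S. f i)"

definition E_sym :: "'a::field set \<Rightarrow> 'a set \<Rightarrow> nat \<Rightarrow> 'a \<Rightarrow> 'a" where
  "E_sym K L h \<alpha> = elem_sym h (embeddings K L) (\<lambda>\<sigma>. \<sigma> \<alpha>)"

definition g_min :: "'a::field set \<Rightarrow> ('a \<Rightarrow> int extended) \<Rightarrow> 'a set \<Rightarrow> ('a \<Rightarrow> int extended) \<Rightarrow>
    nat \<Rightarrow> int \<Rightarrow> int extended" where
  "g_min K vK L vL h r =
     (LEAST g. g \<in> (\<lambda>\<alpha>. vK (E_sym K L h \<alpha>)) ` maximal_ideal_pow L vL r)"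


section \<open>Indices of inseparability\<close>

text \<open>
  The \<open>p\<close>-adic valuation truncated at \<open>\<nu>\<close>. The case distinction is needed because
  \<open>v\<^sub>p 0\<close> is infinite, whereas \<open>multiplicity p 0 = 0\<close>.
\<close>

definition vp_trunc :: "nat \<Rightarrow> nat \<Rightarrow> int \<Rightarrow> nat" where
  "vp_trunc p \<nu> k = (if k = 0 then \<nu> else min (multiplicity (int p) k) \<nu>)"

text \<open>The \<open>c\<^sub>h\<close> in the minimal polynomial \<open>X\<^sup>n - c\<^sub>1 X\<^sup>n\<^sup>-\<^sup>1 + \<dots> + (-1)\<^sup>n c\<^sub>n\<close> of a uniformizer.\<close>

definition min_poly_c :: "'a::field set \<Rightarrow> nat \<Rightarrow> 'a \<Rightarrow> nat \<Rightarrow> 'a" where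
  "min_poly_c K n \<pi> h = (- 1) ^ h * coeff (min_poly K \<pi>) (n - h)"

definition insep_index_at ::
    "'a::field set \<Rightarrow> ('a \<Rightarrow> int extended) \<Rightarrow> nat \<Rightarrow> nat \<Rightarrow> nat \<Rightarrow> 'a \<Rightarrow> nat \<Rightarrow> int extended" where
  "insep_index_at K vK p n \<nu> \<pi> j =
     Min ((\<lambda>h. nmul n (vK (min_poly_c K n \<pi> h)) - Fin (int h)) `
            {h \<in> {1..n}. vp_trunc p \<nu> (int h) \<le> j})"

text \<open>
  Here \<open>vL (of_nat p)\<close> is the absolute ramification index, which is \<open>Pinf\<close> in characteristic \<open>p\<close>.
  For a separable extension the minimum below is always finite, so its value is taken as an integer.
\<close>

definition insep_index ::
    "'a::field set \<Rightarrow> ('a \<Rightarrow> int extended) \<Rightarrow> ('a \<Rightarrow> int extended) \<Rightarrow>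
     nat \<Rightarrow> nat \<Rightarrow> nat \<Rightarrow> 'a \<Rightarrow> nat \<Rightarrow> int" where
  "insep_index K vK vL p n \<nu> \<pi> j =
     the_Fin (Min ((\<lambda>j'. insep_index_at K vK p n \<nu> \<pi> j' + nmul (j' - j) (vL (of_nat p))) ` {j..\<nu>}))"

end

theory Submission
  imports
    Defs
    "HOL-Library.Multiset"
    "HOL-Combinatorics.Permutations"
    "HOL-Computational_Algebra.Fundamental_Theorem_Algebra"
    "HOL-Number_Theory.Cong"
begin

text \<open>
  Let \<open>x\<^sub>1, \<dots>, x\<^sub>n\<close> be the conjugates of the uniformizer and \<open>c\<^sub>h\<close> their elementary symmetric
  polynomials. For \<open>\<alpha> = \<Sum> a\<^sub>e \<pi>\<^sup>e\<close> with all \<open>e \<ge> r > 0\<close>, the element \<open>E\<^sub>h(\<alpha>)\<close> is a combination of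
  monomial symmetric functions \<open>m\<^sub>\<mu>(x)\<close> with \<open>|\<mu>| = h\<close> parts, and \<open>m\<^sub>\<mu>\<close> is an integral combination
  of products \<open>c\<^sub>\<kappa>\<close>, where \<open>\<kappa>\<close> runs through the partitions of the weight \<open>w\<close> of \<open>\<mu>\<close>. The integers
  \<open>d\<^sub>\<mu>\<^sub>\<kappa>\<close> do not depend on the field, so they can be studied over the complex numbers:

  \<^item> if \<open>q\<close> divides all parts of \<open>\<kappa>\<close>, then \<open>q\<close> divides \<open>h d\<^sub>\<mu>\<^sub>\<kappa>\<close>, by Newton-type identities for the
    roots of a polynomial in \<open>X\<^sup>q\<close>;
  \<^item> if \<open>\<mu>\<close> consists of \<open>p\<^sup>m\<close> parts \<open>r + \<delta>\<close> and \<open>p\<^sup>j - p\<^sup>m\<close> parts \<open>r\<close>, with \<open>\<delta>\<close> prime to \<open>p\<close>, and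
    \<open>\<kappa> = (k, n, \<dots>, n)\<close> with \<open>0 < k < n\<close>, then \<open>d\<^sub>\<mu>\<^sub>\<kappa>\<close> is prime to \<open>p\<close>, by a first-order perturbation
    of the \<open>n\<close>-th roots of unity.

  The first fact gives \<open>v\<^sub>L(d\<^sub>\<mu>\<^sub>\<kappa> c\<^sub>\<kappa>) \<ge> i\<^sub>j + w\<close>, hence the lower bound. Since \<open>m < j\<close>, equality holds
  only for \<open>\<kappa> = (k, n, \<dots>, n)\<close>, where \<open>k\<close> is the residue of \<open>-i\<^sub>j\<close> modulo \<open>n\<close>. For
  \<open>\<alpha> = \<pi>\<^sup>r + b \<pi>\<^sup>r\<^sup>+\<^sup>\<delta>\<close> with suitable \<open>\<delta>\<close>, the element \<open>E\<^sub>h(\<alpha>)\<close> divided by the expected power of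
  the uniformizer of \<open>K\<close> is therefore, modulo the maximal ideal, a polynomial in \<open>b\<close> of degree
  exactly \<open>p\<^sup>m\<close>. It has a nonzero value because the residue field has more than \<open>p\<^sup>m\<close> elements.
\<close>


section \<open>Symmetric polynomials\<close>

definition posmset :: "'i set \<Rightarrow> ('i \<Rightarrow> nat) \<Rightarrow> nat multiset" where
  "posmset J g = filter_mset (\<lambda>e. 0 < e) (image_mset g (mset_set J))"

text \<open>Exponent vectors are total functions vanishing outside \<open>J\<close>, so equal
  monomials have equal vectors. The type \<open>posmset\<close> forgets zeros, which lets the same
  \<open>\<mu>\<close> serve for \<open>J\<close> and for \<open>J - {i}\<close>.\<close>

definition expos :: "'i set \<Rightarrow> nat multiset \<Rightarrow> ('i \<Rightarrow> nat) set" where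
  "expos J \<mu> = {g. (\<forall>i. i \<notin> J \<longrightarrow> g i = 0) \<and> posmset J g = \<mu>}"

definition monom_sym :: "'i set \<Rightarrow> nat multiset \<Rightarrow> ('i \<Rightarrow> 'a::comm_ring_1) \<Rightarrow> 'a" where
  "monom_sym J \<mu> x = (\<Sum>g\<in>expos J \<mu>. \<Prod>i\<in>J. x i ^ g i)"

lemma sum_mset_pos: "sum_mset (filter_mset (\<lambda>e. 0 < e) M) = sum_mset (M :: nat multiset)"
  by (induction M) auto

lemma sum_mset_posmset: "sum_mset (posmset J g) = sum g J"
  unfolding posmset_def sum_mset_pos by (simp add: sum_unfold_sum_mset)

lemma size_posmset: "finite J \<Longrightarrow> size (posmset J g) = card {i\<in>J. 0 < g i}"
  unfolding posmset_def by (simp add: filter_mset_image_mset)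

definition expo_wt :: "'i set \<Rightarrow> nat \<Rightarrow> ('i \<Rightarrow> nat) set" where
  "expo_wt J w = {g. (\<forall>i. i \<notin> J \<longrightarrow> g i = 0) \<and> sum g J = w}"

lemma finite_funs_bounded:
  assumes "finite J"
  shows "finite {g :: 'i \<Rightarrow> nat. (\<forall>i. i \<notin> J \<longrightarrow> g i = 0) \<and> (\<forall>i\<in>J. g i \<le> w)}"
proof -
  have "finite {g :: 'i \<Rightarrow> nat. \<forall>i. (i \<in> J \<longrightarrow> g i \<in> {..w}) \<and> (i \<notin> J \<longrightarrow> g i = 0)}"
    by (rule finite_set_of_finite_funs) (use assms in auto)
  then show ?thesis by (rule rev_finite_subset) auto
qed

lemma finite_expo_wt: "finite J \<Longrightarrow> finite (expo_wt J w)"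
  by (rule finite_subset[OF _ finite_funs_bounded[of J w]]) (auto simp: expo_wt_def intro: member_le_sum)

lemma expos_subset_expo_wt: "expos J \<mu> \<subseteq> expo_wt J (sum_mset \<mu>)"
  by (auto simp: expos_def expo_wt_def sum_mset_posmset)

lemma finite_expos: "finite J \<Longrightarrow> finite (expos J \<mu>)"
  by (rule finite_subset[OF expos_subset_expo_wt finite_expo_wt])

text \<open>The multiset \<open>\<kappa>\<close> names the product of the elementary symmetric
  polynomials with these indices. The bound \<open>n\<close> will be the number of variables, beyond
  which they vanish.\<close>

definition partitions_le :: "nat \<Rightarrow> nat \<Rightarrow> nat multiset set" where
  "partitions_le n w = {\<kappa>. set_mset \<kappa> \<subseteq> {1..n} \<and> sum_mset \<kappa> = w}"

definition elem_prod :: "'i set \<Rightarrow> nat multiset \<Rightarrow> ('i \<Rightarrow> 'a::comm_ring_1) \<Rightarrow> 'a" where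
  "elem_prod J \<kappa> x = prod_mset (image_mset (\<lambda>h. elem_sym h J x) \<kappa>)"

lemma size_le_sum_mset: "(\<forall>e\<in>#M. 0 < e) \<Longrightarrow> size M \<le> sum_mset (M :: nat multiset)"
  by (induction M) auto

lemma finite_multisets_of_size:
  assumes W: "finite W"
  shows "finite {M. size M = k \<and> set_mset M \<subseteq> W}"
proof (induction k)
  case 0
  then show ?case by (simp add: conj_commute)
next
  case (Suc k)
  have "{M. size M = Suc k \<and> set_mset M \<subseteq> W}
    \<subseteq> (\<lambda>(a, M). add_mset a M) ` (W \<times> {M. size M = k \<and> set_mset M \<subseteq> W})"
  proof
    fix M assume M: "M \<in> {M. size M = Suc k \<and> set_mset M \<subseteq> W}"
    then obtain a N where "M = add_mset a N" using size_eq_Suc_imp_eq_union by blast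
    then show "M \<in> (\<lambda>(a, M). add_mset a M) ` (W \<times> {M. size M = k \<and> set_mset M \<subseteq> W})"
      using M by auto
  qed
  then show ?case using Suc W by (meson finite_SigmaI finite_imageI finite_subset)
qed

lemma finite_partitions_le: "finite (partitions_le n w)"
proof (rule finite_subset)
  show "partitions_le n w \<subseteq> (\<Union>k\<le>w. {M. size M = k \<and> set_mset M \<subseteq> {1..n}})"
  proof
    fix M assume M: "M \<in> partitions_le n w"
    then have "\<forall>e\<in>#M. 0 < e" by (force simp: partitions_le_def)
    then have "size M \<le> w" using size_le_sum_mset[of M] M by (simp add: partitions_le_def)
    then show "M \<in> (\<Union>k\<le>w. {M. size M = k \<and> set_mset M \<subseteq> {1..n}})"
      using M by (auto simp: partitions_le_def)
  qed
  show "finite (\<Union>k\<le>w. {M. size M = k \<and> set_mset M \<subseteq> {1..n}})"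
    by (intro finite_UN_I finite_multisets_of_size) auto
qed

section \<open>Symmetric polynomials with integer coefficients\<close>

text \<open>Invariance under permutations of the variables, expressed on coefficients: two vectors
  have the same multiset of values on \<open>J\<close> exactly when a permutation of
  \<open>J\<close> carries one to the other there.\<close>

definition sym_coeff :: "'i set \<Rightarrow> (('i \<Rightarrow> nat) \<Rightarrow> int) \<Rightarrow> bool" where
  "sym_coeff J a \<longleftrightarrow> (\<forall>g g'. image_mset g (mset_set J) = image_mset g' (mset_set J) \<longrightarrow> a g = a g')"

lemma sym_coeffD:
  "sym_coeff J a \<Longrightarrow> image_mset g (mset_set J) = image_mset g' (mset_set J) \<Longrightarrow> a g = a g'"
  unfolding sym_coeff_def by blast

definition expo_sum :: "'i set \<Rightarrow> nat \<Rightarrow> (('i \<Rightarrow> nat) \<Rightarrow> int) \<Rightarrow> ('i \<Rightarrow> 'a::comm_ring_1) \<Rightarrow> 'a" where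
  "expo_sum J w a x = (\<Sum>g\<in>expo_wt J w. of_int (a g) * (\<Prod>i\<in>J. x i ^ g i))"

definition elem_sum :: "'i set \<Rightarrow> nat \<Rightarrow> (nat multiset \<Rightarrow> int) \<Rightarrow> ('i \<Rightarrow> 'a::comm_ring_1) \<Rightarrow> 'a" where
  "elem_sum J w d x = (\<Sum>\<kappa>\<in>partitions_le (card J) w. of_int (d \<kappa>) * elem_prod J \<kappa> x)"

lemma elem_sum_add: "elem_sum J w (\<lambda>l. d l + d' l) x = elem_sum J w d x + elem_sum J w d' x"
  by (simp add: elem_sum_def distrib_right sum.distrib)

lemma expo_sum_add: "expo_sum J w (\<lambda>l. d l + d' l) x = expo_sum J w d x + expo_sum J w d' x"
  by (simp add: expo_sum_def distrib_right sum.distrib)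

text \<open>Adding a part \<open>l\<close> is a bijection from the partitions of \<open>w\<close>
  onto those partitions of \<open>w + l\<close> that contain \<open>l\<close>.\<close>

lemma elem_sum_shift:
  assumes "l \<in> {1..card J}"
  shows "elem_sum J (w + l) (\<lambda>\<kappa>. if l \<in># \<kappa> then d (\<kappa> - {#l#}) else 0) x = elem_sym l J x * elem_sum J w d x"
proof -
  have "elem_sum J (w + l) (\<lambda>\<kappa>. if l \<in># \<kappa> then d (\<kappa> - {#l#}) else 0) x
    = (\<Sum>\<kappa>\<in>{\<kappa>\<in>partitions_le (card J) (w + l). l \<in># \<kappa>}. of_int (d (\<kappa> - {#l#})) * elem_prod J \<kappa> x)"
    unfolding elem_sum_def by (rule sum.mono_neutral_cong_right) (auto simp: finite_partitions_le)
  also have "\<dots> = (\<Sum>\<kappa>\<in>partitions_le (card J) w. of_int (d \<kappa>) * elem_prod J (add_mset l \<kappa>) x)"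
    by (rule sum.reindex_bij_witness[of _ "add_mset l" "\<lambda>\<kappa>. \<kappa> - {#l#}"])
       (use assms in \<open>auto simp: partitions_le_def sum_mset_diff dest: in_diffD\<close>)
  finally show ?thesis by (simp add: elem_sum_def elem_prod_def sum_distrib_left mult_ac)
qed

definition add_ind :: "('i \<Rightarrow> nat) \<Rightarrow> 'i set \<Rightarrow> 'i \<Rightarrow> nat" where
  "add_ind g S = (\<lambda>i. g i + of_bool (i \<in> S))"

definition sub_ind :: "('i \<Rightarrow> nat) \<Rightarrow> 'i set \<Rightarrow> 'i \<Rightarrow> nat" where
  "sub_ind g S = (\<lambda>i. g i - of_bool (i \<in> S))"

text \<open>As \<open>S\<close> contains the support of \<open>g\<close>, the values are those of
  \<open>g\<close> on its support raised by one, then ones, then zeros. Only the type of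
  \<open>g\<close> and the size of \<open>S\<close> enter, which makes the coefficients
  \<open>a'\<close> in \<open>fundamental_symmetric\<close> independent of choices.\<close>

lemma image_mset_add_ind:
  assumes J: "finite J" and S: "S \<subseteq> J" "{i\<in>J. 0 < g i} \<subseteq> S"
  shows "image_mset (add_ind g S) (mset_set J) =
    image_mset (Suc \<circ> g) (mset_set {i\<in>J. 0 < g i}) + replicate_mset (card S - card {i\<in>J. 0 < g i}) 1
    + replicate_mset (card J - card S) 0"
proof -
  let ?P = "{i\<in>J. 0 < g i}"
  have fin: "finite S" "finite ?P" using J S by (auto intro: finite_subset)
  have "mset_set J = mset_set ?P + mset_set (S - ?P) + mset_set (J - S)"
  proof -
    have "J = (?P \<union> (S - ?P)) \<union> (J - S)" using S by auto
    moreover have "mset_set ((?P \<union> (S - ?P)) \<union> (J - S)) = mset_set (?P \<union> (S - ?P)) + mset_set (J - S)"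
      by (rule mset_set_Union) (use S J fin in auto)
    moreover have "mset_set (?P \<union> (S - ?P)) = mset_set ?P + mset_set (S - ?P)"
      by (rule mset_set_Union) (use fin in auto)
    ultimately show ?thesis by simp
  qed
  moreover have "image_mset (add_ind g S) (mset_set ?P) = image_mset (Suc \<circ> g) (mset_set ?P)"
    by (rule image_mset_cong) (use S fin in \<open>auto simp: add_ind_def\<close>)
  moreover have "image_mset (add_ind g S) (mset_set (S - ?P)) = image_mset (\<lambda>_. 1) (mset_set (S - ?P))"
    by (rule image_mset_cong) (use S fin in \<open>auto simp: add_ind_def\<close>)
  moreover have "image_mset (add_ind g S) (mset_set (J - S)) = image_mset (\<lambda>_. 0) (mset_set (J - S))"
    by (rule image_mset_cong) (use S J in \<open>auto simp: add_ind_def\<close>)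
  ultimately show ?thesis
    using S J fin by (simp add: image_mset_const_eq card_Diff_subset)
qed

text \<open>A monomial \<open>g\<close> of the product arises once for each \<open>l\<close>-subset
  \<open>S\<close> of its support, from the monomial with the variables in \<open>S\<close> divided
  out. Truncated subtraction is exact because \<open>S\<close> lies in the support.\<close>

lemma elem_sym_mult_expo_sum:
  fixes x :: "'i \<Rightarrow> 'a::comm_ring_1"
  assumes J: "finite J"
  shows "elem_sym l J x * expo_sum J w a x
    = expo_sum J (w + l) (\<lambda>g. \<Sum>S | S \<subseteq> {i\<in>J. 0 < g i} \<and> card S = l. a (sub_ind g S)) x"
proof -
  let ?Sub = "{S. S \<subseteq> J \<and> card S = l}"
  let ?A = "?Sub \<times> expo_wt J w"
  let ?B = "Sigma (expo_wt J (w + l)) (\<lambda>g. {S. S \<subseteq> {i\<in>J. 0 < g i} \<and> card S = l})"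
  have sum_add: "sum (add_ind g S) J = sum g J + card S" if "S \<subseteq> J" for g S
  proof -
    have "sum (add_ind g S) J = sum g J + (\<Sum>i\<in>J. of_bool (i \<in> S))" by (simp add: add_ind_def sum.distrib)
    also have "(\<Sum>i\<in>J. of_bool (i \<in> S) :: nat) = card S"
      using that J by (simp add: Int_absorb1 Int_commute)
    finally show ?thesis .
  qed
  have add_sub: "add_ind (sub_ind g S) S = g" if "S \<subseteq> {i\<in>J. 0 < g i}" for g S
    using that by (fastforce simp: add_ind_def sub_ind_def fun_eq_iff)
  have sub_add: "sub_ind (add_ind g S) S = g" for g :: "'i \<Rightarrow> nat" and S
    by (auto simp: add_ind_def sub_ind_def fun_eq_iff)
  have "elem_sym l J x * expo_sum J w a x
    = (\<Sum>(S, g)\<in>?A. (\<Prod>i\<in>S. x i) * (of_int (a g) * (\<Prod>i\<in>J. x i ^ g i)))"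
    by (simp add: elem_sym_def expo_sum_def sum_product sum.cartesian_product)
  also have "\<dots> = (\<Sum>(g, S)\<in>?B. of_int (a (sub_ind g S)) * (\<Prod>i\<in>J. x i ^ g i))"
  proof (rule sum.reindex_bij_witness[of _ "\<lambda>(g, S). (S, sub_ind g S)" "\<lambda>(S, g). (add_ind g S, S)"], goal_cases)
    case (1 y) then show ?case by (auto simp: sub_add)
  next
    case (2 y)
    then obtain S g where y: "y = (S, g)" "S \<subseteq> J" "card S = l" "g \<in> expo_wt J w" by auto
    then show ?case using sum_add[of S g] by (auto simp: expo_wt_def add_ind_def)
  next
    case (3 y) then show ?case by (auto simp: add_sub)
  next
    case (4 y)
    then obtain S g where y: "y = (g, S)" "S \<subseteq> {i\<in>J. 0 < g i}" "card S = l" "g \<in> expo_wt J (w + l)" by auto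
    then have "sum (sub_ind g S) J + card S = sum g J" using sum_add[of S "sub_ind g S"] add_sub[of S g] by fastforce
    then show ?case using y by (auto simp: expo_wt_def sub_ind_def)
  next
    case (5 y)
    then obtain S g where y: "y = (S, g)" "S \<subseteq> J" "card S = l" "g \<in> expo_wt J w" by auto
    have "(\<Prod>i\<in>J. x i ^ add_ind g S i) = (\<Prod>i\<in>J. x i ^ g i) * (\<Prod>i\<in>J. x i ^ of_bool (i \<in> S))"
      by (simp add: add_ind_def power_add prod.distrib)
    also have "(\<Prod>i\<in>J. x i ^ of_bool (i \<in> S)) = (\<Prod>i\<in>S. x i)"
    proof -
      have "(\<Prod>i\<in>S. x i) = (\<Prod>i\<in>J. if i \<in> S then x i else 1)"
        using y J by (simp add: prod.inter_restrict[symmetric] Int_absorb1)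
      also have "\<dots> = (\<Prod>i\<in>J. x i ^ of_bool (i \<in> S))" by (rule prod.cong) auto
      finally show ?thesis by simp
    qed
    finally show ?case using y by (simp add: sub_add mult_ac)
  qed
  also have "\<dots> = (\<Sum>g\<in>expo_wt J (w + l). \<Sum>S | S \<subseteq> {i\<in>J. 0 < g i} \<and> card S = l.
       of_int (a (sub_ind g S)) * (\<Prod>i\<in>J. x i ^ g i))"
    by (rule sum.Sigma[symmetric]) (use J in \<open>auto simp: finite_expo_wt\<close>)
  also have "\<dots> = expo_sum J (w + l) (\<lambda>g. \<Sum>S | S \<subseteq> {i\<in>J. 0 < g i} \<and> card S = l. a (sub_ind g S)) x"
    by (simp add: expo_sum_def sum_distrib_right)
  finally show ?thesis .
qed

text \<open>A permutation carrying \<open>g\<close> to \<open>g'\<close> also carries the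
  \<open>l\<close>-subsets of one support to those of the other.\<close>

lemma sym_coeff_sub_ind_sum:
  assumes J: "finite J" and a: "sym_coeff J a"
  shows "sym_coeff J (\<lambda>g. \<Sum>S | S \<subseteq> {i\<in>J. 0 < g i} \<and> card S = l. a (sub_ind g S))"
  unfolding sym_coeff_def
proof (intro allI impI)
  fix g g' :: "'a \<Rightarrow> nat"
  assume "image_mset g (mset_set J) = image_mset g' (mset_set J)"
  from image_mset_eq_implies_permutes[OF J this]
  obtain p where p: "p permutes J" "\<And>i. i \<in> J \<Longrightarrow> g i = g' (p i)" by metis
  have inj: "inj p" using p permutes_inj by blast
  have q: "inv p permutes J" using p permutes_inv by blast
  have pJ: "p i \<in> J \<longleftrightarrow> i \<in> J" for i using p permutes_in_image by metis
  have pq: "p (inv p i) = i" "inv p (p i) = i" for i using p by (auto simp: permutes_inverses)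
  show "(\<Sum>S | S \<subseteq> {i\<in>J. 0 < g i} \<and> card S = l. a (sub_ind g S))
      = (\<Sum>S | S \<subseteq> {i\<in>J. 0 < g' i} \<and> card S = l. a (sub_ind g' S))"
  proof (rule sum.reindex_bij_witness[of _ "\<lambda>S. inv p ` S" "\<lambda>S. p ` S"], goal_cases)
    case (1 S) then show ?case by (simp add: image_image pq)
  next
    case (2 S) then show ?case using inj by (auto simp: pJ p(2) card_image inj_on_subset)
  next
    case (3 S) then show ?case by (simp add: image_image pq)
  next
    case (4 S)
    have "inj (inv p)" using q permutes_inj by blast
    then have "card (inv p ` S) = l" using 4 by (simp add: card_image inj_on_subset)
    moreover have "inv p i \<in> J \<and> 0 < g (inv p i)" if "i \<in> S" for i
      using 4 that p(2)[of "inv p i"] pJ[of "inv p i"] by (auto simp: pq)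
    ultimately show ?case by blast
  next
    case (5 S)
    have "image_mset (sub_ind g S) (mset_set J) = image_mset (sub_ind g' (p ` S) \<circ> p) (mset_set J)"
      by (rule image_mset_cong) (use J p inj in \<open>auto simp: sub_ind_def inj_image_mem_iff\<close>)
    also have "\<dots> = image_mset (sub_ind g' (p ` S)) (image_mset p (mset_set J))" by (simp add: multiset.map_comp)
    also have "image_mset p (mset_set J) = mset_set J"
      using p inj by (simp add: image_mset_mset_set inj_on_subset permutes_image)
    finally show ?case by (rule sym_coeffD[OF a, symmetric])
  qed
qed

text \<open>
  The two type variables make the same integers \<open>d\<close> available in the given field and in the
  complex numbers. Multiplying by \<open>e\<^sub>l\<close>, where \<open>l\<close> is the least support size, removes the monomials
  of support size \<open>l\<close>.
\<close>

theorem fundamental_symmetric: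
  assumes J: "finite (J :: 'i set)" and a: "sym_coeff J a"
  shows "\<exists>d. (\<forall>x :: 'i \<Rightarrow> 'a::comm_ring_1. expo_sum J w a x = elem_sum J w d x) \<and>
             (\<forall>x :: 'i \<Rightarrow> 'b::comm_ring_1. expo_sum J w a x = elem_sum J w d x)"
  using a
proof (induction w arbitrary: a rule: less_induct)
  case (less w)
  let ?Q = "\<lambda>a. \<exists>d. (\<forall>x :: 'i \<Rightarrow> 'a. expo_sum J w a x = elem_sum J w d x) \<and>
             (\<forall>x :: 'i \<Rightarrow> 'b. expo_sum J w a x = elem_sum J w d x)"
  have zero: "?Q a" if "\<And>g. g \<in> expo_wt J w \<Longrightarrow> a g = 0" for a
    by (rule exI[of _ "\<lambda>_. 0"]) (simp add: expo_sum_def elem_sum_def that)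
  have supp_le: "card {i\<in>J. 0 < g i} \<le> w" if "g \<in> expo_wt J w" for g
    using size_le_sum_mset[of "posmset J g"] that J
    by (auto simp: sum_mset_posmset size_posmset expo_wt_def) (simp add: posmset_def)
  show ?case
  proof (cases "w = 0")
    case True
    have e: "expo_wt J w = {\<lambda>_. 0}" using True J by (auto simp: expo_wt_def fun_eq_iff)
    have "\<kappa> = {#}" if "\<kappa> \<in> partitions_le (card J) w" for \<kappa>
    proof -
      have "\<forall>e\<in>#\<kappa>. 0 < e" using that by (force simp: partitions_le_def)
      then show ?thesis using that True by (cases \<kappa>) (auto simp: partitions_le_def)
    qed
    moreover have "{#} \<in> partitions_le (card J) w" using True by (simp add: partitions_le_def)
    ultimately have p: "partitions_le (card J) w = {{#}}" by blast
    show ?thesis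
      by (rule exI[of _ "\<lambda>_. a (\<lambda>_. 0)"]) (simp add: expo_sum_def elem_sum_def e p elem_prod_def)
  next
    case False
    \<comment> \<open>Inside the induction on the weight, a second induction raises the least
      support size \<open>l\<close> that may still occur. Beyond \<open>l = w\<close> no monomial is
      left.\<close>
    have "\<forall>a. sym_coeff J a \<and> (\<forall>g\<in>expo_wt J w. card {i\<in>J. 0 < g i} < l \<longrightarrow> a g = 0) \<longrightarrow> ?Q a"
      if "l \<ge> 1" for l
      using that
    proof (induction "w + 1 - l" arbitrary: l)
      case 0
      then show ?case using supp_le by (auto intro!: zero) (meson Suc_leI le_trans le_imp_less_Suc less_le_trans)
    next
      case (Suc k)
      show ?case
      proof (intro allI impI, elim conjE)
        fix a assume a: "sym_coeff J a"
          and van: "\<forall>g\<in>expo_wt J w. card {i\<in>J. 0 < g i} < l \<longrightarrow> a g = 0"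
        show "?Q a"
        proof (cases "l \<le> card J")
          case False
          have "card {i\<in>J. 0 < g i} \<le> card J" for g :: "'i \<Rightarrow> nat" by (rule card_mono) (use J in auto)
          then show ?thesis using van False by (intro zero) (meson le_less_trans not_le)
        next
          case lJ: True
          define ext where "ext g = (SOME S. S \<subseteq> J \<and> {i\<in>J. 0 < g i} \<subseteq> S \<and> card S = l)" for g :: "'i \<Rightarrow> nat"
          have ext: "ext g \<subseteq> J \<and> {i\<in>J. 0 < g i} \<subseteq> ext g \<and> card (ext g) = l"
            if "card {i\<in>J. 0 < g i} \<le> l" for g
            unfolding ext_def
          proof (rule someI_ex)
            show "\<exists>S\<subseteq>J. {i \<in> J. 0 < g i} \<subseteq> S \<and> card S = l"
              using exists_subset_between[OF that lJ _ J] by auto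
          qed
          \<comment> \<open>Coefficients of the cofactor of \<open>elem_sym l\<close>:
            \<open>g\<close> receives the coefficient that \<open>a\<close> has at \<open>g\<close>
            times the variables in \<open>ext g\<close>. The next fact shows that any other
            \<open>l\<close>-set containing the support gives the same value.\<close>
          define a' where "a' g = (if card {i\<in>J. 0 < g i} \<le> l then a (add_ind g (ext g)) else 0)" for g
          have a': "a' g = a (add_ind g S)" if "S \<subseteq> J" "{i\<in>J. 0 < g i} \<subseteq> S" "card S = l" for g S
          proof -
            have "card {i\<in>J. 0 < g i} \<le> card S"
              using that J by (intro card_mono) (auto intro: finite_subset)
            then have le: "card {i\<in>J. 0 < g i} \<le> l" using that by simp
            have "image_mset (add_ind g (ext g)) (mset_set J) = image_mset (add_ind g S) (mset_set J)"
              using ext[OF le] that J by (simp add: image_mset_add_ind)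
            from sym_coeffD[OF a this] show ?thesis using le by (simp add: a'_def)
          qed
          have sa': "sym_coeff J a'"
            unfolding sym_coeff_def
          proof (intro allI impI)
            fix g g' :: "'i \<Rightarrow> nat" assume eq: "image_mset g (mset_set J) = image_mset g' (mset_set J)"
            have pm: "image_mset g (mset_set {i\<in>J. 0 < g i}) = posmset J g" for g :: "'i \<Rightarrow> nat"
              using J by (simp add: posmset_def filter_mset_image_mset)
            have c: "card {i\<in>J. 0 < g i} = card {i\<in>J. 0 < g' i}"
              using eq J size_posmset[of J g] size_posmset[of J g'] by (simp add: posmset_def)
            show "a' g = a' g'"
            proof (cases "card {i\<in>J. 0 < g i} \<le> l")
              case True
              have "image_mset (add_ind g (ext g)) (mset_set J) = image_mset (add_ind g' (ext g')) (mset_set J)"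
                using ext[OF True] ext[of g'] True c J eq pm[of g] pm[of g']
                by (simp add: image_mset_add_ind multiset.map_comp[symmetric] posmset_def)
              from sym_coeffD[OF a this] show ?thesis using True c by (simp add: a'_def)
            qed (use c in \<open>simp add: a'_def\<close>)
          qed
          show ?thesis
          proof (cases "l \<le> w")
            case False
            then show ?thesis using van supp_le by (intro zero) (meson le_less_trans not_le)
          next
            case lw: True
            have "w - l < w" using \<open>w \<noteq> 0\<close> Suc.prems by simp
            from less.IH[OF this sa'] obtain d' where
              d': "\<And>x :: 'i \<Rightarrow> 'a. expo_sum J (w - l) a' x = elem_sum J (w - l) d' x"
                  "\<And>x :: 'i \<Rightarrow> 'b. expo_sum J (w - l) a' x = elem_sum J (w - l) d' x" by metis
            \<comment> \<open>Coefficients of \<open>elem_sym l\<close> times the cofactor. They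
              vanish below support size \<open>l\<close> and agree with \<open>a\<close> at size
              \<open>l\<close>, so the difference falls under the hypothesis for
              \<open>Suc l\<close>, while the cofactor has the smaller weight
              \<open>w - l\<close>.\<close>
            define b where "b g = (\<Sum>S | S \<subseteq> {i\<in>J. 0 < g i} \<and> card S = l. a' (sub_ind g S))" for g
            have sb: "sym_coeff J b" unfolding b_def by (rule sym_coeff_sub_ind_sum[OF J sa'])
            have b0: "b g = 0" if "card {i\<in>J. 0 < g i} < l" for g
            proof -
              have "{S. S \<subseteq> {i\<in>J. 0 < g i} \<and> card S = l} = {}"
                using that J card_mono[of "{i\<in>J. 0 < g i}"] by (auto simp: not_less[symmetric])
              then show ?thesis unfolding b_def by (simp only: sum.empty)
            qed
            have b1: "b g = a g" if "card {i\<in>J. 0 < g i} = l" for g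
            proof -
              have "{S. S \<subseteq> {i\<in>J. 0 < g i} \<and> card S = l} = {{i\<in>J. 0 < g i}}"
                using that J card_subset_eq[of "{i\<in>J. 0 < g i}"] by auto
              then have "b g = a' (sub_ind g {i\<in>J. 0 < g i})" unfolding b_def by (simp only: sum.empty sum.insert) simp
              also have "\<dots> = a (add_ind (sub_ind g {i\<in>J. 0 < g i}) {i\<in>J. 0 < g i})"
                using that by (intro a') (auto simp: sub_ind_def)
              also have "image_mset (add_ind (sub_ind g {i\<in>J. 0 < g i}) {i\<in>J. 0 < g i}) (mset_set J) = image_mset g (mset_set J)"
                by (rule image_mset_cong) (use J in \<open>auto simp: add_ind_def sub_ind_def\<close>)
              then have "a (add_ind (sub_ind g {i\<in>J. 0 < g i}) {i\<in>J. 0 < g i}) = a g"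
                by (rule sym_coeffD[OF a])
              finally show ?thesis .
            qed
            have "sym_coeff J (\<lambda>g. a g + - b g)"
              using a sb unfolding sym_coeff_def by metis
            moreover have "\<forall>g\<in>expo_wt J w. card {i\<in>J. 0 < g i} < Suc l \<longrightarrow> a g + - b g = 0"
              using van b0 b1 by (auto simp: less_Suc_eq)
            moreover have "k = w + 1 - Suc l" using Suc.hyps(2) by simp
            ultimately have "?Q (\<lambda>g. a g + - b g)" using Suc.hyps(1)[of "Suc l"] by simp
            then obtain d'' where
              d'': "\<And>x :: 'i \<Rightarrow> 'a. expo_sum J w (\<lambda>g. a g + - b g) x = elem_sum J w d'' x"
                   "\<And>x :: 'i \<Rightarrow> 'b. expo_sum J w (\<lambda>g. a g + - b g) x = elem_sum J w d'' x" by metis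
            define d where "d \<kappa> = (if l \<in># \<kappa> then d' (\<kappa> - {#l#}) else 0) + d'' \<kappa>" for \<kappa>
            have l: "l \<in> {1..card J}" using lJ Suc.prems by simp
            have eb: "expo_sum J w b x = elem_sym l J x * expo_sum J (w - l) a' x" for x :: "'i \<Rightarrow> 'c::comm_ring_1"
              using elem_sym_mult_expo_sum[OF J, of l x "w - l" a'] lw by (simp add: b_def[abs_def])
            have ed: "elem_sum J w d x = elem_sym l J x * elem_sum J (w - l) d' x + elem_sum J w d'' x" for x :: "'i \<Rightarrow> 'c::comm_ring_1"
              using elem_sum_shift[OF l, of "w - l" d' x] lw unfolding d_def elem_sum_add by simp
            have ea: "expo_sum J w a x = expo_sum J w b x + expo_sum J w (\<lambda>g. a g + - b g) x" for x :: "'i \<Rightarrow> 'c::comm_ring_1"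
              unfolding expo_sum_add[symmetric] by simp
            show ?thesis
              by (rule exI[of _ d]) (simp only: ea eb ed d' d'' simp_thms)
          qed
        qed
      qed
    qed
    from this[of 1] less.prems have "(\<forall>g\<in>expo_wt J w. card {i\<in>J. 0 < g i} < 1 \<longrightarrow> a g = 0) \<longrightarrow> ?Q a" by blast
    moreover have "card {i\<in>J. 0 < g i} \<noteq> 0" if "g \<in> expo_wt J w" for g
    proof
      assume "card {i\<in>J. 0 < g i} = 0"
      then have "\<forall>i\<in>J. g i = 0" using J by auto
      then have "sum g J = 0" by simp
      then show False using that False by (simp add: expo_wt_def)
    qed
    ultimately show ?thesis by auto
  qed
qed

lemma monom_sym_eq_expo_sum:
  assumes "finite J"
  shows "monom_sym J \<mu> x = expo_sum J (sum_mset \<mu>) (\<lambda>g. of_bool (posmset J g = \<mu>)) x"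
  unfolding monom_sym_def expo_sum_def
  by (rule sum.mono_neutral_cong_left, rule finite_expo_wt[OF assms])
     (auto simp: expos_def expo_wt_def sum_mset_posmset)

text \<open>The indicator of the exponent vectors of type \<open>\<mu>\<close> is a symmetric
  coefficient function. A single \<open>d\<close> is obtained for both rings.\<close>

lemma monom_sym_eq_elem_sum:
  assumes "finite (J :: 'i set)"
  obtains d where "\<And>x :: 'i \<Rightarrow> 'a::comm_ring_1. monom_sym J \<mu> x = elem_sum J (sum_mset \<mu>) d x"
    and "\<And>x :: 'i \<Rightarrow> 'b::comm_ring_1. monom_sym J \<mu> x = elem_sum J (sum_mset \<mu>) d x"
proof -
  have "sym_coeff J (\<lambda>g. of_bool (posmset J g = \<mu>))"
    by (simp add: sym_coeff_def posmset_def)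
  from fundamental_symmetric[OF assms this, of "sum_mset \<mu>"] show ?thesis
    using that by (auto simp: monom_sym_eq_expo_sum[OF assms])
qed

section \<open>Recursions obtained by removing one variable\<close>

lemma posmset_insert:
  "finite J \<Longrightarrow> i \<notin> J \<Longrightarrow> posmset (insert i J) g = (if 0 < g i then add_mset (g i) (posmset J g) else posmset J g)"
  by (simp add: posmset_def)

lemma posmset_upd: "i \<notin> J \<Longrightarrow> posmset J (g(i := e)) = posmset J g"
  unfolding posmset_def
  by (cases "finite J") (auto intro!: arg_cong[of _ _ "filter_mset _"] image_mset_cong)

text \<open>Exponent vectors are sorted by their value at \<open>i\<close>. The weight
  \<open>\<phi>\<close> is the constant 1 for removing a variable, the indicator of positive
  exponents for counting, and \<open>of_nat\<close> for differentiation.\<close>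

lemma sum_expos_remove:
  fixes x :: "'i \<Rightarrow> 'a::comm_ring_1" and \<phi> :: "nat \<Rightarrow> 'a"
  assumes J: "finite J" and i: "i \<in> J" and \<mu>: "0 \<notin># \<mu>"
  shows "(\<Sum>g\<in>expos J \<mu>. \<phi> (g i) * (\<Prod>k\<in>J. x k ^ g k))
    = \<phi> 0 * monom_sym (J - {i}) \<mu> x
      + (\<Sum>e\<in>set_mset \<mu>. \<phi> e * x i ^ e * monom_sym (J - {i}) (\<mu> - {#e#}) x)"
proof -
  let ?J = "J - {i}"
  let ?\<mu> = "\<lambda>e. if e = 0 then \<mu> else \<mu> - {#e#}"
  have J': "finite ?J" "i \<notin> ?J" "insert i ?J = J" using J i by auto
  have pm: "posmset J g = (if 0 < g i then add_mset (g i) (posmset ?J g) else posmset ?J g)" for g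
    using posmset_insert[OF J'(1,2), of g] J'(3) by simp
  have "(\<Sum>g\<in>expos J \<mu>. \<phi> (g i) * (\<Prod>k\<in>J. x k ^ g k))
    = (\<Sum>(e, g)\<in>Sigma (insert 0 (set_mset \<mu>)) (\<lambda>e. expos ?J (?\<mu> e)). \<phi> e * x i ^ e * (\<Prod>k\<in>?J. x k ^ g k))"
  proof (rule sum.reindex_bij_witness[of _ "\<lambda>(e, g). g(i := e)" "\<lambda>g. (g i, g(i := 0))"], goal_cases)
    case (1 g) then show ?case by simp
  next
    case (2 g)
    then have g: "posmset J g = \<mu>" "\<And>k. k \<notin> J \<Longrightarrow> g k = 0" by (auto simp: expos_def)
    then show ?case using pm[of g] J' by (auto simp: expos_def posmset_upd)
  next
    case (3 y)
    then show ?case by (auto simp: expos_def fun_eq_iff split: if_splits)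
  next
    case (4 y)
    then obtain e g where y: "y = (e, g)" "e \<in> insert 0 (set_mset \<mu>)" "g \<in> expos ?J (?\<mu> e)" by blast
    then show ?case using pm[of "g(i := e)"] J' \<mu> i by (auto simp: expos_def posmset_upd split: if_splits)
  next
    case (5 g)
    have "(\<Prod>k\<in>J. x k ^ g k) = x i ^ g i * (\<Prod>k\<in>?J. x k ^ g k)" using J i by (rule prod.remove)
    moreover have "(\<Prod>k\<in>?J. x k ^ (g(i := 0)) k) = (\<Prod>k\<in>?J. x k ^ g k)" by (rule prod.cong) auto
    ultimately show ?case by (simp add: mult_ac)
  qed
  also have "\<dots> = (\<Sum>e\<in>insert 0 (set_mset \<mu>). \<phi> e * x i ^ e * monom_sym ?J (?\<mu> e) x)"
    by (subst sum.Sigma[symmetric]) (use J' in \<open>auto simp: finite_expos monom_sym_def sum_distrib_left\<close>)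
  also have "\<dots> = \<phi> 0 * monom_sym ?J \<mu> x + (\<Sum>e\<in>set_mset \<mu>. \<phi> e * x i ^ e * monom_sym ?J (?\<mu> e) x)"
    using \<mu> by simp
  also have "(\<Sum>e\<in>set_mset \<mu>. \<phi> e * x i ^ e * monom_sym ?J (?\<mu> e) x)
    = (\<Sum>e\<in>set_mset \<mu>. \<phi> e * x i ^ e * monom_sym ?J (\<mu> - {#e#}) x)"
    by (rule sum.cong) (use \<mu> in auto)
  finally show ?thesis .
qed

lemma monom_sym_remove:
  fixes x :: "'i \<Rightarrow> 'a::comm_ring_1"
  assumes "finite J" "i \<in> J" "0 \<notin># \<mu>"
  shows "monom_sym J \<mu> x = monom_sym (J - {i}) \<mu> x
     + (\<Sum>e\<in>set_mset \<mu>. x i ^ e * monom_sym (J - {i}) (\<mu> - {#e#}) x)"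
  using sum_expos_remove[OF assms, of "\<lambda>_. 1" x] by (simp add: monom_sym_def)

text \<open>Double counting: each exponent vector of type \<open>\<mu>\<close> has exactly
  \<open>size \<mu>\<close> indices in its support.\<close>

lemma size_mult_monom_sym:
  fixes x :: "'i \<Rightarrow> 'a::comm_ring_1"
  assumes J: "finite J" and \<mu>: "0 \<notin># \<mu>"
  shows "of_nat (size \<mu>) * monom_sym J \<mu> x
    = (\<Sum>e\<in>set_mset \<mu>. \<Sum>i\<in>J. x i ^ e * monom_sym (J - {i}) (\<mu> - {#e#}) x)"
proof -
  have "of_nat (size \<mu>) * monom_sym J \<mu> x = (\<Sum>g\<in>expos J \<mu>. \<Sum>i\<in>J. of_bool (0 < g i) * (\<Prod>k\<in>J. x k ^ g k))"
    unfolding monom_sym_def sum_distrib_left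
  proof (rule sum.cong[OF refl])
    fix g assume "g \<in> expos J \<mu>"
    then have "size \<mu> = card {i\<in>J. 0 < g i}" using size_posmset[OF J] by (auto simp: expos_def)
    then have "of_nat (size \<mu>) = (\<Sum>i\<in>J. of_bool (0 < g i) :: 'a)"
      using J by (simp add: Int_def)
    then show "of_nat (size \<mu>) * (\<Prod>k\<in>J. x k ^ g k) = (\<Sum>i\<in>J. of_bool (0 < g i) * (\<Prod>k\<in>J. x k ^ g k))"
      by (simp add: sum_distrib_right)
  qed
  also have "\<dots> = (\<Sum>i\<in>J. \<Sum>g\<in>expos J \<mu>. of_bool (0 < g i) * (\<Prod>k\<in>J. x k ^ g k))" by (rule sum.swap)
  also have "\<dots> = (\<Sum>i\<in>J. \<Sum>e\<in>set_mset \<mu>. x i ^ e * monom_sym (J - {i}) (\<mu> - {#e#}) x)"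
  proof (rule sum.cong[OF refl])
    fix i assume "i \<in> J"
    have "(\<Sum>g\<in>expos J \<mu>. of_bool (0 < g i) * (\<Prod>k\<in>J. x k ^ g k))
      = (\<Sum>e\<in>set_mset \<mu>. of_bool (0 < e) * x i ^ e * monom_sym (J - {i}) (\<mu> - {#e#}) x)"
      using sum_expos_remove[OF J \<open>i \<in> J\<close> \<mu>, of "\<lambda>e. of_bool (0 < e)" x] by simp
    also have "\<dots> = (\<Sum>e\<in>set_mset \<mu>. x i ^ e * monom_sym (J - {i}) (\<mu> - {#e#}) x)"
      by (rule sum.cong) (use \<mu> in \<open>auto intro: Suc_leI\<close>)
    finally show "(\<Sum>g\<in>expos J \<mu>. of_bool (0 < g i) * (\<Prod>k\<in>J. x k ^ g k)) = \<dots>" .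
  qed
  also have "\<dots> = (\<Sum>e\<in>set_mset \<mu>. \<Sum>i\<in>J. x i ^ e * monom_sym (J - {i}) (\<mu> - {#e#}) x)" by (rule sum.swap)
  finally show ?thesis .
qed

lemma monom_sym_empty: "finite J \<Longrightarrow> monom_sym J {#} x = 1"
proof -
  assume J: "finite J"
  have "expos J {#} = {\<lambda>_. 0}"
  proof -
    have "posmset J g = {#} \<longleftrightarrow> (\<forall>i\<in>J. g i = 0)" for g
      using size_posmset[OF J, of g] J by (auto simp flip: size_eq_0_iff_empty)
    then show ?thesis by (auto simp: expos_def fun_eq_iff)
  qed
  then show ?thesis by (simp add: monom_sym_def)
qed

text \<open>The indicator functions of the \<open>k\<close>-subsets are the exponent vectors with
  \<open>k\<close> entries 1 and no other positive entry.\<close>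

lemma elem_sym_eq_monom_sym:
  assumes J: "finite J"
  shows "elem_sym k J x = monom_sym J (replicate_mset k 1) x"
  unfolding elem_sym_def monom_sym_def
proof (rule sum.reindex_bij_witness[of _ "\<lambda>g. {i\<in>J. 0 < g i}" "\<lambda>S i. of_bool (i \<in> S)"], goal_cases)
  case (1 S) then show ?case by auto
next
  case (2 S)
  then have "filter_mset (\<lambda>e. 0 < e) (image_mset (\<lambda>i. of_bool (i \<in> S)) (mset_set J)) = image_mset (\<lambda>_. 1 :: nat) (mset_set S)"
  proof -
    have "{i\<in>J. i \<in> S} = S" using 2 by auto
    then show ?thesis using J finite_subset[of S J] 2
      by (auto simp: filter_mset_image_mset intro!: image_mset_cong)
  qed
  then show ?case using 2 J by (auto simp: expos_def posmset_def image_mset_const_eq finite_subset)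
next
  case (3 g)
  have g01: "g i = 0 \<or> g i = 1" for i
  proof (cases "i \<in> J \<and> 0 < g i")
    case True
    then have "g i \<in># posmset J g" using J by (auto simp: posmset_def)
    then show ?thesis using 3 by (auto simp: expos_def split: if_splits)
  qed (use 3 in \<open>auto simp: expos_def\<close>)
  have "of_bool (i \<in> {i\<in>J. 0 < g i}) = g i" for i
    using 3 g01[of i] by (auto simp: expos_def)
  then show ?case by (simp add: fun_eq_iff)
next
  case (4 g)
  then show ?case using size_posmset[OF J, of g] by (auto simp: expos_def)
next
  case (5 S)
  then have "(\<Prod>i\<in>S. x i) = (\<Prod>i\<in>J. if i \<in> S then x i else 1)"
    using J by (simp add: prod.inter_restrict[symmetric] Int_absorb1)
  also have "\<dots> = (\<Prod>i\<in>J. x i ^ of_bool (i \<in> S))" by (rule prod.cong) auto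
  finally show ?case by simp
qed

lemma elem_sym_remove:
  assumes "finite J" "i \<in> J"
  shows "elem_sym (Suc k) J x = elem_sym (Suc k) (J - {i}) x + x i * elem_sym k (J - {i}) x"
  using monom_sym_remove[OF assms, of "replicate_mset (Suc k) 1" x] assms
  by (simp add: elem_sym_eq_monom_sym)

lemma Suc_mult_elem_sym:
  assumes "finite J"
  shows "of_nat (Suc k) * elem_sym (Suc k) J x = (\<Sum>i\<in>J. x i * elem_sym k (J - {i}) x)"
  using size_mult_monom_sym[OF assms, of "replicate_mset (Suc k) 1" x] assms
  by (simp add: elem_sym_eq_monom_sym)

lemma elem_sym_0: "finite J \<Longrightarrow> elem_sym 0 J x = 1"
  by (simp add: elem_sym_eq_monom_sym monom_sym_empty)

lemma elem_sym_gt_card: "finite J \<Longrightarrow> card J < k \<Longrightarrow> elem_sym k J x = 0"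
proof -
  assume "finite J" "card J < k"
  then have "{S. S \<subseteq> J \<and> card S = k} = {}" using card_mono[of J] by (auto simp: not_less[symmetric])
  then show ?thesis unfolding elem_sym_def by (simp only: sum.empty)
qed

section \<open>Vieta's formula and prescribed roots\<close>

text \<open>Multiply out the product; the subset \<open>S\<close> collects the factors that
  contribute their constant term.\<close>

lemma coeff_prod_linear:
  fixes x :: "'i \<Rightarrow> 'a::comm_ring_1"
  assumes J: "finite J" and h: "h \<le> card J"
  shows "coeff (\<Prod>i\<in>J. [:- x i, 1:]) (card J - h) = (- 1) ^ h * elem_sym h J x"
proof -
  have "(\<Prod>i\<in>J. [:- x i, 1:]) = (\<Prod>i\<in>J. [:- x i:] + monom 1 1)"
    by (rule prod.cong) (auto simp: monom_altdef)
  also have "\<dots> = (\<Sum>S\<in>Pow J. (\<Prod>i\<in>S. [:- x i:]) * (\<Prod>i\<in>J - S. monom 1 1))"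
    using J by (rule prod_add)
  also have "\<dots> = (\<Sum>S\<in>Pow J. monom ((- 1) ^ card S * (\<Prod>i\<in>S. x i)) (card J - card S))"
  proof (rule sum.cong[OF refl])
    fix S assume S: "S \<in> Pow J"
    then have "finite S" using J finite_subset by auto
    then have "(\<Prod>i\<in>S. [:- x i:]) = [:(- 1) ^ card S * (\<Prod>i\<in>S. x i):]"
      by (induction S rule: finite_induct) (auto simp: mult_ac)
    moreover have "(\<Prod>i\<in>J - S. monom (1::'a) 1) = monom 1 (card J - card S)"
      using S J by (simp add: monom_power card_Diff_subset finite_subset)
    ultimately show "(\<Prod>i\<in>S. [:- x i:]) * (\<Prod>i\<in>J - S. monom 1 1) = monom ((- 1) ^ card S * (\<Prod>i\<in>S. x i)) (card J - card S)"
      by (simp add: smult_monom)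
  qed
  finally have "coeff (\<Prod>i\<in>J. [:- x i, 1:]) (card J - h)
    = (\<Sum>S\<in>Pow J. if card J - card S = card J - h then (- 1) ^ card S * (\<Prod>i\<in>S. x i) else 0)"
    by (simp add: coeff_sum)
  also have "\<dots> = (\<Sum>S | S \<subseteq> J \<and> card S = h. (- 1) ^ h * (\<Prod>i\<in>S. x i))"
  proof (rule sum.mono_neutral_cong_right)
    have *: "card S \<le> card J" if "S \<subseteq> J" for S using that J card_mono by blast
    show "\<forall>S\<in>Pow J - {S. S \<subseteq> J \<and> card S = h}.
      (if card J - card S = card J - h then (- 1) ^ card S * (\<Prod>i\<in>S. x i) else 0) = 0"
    proof
      fix S assume "S \<in> Pow J - {S. S \<subseteq> J \<and> card S = h}"
      then have "card S \<le> card J" "card S \<noteq> h" using *[of S] by auto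
      then show "(if card J - card S = card J - h then (- 1) ^ card S * (\<Prod>i\<in>S. x i) else 0) = 0"
        using h by auto
    qed
  qed (use J in auto)
  finally show ?thesis by (simp add: elem_sym_def sum_distrib_left)
qed

text \<open>Vieta's formula read backwards, applied to the roots of the monic polynomial with the
  prescribed coefficients. It makes the elementary symmetric values free parameters over the complex
  numbers.\<close>

lemma exists_roots_elem_sym:
  fixes c :: "nat \<Rightarrow> 'a::alg_closed_field"
  shows "\<exists>x :: nat \<Rightarrow> 'a. \<forall>h\<in>{1..n}. elem_sym h {..<n} x = c h"
proof -
  define P where "P = monom 1 n + (\<Sum>h=1..n. monom ((- 1) ^ h * c h) (n - h))"
  have co: "coeff P (n - h) = (- 1) ^ h * c h" if "h \<in> {1..n}" for h
  proof -
    have "coeff P (n - h) = (\<Sum>k=1..n. if n - k = n - h then (- 1) ^ k * c k else 0)"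
      using that by (auto simp: P_def coeff_sum)
    also have "\<dots> = (\<Sum>k=1..n. if k = h then (- 1) ^ k * c k else 0)"
      by (rule sum.cong) (use that in auto)
    finally show ?thesis using that by simp
  qed
  have cn: "coeff P n = 1" by (auto simp: P_def coeff_sum intro!: sum.neutral)
  have "degree P \<le> n"
    unfolding P_def by (intro degree_add_le degree_sum_le) (auto intro: order.trans[OF degree_monom_le])
  then have dP: "degree P = n" using cn by (metis le_antisym le_degree zero_neq_one)
  then have "P \<noteq> 0" and lc: "lead_coeff P = 1" using cn by auto
  then obtain A where A: "size A = degree P" "P = smult (lead_coeff P) (\<Prod>y\<in>#A. [:- y, 1:])"
    using alg_closed_imp_factorization by blast
  obtain xs where xs: "mset xs = A" using ex_mset by blast
  then have len: "length xs = n" using A dP by auto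
  have "P = (\<Prod>y\<in>#mset xs. [:- y, 1:])" using A(2) lc xs by simp
  also have "\<dots> = (\<Prod>i\<in>{..<n}. [:- (xs ! i), 1:])"
    unfolding mset_map[symmetric] prod_mset_prod_list
    by (simp add: prod.list_conv_set_nth len atLeast0LessThan)
  finally have P: "P = (\<Prod>i\<in>{..<n}. [:- (xs ! i), 1:])" .
  have "elem_sym h {..<n} ((!) xs) = c h" if "h \<in> {1..n}" for h
    using coeff_prod_linear[of "{..<n}" h "(!) xs"] co[OF that] that P
    by (simp flip: mult.assoc power_mult_distrib)
  then show ?thesis by blast
qed

section \<open>Divisibility of the coefficients\<close>

lemma digit_expansion_inj:
  fixes f g :: "nat \<Rightarrow> nat"
  assumes "(\<Sum>i<N. f i * B ^ i) = (\<Sum>i<N. g i * B ^ i)" "\<And>i. f i < B" "\<And>i. g i < B" "i < N"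
  shows "f i = g i"
  using assms
proof (induction N arbitrary: f g i)
  case (Suc N)
  have e: "(\<Sum>i<Suc N. f i * B ^ i) = f 0 + B * (\<Sum>i<N. f (Suc i) * B ^ i)" for f :: "nat \<Rightarrow> nat"
    unfolding sum.lessThan_Suc_shift by (simp add: sum_distrib_left mult_ac)
  have eq: "f 0 + B * (\<Sum>i<N. f (Suc i) * B ^ i) = g 0 + B * (\<Sum>i<N. g (Suc i) * B ^ i)"
    using Suc.prems(1) unfolding e .
  have B: "f 0 < B" "g 0 < B" using Suc.prems by auto
  have "f 0 = (f 0 + B * (\<Sum>i<N. f (Suc i) * B ^ i)) mod B" using B by simp
  also have "\<dots> = g 0" unfolding eq using B by simp
  finally have 0: "f 0 = g 0" .
  then have "(\<Sum>i<N. f (Suc i) * B ^ i) = (\<Sum>i<N. g (Suc i) * B ^ i)" using eq B by simp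
  then show ?case using Suc.IH[of "\<lambda>i. f (Suc i)" "\<lambda>i. g (Suc i)" "i - 1"] Suc.prems 0
    by (cases i) auto
qed simp

text \<open>The multiplicities of the elements are base \<open>B\<close> digits, and the bounds on
  the sizes exclude carries.\<close>

lemma sum_mset_power_inj:
  fixes M M' :: "nat multiset"
  assumes eq: "(\<Sum>h\<in>#M. B ^ h) = (\<Sum>h\<in>#M'. B ^ h)" and "size M < B" "size M' < B"
  shows "M = M'"
proof -
  obtain N where N: "\<forall>h\<in>#M + M'. h < N"
    using finite_nat_set_iff_bounded[of "set_mset (M + M')"] by auto
  have e: "(\<Sum>h\<in>#A. B ^ h) = (\<Sum>h<N. count A h * B ^ h)" if "\<forall>h\<in>#A. h < N" for A
    using that
  proof (induction A)
    case (add a A)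
    have "(\<Sum>h<N. count (add_mset a A) h * B ^ h) = (\<Sum>h<N. (if h = a then B ^ h else 0) + count A h * B ^ h)"
      by (rule sum.cong) auto
    then show ?case using add by (simp add: sum.distrib)
  qed simp
  have le: "count A h \<le> size A" for A :: "nat multiset" and h by (rule count_le_size)
  have "count M h = count M' h" for h
  proof (cases "h < N")
    case True
    show ?thesis
      by (rule digit_expansion_inj[of "count M" B N "count M'", OF _ _ _ True])
         (use eq e[of M] e[of M'] N le assms in \<open>auto intro: le_less_trans\<close>)
  next
    case False
    then show ?thesis using N by (metis not_in_iff union_iff)
  qed
  then show ?thesis by (rule multiset_eqI)
qed

section \<open>Multiples of \<open>q\<close> among integral polynomial functions\<close>

text \<open>A predicate on functions rather than polynomials, because the roots \<open>X t\<close>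
  below are chosen separately for each \<open>t\<close>. Only certain symmetric expressions in them
  turn out to be polynomial in \<open>t\<close>.\<close>

definition int_poly_fun :: "nat \<Rightarrow> (complex \<Rightarrow> complex) \<Rightarrow> bool" where
  "int_poly_fun q f \<longleftrightarrow> (\<exists>P. (\<forall>i. coeff P i \<in> \<int>) \<and> (\<forall>t. f t = of_nat q * poly P t))"

lemma int_poly_fun_cong: "int_poly_fun q f \<Longrightarrow> (\<And>t. f t = g t) \<Longrightarrow> int_poly_fun q g"
  by (auto simp: int_poly_fun_def)

lemma int_poly_fun_zero: "int_poly_fun q (\<lambda>_. 0)"
  unfolding int_poly_fun_def by (rule exI[of _ 0]) simp

lemma int_poly_fun_add: "int_poly_fun q f \<Longrightarrow> int_poly_fun q g \<Longrightarrow> int_poly_fun q (\<lambda>t. f t + g t)"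
  unfolding int_poly_fun_def
  by (elim exE conjE, rule_tac x = "P + Pa" in exI) (auto simp: algebra_simps)

lemma int_poly_fun_diff: "int_poly_fun q f \<Longrightarrow> int_poly_fun q g \<Longrightarrow> int_poly_fun q (\<lambda>t. f t - g t)"
  unfolding int_poly_fun_def
  by (elim exE conjE, rule_tac x = "P - Pa" in exI) (auto simp: algebra_simps)

lemma int_poly_fun_mult: "int_poly_fun q f \<Longrightarrow> int_poly_fun 1 g \<Longrightarrow> int_poly_fun q (\<lambda>t. f t * g t)"
  unfolding int_poly_fun_def
  by (elim exE conjE, rule_tac x = "P * Pa" in exI) (auto simp: coeff_mult intro!: Ints_sum Ints_mult)

lemma int_poly_fun_monom: "int_poly_fun q (\<lambda>t. of_nat q * (of_int a * t ^ k))"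
  unfolding int_poly_fun_def by (rule exI[of _ "monom (of_int a) k"]) (auto simp: poly_monom)

lemma int_poly_fun_of_int: "int_poly_fun 1 (\<lambda>_. of_int a)"
  using int_poly_fun_monom[of 1 a 0] by simp

lemma int_poly_fun_sum: "(\<And>i. i \<in> A \<Longrightarrow> int_poly_fun q (f i)) \<Longrightarrow> int_poly_fun q (\<lambda>t. \<Sum>i\<in>A. f i t)"
  by (induction A rule: infinite_finite_induct) (auto intro: int_poly_fun_zero int_poly_fun_add)

text \<open>
  Kronecker substitution: the polynomial with \<open>c\<^sub>h = t\<^bsup>B^h\<^esup>\<close> for \<open>q dvd h\<close>, and \<open>c\<^sub>h = 0\<close> otherwise,
  separates the coefficients \<open>d \<kappa>\<close> if \<open>B\<close> is large. All power sums of its roots are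
  divisible by \<open>q\<close> in the integral polynomials in \<open>t\<close>.
\<close>

theorem dvd_size_mult_coeff:
  fixes \<mu> :: "nat multiset"
  assumes d: "\<And>x :: nat \<Rightarrow> complex. monom_sym {..<n} \<mu> x = elem_sum {..<n} (sum_mset \<mu>) d x"
    and \<mu>: "0 \<notin># \<mu>" and \<kappa>: "\<kappa> \<in> partitions_le n (sum_mset \<mu>)" and q: "\<forall>h\<in>#\<kappa>. q dvd h"
  shows "int q dvd int (size \<mu>) * d \<kappa>"
proof -
  let ?J = "{..<n}"
  \<comment> \<open>A partition of this weight has fewer than \<open>B\<close> parts, as
    \<open>sum_mset_power_inj\<close> demands.\<close>
  define B where "B = Suc (sum_mset \<mu>)"
  define c :: "complex \<Rightarrow> nat \<Rightarrow> complex" where "c t h = (if q dvd h then t ^ (B ^ h) else 0)" for t h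
  obtain X :: "complex \<Rightarrow> nat \<Rightarrow> complex" where X: "\<And>t h. h \<in> {1..n} \<Longrightarrow> elem_sym h ?J (X t) = c t h"
    using exists_roots_elem_sym[of n "c _"] by metis
  have e1: "int_poly_fun 1 (\<lambda>t. elem_sym h ?J (X t))" for h
  proof -
    consider "h = 0" | "n < h" | "h \<in> {1..n}" "q dvd h" | "h \<in> {1..n}" "\<not> q dvd h" by force
    then show ?thesis
    proof cases
      case 1 then show ?thesis using int_poly_fun_of_int[of 1] by (simp add: elem_sym_0)
    next
      case 2 then show ?thesis by (simp add: elem_sym_gt_card int_poly_fun_zero)
    next
      case 3 then show ?thesis using int_poly_fun_monom[of 1 1 "B ^ h"] X by (simp add: c_def)
    next
      case 4 then show ?thesis using X by (simp add: c_def int_poly_fun_zero)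
    qed
  qed
  have eprod: "int_poly_fun 1 (\<lambda>t. elem_prod ?J \<kappa> (X t))" for \<kappa>
  proof (induction \<kappa>)
    case empty then show ?case using int_poly_fun_of_int[of 1] by (simp add: elem_prod_def)
  next
    case (add h \<kappa>)
    from int_poly_fun_mult[OF e1 this] show ?case by (simp add: elem_prod_def)
  qed
  have m1: "int_poly_fun 1 (\<lambda>t. monom_sym ?J \<mu> (X t))" for \<mu>
  proof -
    obtain d where "\<And>x :: nat \<Rightarrow> complex. monom_sym ?J \<mu> x = elem_sum ?J (sum_mset \<mu>) d x"
      using monom_sym_eq_elem_sum[where ?'a = complex and ?'b = complex, of ?J \<mu>] by blast
    then show ?thesis
      unfolding elem_sum_def
      by (auto simp del: One_nat_def intro!: int_poly_fun_sum int_poly_fun_mult int_poly_fun_of_int eprod)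
  qed
  \<comment> \<open>Newton's recursion on the exponent. For \<open>f = 0\<close> the sum is
    \<open>Suc k\<close> times \<open>elem_sym (Suc k)\<close>, which vanishes unless
    \<open>q\<close> divides \<open>Suc k\<close>. For larger \<open>f\<close> one factor is
    absorbed by \<open>elem_sym_remove\<close>; the power sum appearing there is the instance
    \<open>k = 0\<close>, since \<open>elem_sym 0\<close> is 1.\<close>
  have Phi: "int_poly_fun q (\<lambda>t. \<Sum>i\<in>?J. X t i ^ Suc f * elem_sym k (?J - {i}) (X t))" for f k
  proof (induction f arbitrary: k)
    case 0
    have "int_poly_fun q (\<lambda>t. of_nat (Suc k) * elem_sym (Suc k) ?J (X t))"
    proof (cases "Suc k \<in> {1..n} \<and> q dvd Suc k")
      case True
      then obtain b where b: "Suc k = q * b" by blast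
      show ?thesis
        by (rule int_poly_fun_cong[OF int_poly_fun_monom[of q "int b" "B ^ Suc k"]])
           (use True X[of "Suc k"] in \<open>simp add: c_def b mult_ac flip: of_nat_mult\<close>)
    next
      case False
      then have "elem_sym (Suc k) ?J (X t) = 0" for t
        using X[of "Suc k" t] by (cases "Suc k \<le> n") (auto simp: c_def elem_sym_gt_card)
      then show ?thesis by (simp add: int_poly_fun_zero)
    qed
    then show ?case by (simp add: Suc_mult_elem_sym del: of_nat_Suc)
  next
    case (Suc f)
    have "int_poly_fun q (\<lambda>t. (\<Sum>i\<in>?J. X t i ^ Suc f * elem_sym 0 (?J - {i}) (X t)) * elem_sym (Suc k) ?J (X t)
        - (\<Sum>i\<in>?J. X t i ^ Suc f * elem_sym (Suc k) (?J - {i}) (X t)))"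
      by (intro int_poly_fun_diff int_poly_fun_mult Suc.IH e1)
    then show ?case
    proof (rule int_poly_fun_cong)
      fix t
      have "(\<Sum>i\<in>?J. X t i ^ Suc f * elem_sym 0 (?J - {i}) (X t)) * elem_sym (Suc k) ?J (X t)
        = (\<Sum>i\<in>?J. X t i ^ Suc f * (elem_sym (Suc k) (?J - {i}) (X t) + X t i * elem_sym k (?J - {i}) (X t)))"
        unfolding sum_distrib_right
        by (rule sum.cong) (auto simp: elem_sym_0 elem_sym_remove[symmetric] simp del: power_Suc)
      then show "(\<Sum>i\<in>?J. X t i ^ Suc f * elem_sym 0 (?J - {i}) (X t)) * elem_sym (Suc k) ?J (X t)
        - (\<Sum>i\<in>?J. X t i ^ Suc f * elem_sym (Suc k) (?J - {i}) (X t))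
        = (\<Sum>i\<in>?J. X t i ^ Suc (Suc f) * elem_sym k (?J - {i}) (X t))"
        by (simp add: distrib_left sum.distrib mult_ac)
    qed
  qed
  \<comment> \<open>The same recursion with \<open>monom_sym_remove\<close>: smaller multisets
    appear with higher powers, so the induction is on the size and \<open>f\<close> stays
    arbitrary.\<close>
  have Psi: "0 \<notin># \<mu> \<Longrightarrow> int_poly_fun q (\<lambda>t. \<Sum>i\<in>?J. X t i ^ Suc f * monom_sym (?J - {i}) \<mu> (X t))" for f \<mu>
  proof (induction "size \<mu>" arbitrary: \<mu> f rule: less_induct)
    case less
    have "int_poly_fun q (\<lambda>t. (\<Sum>i\<in>?J. X t i ^ Suc f * elem_sym 0 (?J - {i}) (X t)) * monom_sym ?J \<mu> (X t)
        - (\<Sum>e\<in>set_mset \<mu>. \<Sum>i\<in>?J. X t i ^ Suc (f + e) * monom_sym (?J - {i}) (\<mu> - {#e#}) (X t)))"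
    proof (intro int_poly_fun_diff int_poly_fun_mult int_poly_fun_sum[of "set_mset \<mu>"] Phi m1)
      fix e assume "e \<in># \<mu>"
      then show "int_poly_fun q (\<lambda>t. \<Sum>i\<in>?J. X t i ^ Suc (f + e) * monom_sym (?J - {i}) (\<mu> - {#e#}) (X t))"
        using less.prems by (intro less.hyps) (auto simp: size_Diff1_less dest: in_diffD)
    qed
    then show ?case
    proof (rule int_poly_fun_cong)
      fix t
      have "(\<Sum>i\<in>?J. X t i ^ Suc f * elem_sym 0 (?J - {i}) (X t)) * monom_sym ?J \<mu> (X t)
        = (\<Sum>i\<in>?J. X t i ^ Suc f * (monom_sym (?J - {i}) \<mu> (X t)
            + (\<Sum>e\<in>set_mset \<mu>. X t i ^ e * monom_sym (?J - {i}) (\<mu> - {#e#}) (X t))))"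
        unfolding sum_distrib_right
        by (rule sum.cong) (auto simp: elem_sym_0 monom_sym_remove[symmetric] less.prems simp del: power_Suc)
      also have "\<dots> = (\<Sum>i\<in>?J. X t i ^ Suc f * monom_sym (?J - {i}) \<mu> (X t))
        + (\<Sum>i\<in>?J. \<Sum>e\<in>set_mset \<mu>. X t i ^ Suc (f + e) * monom_sym (?J - {i}) (\<mu> - {#e#}) (X t))"
        by (simp add: distrib_left sum.distrib sum_distrib_left power_add mult_ac)
      also have "(\<Sum>i\<in>?J. \<Sum>e\<in>set_mset \<mu>. X t i ^ Suc (f + e) * monom_sym (?J - {i}) (\<mu> - {#e#}) (X t))
        = (\<Sum>e\<in>set_mset \<mu>. \<Sum>i\<in>?J. X t i ^ Suc (f + e) * monom_sym (?J - {i}) (\<mu> - {#e#}) (X t))"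
        by (rule sum.swap)
      finally show "(\<Sum>i\<in>?J. X t i ^ Suc f * elem_sym 0 (?J - {i}) (X t)) * monom_sym ?J \<mu> (X t)
        - (\<Sum>e\<in>set_mset \<mu>. \<Sum>i\<in>?J. X t i ^ Suc (f + e) * monom_sym (?J - {i}) (\<mu> - {#e#}) (X t))
        = (\<Sum>i\<in>?J. X t i ^ Suc f * monom_sym (?J - {i}) \<mu> (X t))" by simp
    qed
  qed
  \<comment> \<open>By \<open>size_mult_monom_sym\<close>; every part \<open>e\<close> is positive,
    so each inner sum is covered by \<open>Psi\<close>.\<close>
  have "int_poly_fun q (\<lambda>t. of_nat (size \<mu>) * monom_sym ?J \<mu> (X t))"
  proof -
    have "int_poly_fun q (\<lambda>t. \<Sum>e\<in>set_mset \<mu>. \<Sum>i\<in>?J. X t i ^ e * monom_sym (?J - {i}) (\<mu> - {#e#}) (X t))"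
    proof (rule int_poly_fun_sum)
      fix e assume e: "e \<in> set_mset \<mu>"
      then obtain f where "e = Suc f" using \<mu> by (cases e) auto
      then show "int_poly_fun q (\<lambda>t. \<Sum>i\<in>?J. X t i ^ e * monom_sym (?J - {i}) (\<mu> - {#e#}) (X t))"
        using Psi[of "\<mu> - {#e#}" f] \<mu> by (auto dest: in_diffD)
    qed
    then show ?thesis by (simp add: size_mult_monom_sym \<mu>)
  qed
  then obtain P where P: "\<And>i. coeff P i \<in> \<int>" "\<And>t. of_nat (size \<mu>) * monom_sym ?J \<mu> (X t) = of_nat q * poly P t"
    unfolding int_poly_fun_def by blast
  let ?S = "{\<kappa> \<in> partitions_le n (sum_mset \<mu>). \<forall>h\<in>#\<kappa>. q dvd h}"
  let ?w = "\<lambda>\<kappa>. (\<Sum>h\<in>#\<kappa>. B ^ h)"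
  have ep: "elem_prod ?J \<kappa> (X t) = (if \<forall>h\<in>#\<kappa>. q dvd h then t ^ ?w \<kappa> else 0)"
    if "set_mset \<kappa> \<subseteq> {1..n}" for \<kappa> t
    using that by (induction \<kappa>) (auto simp: elem_prod_def X c_def power_add)
  have ms: "monom_sym ?J \<mu> (X t) = (\<Sum>\<kappa>\<in>?S. of_int (d \<kappa>) * t ^ ?w \<kappa>)" for t
    unfolding d elem_sum_def
    by (rule sum.mono_neutral_cong_right) (use finite_partitions_le in \<open>auto simp: ep partitions_le_def\<close>)
  \<comment> \<open>The left side as a polynomial. Since it agrees with \<open>q\<close> times
    \<open>P\<close> at every complex \<open>t\<close>, the coefficients can be compared, and the
    exponents \<open>?w \<kappa>\<close> keep different partitions apart.\<close>
  define Q :: "complex poly" where "Q = (\<Sum>\<kappa>\<in>?S. monom (of_nat (size \<mu>) * of_int (d \<kappa>)) (?w \<kappa>))"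
  have "poly Q t = poly (smult (of_nat q) P) t" for t
  proof -
    have "poly Q t = of_nat (size \<mu>) * monom_sym ?J \<mu> (X t)"
      unfolding ms Q_def poly_sum by (simp add: poly_monom sum_distrib_left mult_ac)
    then show ?thesis using P(2) by simp
  qed
  then have "Q = smult (of_nat q) P" using poly_eq_poly_eq_iff by blast
  moreover have "coeff Q (?w \<kappa>) = of_nat (size \<mu>) * of_int (d \<kappa>)"
  proof -
    have sz: "size \<kappa> < B" if "\<kappa> \<in> ?S" for \<kappa>
    proof -
      have "\<forall>e\<in>#\<kappa>. 0 < e" using that by (force simp: partitions_le_def)
      then show ?thesis using that size_le_sum_mset[of \<kappa>] by (simp add: partitions_le_def B_def)
    qed
    have \<kappa>S: "\<kappa> \<in> ?S" using \<kappa> q by simp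
    have "coeff Q (?w \<kappa>) = (\<Sum>\<kappa>'\<in>?S. if ?w \<kappa>' = ?w \<kappa> then of_nat (size \<mu>) * of_int (d \<kappa>') else 0)"
      by (simp add: Q_def coeff_sum)
    also have "\<dots> = (\<Sum>\<kappa>'\<in>?S. if \<kappa>' = \<kappa> then of_nat (size \<mu>) * of_int (d \<kappa>') else 0)"
      by (rule sum.cong) (use sum_mset_power_inj sz \<kappa>S in auto)
    also have "\<dots> = of_nat (size \<mu>) * of_int (d \<kappa>)"
      using \<kappa>S by (subst sum.delta) (auto simp: finite_partitions_le)
    finally show ?thesis .
  qed
  ultimately have eq: "of_nat (size \<mu>) * of_int (d \<kappa>) = of_nat q * coeff P (?w \<kappa>)" by (metis coeff_smult)
  obtain b where "coeff P (?w \<kappa>) = of_int b" using P(1) Ints_cases by metis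
  with eq have "complex_of_int (int (size \<mu>) * d \<kappa>) = of_int (int q * b)" by simp
  then have "int (size \<mu>) * d \<kappa> = int q * b" by (simp only: of_int_eq_iff)
  then show ?thesis by simp
qed

section \<open>The leading coefficient\<close>

text \<open>Written as a logarithmic derivative, so that the exponents \<open>g\<close> stay intact
  and no case distinction for zero exponents is required.\<close>

lemma has_field_derivative_prod_linear:
  fixes z y :: "'i \<Rightarrow> complex"
  assumes "finite J" "\<And>i. i \<in> J \<Longrightarrow> z i \<noteq> 0"
  shows "((\<lambda>t. \<Prod>i\<in>J. (z i + t * y i) ^ g i) has_field_derivative
           (\<Sum>i\<in>J. of_nat (g i) * (y i / z i) * (\<Prod>k\<in>J. z k ^ g k))) (at 0)"
  using assms
proof (induction J rule: finite_induct)
  case (insert a J)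
  have "((\<lambda>t. (z a + t * y a) ^ g a) has_field_derivative of_nat (g a) * (y a / z a) * z a ^ g a) (at 0)"
  proof -
    have "((\<lambda>t. z a + t * y a) has_field_derivative y a) (at 0)" by (auto intro!: derivative_eq_intros)
    from DERIV_power[OF this, of "g a"] show ?thesis
      by (cases "g a") (simp_all add: insert.prems mult_ac)
  qed
  from DERIV_mult[OF this insert.IH] insert show ?case
    by (simp add: sum_distrib_left sum_distrib_right algebra_simps)
qed simp

text \<open>Differentiate each monomial and regroup by the variable, using
  \<open>sum_expos_remove\<close> with weight \<open>of_nat\<close>.\<close>

lemma has_field_derivative_monom_sym:
  fixes z y :: "'i \<Rightarrow> complex"
  assumes J: "finite J" and z: "\<And>i. i \<in> J \<Longrightarrow> z i \<noteq> 0" and \<mu>: "0 \<notin># \<mu>"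
  shows "((\<lambda>t. monom_sym J \<mu> (\<lambda>i. z i + t * y i)) has_field_derivative
           (\<Sum>i\<in>J. y i / z i * (\<Sum>e\<in>set_mset \<mu>. of_nat e * z i ^ e * monom_sym (J - {i}) (\<mu> - {#e#}) z))) (at 0)"
proof -
  have "((\<lambda>t. monom_sym J \<mu> (\<lambda>i. z i + t * y i)) has_field_derivative
     (\<Sum>g\<in>expos J \<mu>. \<Sum>i\<in>J. of_nat (g i) * (y i / z i) * (\<Prod>k\<in>J. z k ^ g k))) (at 0)"
    unfolding monom_sym_def by (intro DERIV_sum has_field_derivative_prod_linear J z)
  also have "(\<Sum>g\<in>expos J \<mu>. \<Sum>i\<in>J. of_nat (g i) * (y i / z i) * (\<Prod>k\<in>J. z k ^ g k))
    = (\<Sum>i\<in>J. \<Sum>g\<in>expos J \<mu>. of_nat (g i) * (y i / z i) * (\<Prod>k\<in>J. z k ^ g k))" by (rule sum.swap)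
  also have "\<dots> = (\<Sum>i\<in>J. y i / z i * (\<Sum>g\<in>expos J \<mu>. of_nat (g i) * (\<Prod>k\<in>J. z k ^ g k)))"
    by (simp add: sum_distrib_left mult_ac)
  also have "\<dots> = (\<Sum>i\<in>J. y i / z i * (\<Sum>e\<in>set_mset \<mu>. of_nat e * z i ^ e * monom_sym (J - {i}) (\<mu> - {#e#}) z))"
    using sum_expos_remove[OF J _ \<mu>, of _ of_nat z] by (intro sum.cong) auto
  finally show ?thesis .
qed

lemma has_field_derivative_elem_sym:
  fixes z y :: "'i \<Rightarrow> complex"
  assumes J: "finite J" and z: "\<And>i. i \<in> J \<Longrightarrow> z i \<noteq> 0"
  shows "((\<lambda>t. elem_sym (Suc k) J (\<lambda>i. z i + t * y i)) has_field_derivative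
           (\<Sum>i\<in>J. y i * elem_sym k (J - {i}) z)) (at 0)"
proof -
  have "(\<Sum>i\<in>J. y i / z i * (\<Sum>e\<in>set_mset (replicate_mset (Suc k) 1). of_nat e * z i ^ e * monom_sym (J - {i}) (replicate_mset (Suc k) 1 - {#e#}) z))
    = (\<Sum>i\<in>J. y i * elem_sym k (J - {i}) z)"
    by (rule sum.cong) (use J z in \<open>auto simp: elem_sym_eq_monom_sym\<close>)
  moreover have "0 \<notin># replicate_mset (Suc k) (1::nat)" by auto
  ultimately show ?thesis
    using has_field_derivative_monom_sym[where z = z and y = y and J = J and \<mu> = "replicate_mset (Suc k) 1"] J z
    by (simp only: elem_sym_eq_monom_sym[OF J, of "Suc k"]) auto
qed

text \<open>With at most one part below \<open>n\<close>, reduction modulo \<open>n\<close> would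
  make that part \<open>k\<close>. Two such parts matter because a product with two vanishing
  factors has derivative zero.\<close>

lemma partition_two_small_parts:
  assumes \<kappa>: "\<kappa> \<in> partitions_le n (k + t * n)" and k: "0 < k" "k < n"
    and ne: "\<kappa> \<noteq> add_mset k (replicate_mset t n)"
  obtains a b \<kappa>' where "\<kappa> = add_mset a (add_mset b \<kappa>')" "0 < a" "a < n" "0 < b" "b < n"
proof -
  let ?F = "filter_mset (\<lambda>h. h \<noteq> n) \<kappa>"
  have sp: "\<kappa> = ?F + replicate_mset (count \<kappa> n) n"
    using multiset_partition[of \<kappa> "\<lambda>h. h \<noteq> n"] by (simp add: filter_eq_replicate_mset[of n])
  have sub: "0 < h \<and> h \<le> n" if "h \<in># \<kappa>" for h using \<kappa> that by (force simp: partitions_le_def)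
  have sm: "sum_mset \<kappa> = sum_mset ?F + count \<kappa> n * n"
    by (subst sp) (simp add: sum_mset_replicate_mset)
  have w: "sum_mset \<kappa> = k + t * n" using \<kappa> by (simp add: partitions_le_def)
  show ?thesis
  proof (cases "size ?F")
    case 0
    then have "?F = {#}" by (simp only: size_eq_0_iff_empty)
    then have "count \<kappa> n * n = k + t * n" using sm w by (simp only: sum_mset.empty)
    then have "n dvd k + t * n" by (metis dvd_triv_right)
    then have "n dvd k" by (simp add: dvd_add_left_iff)
    then show ?thesis using k by (auto dest: dvd_imp_le)
  next
    case (Suc s)
    then obtain a F' where F': "?F = add_mset a F'" using size_eq_Suc_imp_eq_union by blast
    have "a \<in># ?F" using F' by simp
    then have a: "0 < a" "a < n" using sub[of a] by (auto simp: order_le_less)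
    show ?thesis
    proof (cases "F' = {#}")
      case True
      then have eq: "a + count \<kappa> n * n = k + t * n" using sm w by (simp add: F' True)
      then have "(a + count \<kappa> n * n) mod n = (k + t * n) mod n" by simp
      then have "a = k" using a k by simp
      moreover then have "count \<kappa> n = t" using eq k by simp
      ultimately have "\<kappa> = add_mset k (replicate_mset t n)" using sp F' True by simp
      then show ?thesis using ne by simp
    next
      case False
      then obtain b F'' where F'': "F' = add_mset b F''" by (metis multiset_cases)
      have "b \<in># ?F" using F' F'' by simp
      then have b: "0 < b" "b < n" using sub[of b] by (auto simp: order_le_less)
      have "\<kappa> = add_mset a (add_mset b (F'' + replicate_mset (count \<kappa> n) n))"
        using sp F' F'' by simp
      then show ?thesis using a b that by blast
    qed
  qed
qed

text \<open>
  Differentiate \<open>m\<^sub>\<mu>(z\<^sub>i + t z\<^sub>i\<^bsup>1-k\<^esup>)\<close> at \<open>t = 0\<close>, where the \<open>z\<^sub>i\<close> are the \<open>n\<close>-th roots of unity. Among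
  the products \<open>c\<^sub>\<kappa>\<close> of the relevant weight, only \<open>\<kappa> = (k, n, \<dots>, n)\<close> has a nonzero derivative.
\<close>

theorem leading_coeff_not_dvd:
  fixes p n \<nu> k r s h t i1 :: nat
  assumes d: "\<And>x :: nat \<Rightarrow> complex. monom_sym {..<n} \<mu> x = elem_sum {..<n} (sum_mset \<mu>) d x"
    and \<mu>: "\<mu> = replicate_mset (h - s) r + replicate_mset s i1"
    and p: "prime p" "p ^ \<nu> dvd n" and k: "0 < k" "k < n"
    and ri: "0 < r" "0 < i1" "r \<noteq> i1" and h: "0 < s" "s < h" "h \<le> p ^ \<nu>"
    and w: "sum_mset \<mu> = k + t * n"
    and nd: "\<not> int p dvd int r * int ((h - 1) choose s) + int i1 * int ((h - 1) choose (s - 1))"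
  shows "\<not> int p dvd d (add_mset k (replicate_mset t n))"
proof -
  let ?J = "{..<n}"
  have n: "0 < n" using k by simp
  \<comment> \<open>These elementary symmetric values belong to \<open>X^n - 1\<close>, so the
    \<open>z i\<close> are the \<open>n\<close>-th roots of unity.\<close>
  obtain z :: "nat \<Rightarrow> complex" where
    z: "\<And>h. h \<in> {1..n} \<Longrightarrow> elem_sym h ?J z = (if h = n then (- 1) ^ (n + 1) else 0)"
    using exists_roots_elem_sym[of n "\<lambda>h. if h = n then (- 1) ^ (n + 1) else 0"] by blast
  \<comment> \<open>The elementary symmetric polynomials of all roots vanish in degrees strictly
    between 0 and \<open>n\<close>, so each step of the removal recursion multiplies by
    \<open>- z i\<close>.\<close>
  have rem: "elem_sym l (?J - {i}) z = (- z i) ^ l" if "i < n" "l < n" for i l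
    using that(2)
  proof (induction l)
    case (Suc l)
    then show ?case using elem_sym_remove[of ?J i l z] z[of "Suc l"] that by (simp add: eq_neg_iff_add_eq_0)
  qed (simp add: elem_sym_0)
  have zn: "z i ^ n = 1" if i: "i < n" for i
  proof -
    obtain n' where n': "n = Suc n'" using n by (cases n) auto
    have "elem_sym n (?J - {i}) z = 0" using i by (intro elem_sym_gt_card) auto
    then have "z i * (- z i) ^ n' = (- 1) ^ (n + 1)"
      using elem_sym_remove[of ?J i n' z] z[of n] rem[OF i, of n'] i n' by simp
    moreover have "(- z i) ^ n' = (- 1) ^ n' * z i ^ n'" by (rule power_minus)
    ultimately have "(- 1) ^ n' * z i ^ n = (- 1) ^ n'" using n' by simp
    then show ?thesis by simp
  qed
  then have z0: "z i \<noteq> 0" if "i < n" for i using that n by (metis power_0_left zero_neq_one less_irrefl)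
  let ?\<mu> = "\<lambda>u v. replicate_mset u r + replicate_mset v i1"
  have \<mu>0: "0 \<notin># ?\<mu> u v" for u v using ri by (auto split: if_splits)
  have sm: "sum_mset (?\<mu> u v) = u * r + v * i1" for u v by (simp add: sum_mset_replicate_mset)
  \<comment> \<open>At the roots of unity only products of \<open>elem_sym n\<close> survive. Hence
    the value is zero unless \<open>n\<close> divides the weight, and the factor \<open>z i\<close>
    to the weight may be inserted. As \<open>p ^ \<nu>\<close> divides \<open>n\<close> but not the
    smaller positive number \<open>u + v\<close>, \<open>dvd_size_mult_coeff\<close> makes
    \<open>p\<close> divide every contributing coefficient.\<close>
  have full: "\<exists>a. (\<forall>i<n. monom_sym ?J (?\<mu> u v) z = z i ^ (u * r + v * i1) * of_int a) \<and> int p dvd a"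
    if uv: "0 < u + v" "u + v < p ^ \<nu>" for u v
  proof -
    obtain d where d: "\<And>x :: nat \<Rightarrow> complex. monom_sym ?J (?\<mu> u v) x = elem_sum ?J (sum_mset (?\<mu> u v)) d x"
      by (rule monom_sym_eq_elem_sum[where ?'a = complex and ?'b = complex, OF finite_lessThan]) (rule that)
    let ?S = "{\<kappa>\<in>partitions_le n (u * r + v * i1). set_mset \<kappa> \<subseteq> {n}}"
    define a where "a = (\<Sum>\<kappa>\<in>?S. d \<kappa> * ((- 1) ^ (n + 1)) ^ size \<kappa>)"
    have ep: "elem_prod ?J \<kappa> z = (if set_mset \<kappa> \<subseteq> {n} then ((- 1) ^ (n + 1)) ^ size \<kappa> else 0)"
      if "set_mset \<kappa> \<subseteq> {1..n}" for \<kappa>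
      using that by (induction \<kappa>) (auto simp: elem_prod_def z)
    have ms: "monom_sym ?J (?\<mu> u v) z = of_int a"
      unfolding d elem_sum_def sm a_def of_int_sum
      by (rule sum.mono_neutral_cong_right) (use finite_partitions_le in \<open>auto simp: ep partitions_le_def\<close>)
    have "of_int a = z i ^ (u * r + v * i1) * of_int a" if "i < n" for i
    proof (cases "?S = {}")
      case True
      then have "a = 0" unfolding a_def by (simp only: sum.empty)
      then show ?thesis by simp
    next
      case False
      then obtain \<kappa> where \<kappa>: "set_mset \<kappa> \<subseteq> {n}" "sum_mset \<kappa> = u * r + v * i1" by (auto simp: partitions_le_def)
      have "n dvd sum_mset \<kappa>" using \<kappa>(1) by (induction \<kappa>) auto
      then obtain b where "u * r + v * i1 = n * b" using \<kappa>(2) by auto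
      then show ?thesis using zn[OF that] by (simp add: power_mult)
    qed
    moreover have "int p dvd a"
      unfolding a_def
    proof (rule dvd_sum)
      fix \<kappa> assume \<kappa>: "\<kappa> \<in> ?S"
      have "\<forall>h\<in>#\<kappa>. p ^ \<nu> dvd h" using \<kappa> p(2) by auto
      then have "int (p ^ \<nu>) dvd int (size (?\<mu> u v)) * d \<kappa>"
        using \<kappa> sm by (intro dvd_size_mult_coeff[OF d \<mu>0]) auto
      then have *: "int p ^ \<nu> dvd int (u + v) * d \<kappa>" by simp
      have "int p dvd d \<kappa>"
      proof (rule ccontr)
        assume "\<not> int p dvd d \<kappa>"
        then have "coprime (int p ^ \<nu>) (d \<kappa>)"
          using p(1) by (simp add: prime_imp_coprime coprime_power_left_iff)
        then have "int (p ^ \<nu>) dvd int (u + v)" using * by (simp add: coprime_dvd_mult_left_iff)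
        then have "p ^ \<nu> dvd u + v" by (simp only: int_dvd_int_iff)
        then show False using uv by (auto dest: dvd_imp_le)
      qed
      then show "int p dvd d \<kappa> * ((- 1) ^ (n + 1)) ^ size \<kappa>" by simp
    qed
    ultimately show ?thesis using ms by metis
  qed
  \<comment> \<open>Modulo \<open>p\<close> the symmetric function of all roots drops out of the
    removal recursion. What remains is Pascal's rule with alternating signs.\<close>
  have part: "\<exists>a. (\<forall>i<n. monom_sym (?J - {i}) (?\<mu> u v) z = z i ^ (u * r + v * i1) * of_int a)
      \<and> [a = (- 1) ^ (u + v) * int ((u + v) choose v)] (mod int p)"
    if "u + v < p ^ \<nu>" for u v
    using that
  proof (induction "u + v" arbitrary: u v)
    case 0
    then show ?case by (intro exI[of _ 1]) (auto simp: monom_sym_empty)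
  next
    case (Suc N)
    obtain a where a: "\<And>i. i < n \<Longrightarrow> monom_sym ?J (?\<mu> u v) z = z i ^ (u * r + v * i1) * of_int a" "int p dvd a"
    proof -
      have "0 < u + v" using Suc.hyps(2) by linarith
      from full[OF this Suc.prems] show ?thesis using that by blast
    qed
    \<comment> \<open>The contributions of taking away a part \<open>r\<close> (here) and a part
      \<open>i1\<close> (below), each set to zero when no such part is left.\<close>
    have "\<exists>b. (\<forall>i<n. (if 0 < u then z i ^ r * monom_sym (?J - {i}) (?\<mu> (u - 1) v) z else 0) = z i ^ (u * r + v * i1) * of_int b)
      \<and> [b = (- 1) ^ N * int (if 0 < u then N choose v else 0)] (mod int p)"
    proof (cases u)
      case (Suc u')
      obtain b where "\<And>i. i < n \<Longrightarrow> monom_sym (?J - {i}) (?\<mu> u' v) z = z i ^ (u' * r + v * i1) * of_int b"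
        "[b = (- 1) ^ N * int (N choose v)] (mod int p)"
        using Suc.hyps(1)[of u' v] Suc.hyps(2) Suc.prems Suc by auto
      then show ?thesis using Suc by (intro exI[of _ b]) (auto simp: power_add mult_ac)
    qed (auto intro!: exI[of _ 0])
    then obtain b where b: "\<And>i. i < n \<Longrightarrow> (if 0 < u then z i ^ r * monom_sym (?J - {i}) (?\<mu> (u - 1) v) z else 0) = z i ^ (u * r + v * i1) * of_int b"
       "[b = (- 1) ^ N * int (if 0 < u then N choose v else 0)] (mod int p)" by blast
    have "\<exists>c. (\<forall>i<n. (if 0 < v then z i ^ i1 * monom_sym (?J - {i}) (?\<mu> u (v - 1)) z else 0) = z i ^ (u * r + v * i1) * of_int c)
      \<and> [c = (- 1) ^ N * int (if 0 < v then N choose (v - 1) else 0)] (mod int p)"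
    proof (cases v)
      case (Suc v')
      obtain c where "\<And>i. i < n \<Longrightarrow> monom_sym (?J - {i}) (?\<mu> u v') z = z i ^ (u * r + v' * i1) * of_int c"
        "[c = (- 1) ^ N * int (N choose v')] (mod int p)"
        using Suc.hyps(1)[of u v'] Suc.hyps(2) Suc.prems Suc by auto
      then show ?thesis using Suc by (intro exI[of _ c]) (auto simp: power_add mult_ac)
    qed (auto intro!: exI[of _ 0])
    then obtain c where c: "\<And>i. i < n \<Longrightarrow> (if 0 < v then z i ^ i1 * monom_sym (?J - {i}) (?\<mu> u (v - 1)) z else 0) = z i ^ (u * r + v * i1) * of_int c"
       "[c = (- 1) ^ N * int (if 0 < v then N choose (v - 1) else 0)] (mod int p)" by blast
    have "monom_sym (?J - {i}) (?\<mu> u v) z = z i ^ (u * r + v * i1) * of_int (a - b - c)" if i: "i < n" for i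
    proof -
      have "(\<Sum>e\<in>set_mset (?\<mu> u v). z i ^ e * monom_sym (?J - {i}) (?\<mu> u v - {#e#}) z)
        = (if 0 < u then z i ^ r * monom_sym (?J - {i}) (?\<mu> (u - 1) v) z else 0)
        + (if 0 < v then z i ^ i1 * monom_sym (?J - {i}) (?\<mu> u (v - 1)) z else 0)"
      proof -
        have "set_mset (?\<mu> u v) = (if 0 < u then {r} else {}) \<union> (if 0 < v then {i1} else {})" by auto
        moreover have "0 < u \<Longrightarrow> ?\<mu> u v - {#r#} = ?\<mu> (u - 1) v" by (cases u) auto
        moreover have "0 < v \<Longrightarrow> ?\<mu> u v - {#i1#} = ?\<mu> u (v - 1)" by (cases v) auto
        ultimately show ?thesis using ri by (cases "0 < u"; cases "0 < v") simp_all
      qed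
      also have "\<dots> = z i ^ (u * r + v * i1) * of_int (b + c)" using b(1)[OF i] c(1)[OF i] by (simp add: distrib_left)
      finally show ?thesis using monom_sym_remove[of ?J i "?\<mu> u v" z] \<mu>0 i a(1)[OF i]
        by (simp add: algebra_simps)
    qed
    moreover have "[a - b - c = (- 1) ^ (u + v) * int ((u + v) choose v)] (mod int p)"
    proof -
      have "[a - b - c = 0 - (- 1) ^ N * int (if 0 < u then N choose v else 0)
         - (- 1) ^ N * int (if 0 < v then N choose (v - 1) else 0)] (mod int p)"
        using a(2) by (intro cong_diff b(2) c(2)) (simp add: cong_0_iff)
      also have "0 - (- 1) ^ N * int (if 0 < u then N choose v else 0)
         - (- 1) ^ N * int (if 0 < v then N choose (v - 1) else 0) = (- 1) ^ (u + v) * int ((u + v) choose v)"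
      proof -
        \<comment> \<open>Without parts \<open>r\<close> one has \<open>v = Suc N\<close>, so the
          default value 0 agrees with the binomial coefficient.\<close>
        have "N choose v = 0" if "u = 0" using that Suc.hyps(2) by (simp add: binomial_eq_0)
        then show ?thesis unfolding Suc.hyps(2)[symmetric]
          by (cases v) (auto simp: algebra_simps)
      qed
      finally show ?thesis .
    qed
    ultimately show ?case by blast
  qed
  have hs: "(h - s - 1) + s < p ^ \<nu>" "(h - s) + (s - 1) < p ^ \<nu>" "(h - s - 1) + s = h - 1" "(h - s) + (s - 1) = h - 1"
    using h by auto
  obtain a where a: "\<And>i. i < n \<Longrightarrow> monom_sym (?J - {i}) (?\<mu> (h - s - 1) s) z = z i ^ ((h - s - 1) * r + s * i1) * of_int a"
     "[a = (- 1) ^ (h - 1) * int ((h - 1) choose s)] (mod int p)"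
    using part[OF hs(1)] unfolding hs(3) by blast
  obtain b where b: "\<And>i. i < n \<Longrightarrow> monom_sym (?J - {i}) (?\<mu> (h - s) (s - 1)) z = z i ^ ((h - s) * r + (s - 1) * i1) * of_int b"
     "[b = (- 1) ^ (h - 1) * int ((h - 1) choose (s - 1))] (mod int p)"
    using part[OF hs(2)] unfolding hs(4) by blast
  \<comment> \<open>The direction \<open>z i ^ (1 - k)\<close> cancels the power
    \<open>z i ^ k\<close> in the logarithmic derivative, so all \<open>n\<close> summands become
    equal.\<close>
  define y where "y i = z i * inverse (z i) ^ k" for i
  define X where "X t i = z i + t * y i" for t i
  have Dm: "((\<lambda>t. monom_sym ?J \<mu> (X t)) has_field_derivative of_nat n * of_int (int r * a + int i1 * b)) (at 0)"
  proof -
    have "(\<Sum>e\<in>set_mset \<mu>. of_nat e * z i ^ e * monom_sym (?J - {i}) (\<mu> - {#e#}) z) = z i ^ k * of_int (int r * a + int i1 * b)"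
      if i: "i < n" for i
    proof -
      obtain u v where uv: "h - s = Suc u" "s = Suc v" using h by (metis Suc_diff_1 zero_less_diff)
      have ww: "(h - s) * r + s * i1 = k + t * n" using w \<mu> sm by simp
      have "set_mset \<mu> = {r, i1}" using uv \<mu> by auto
      moreover have "\<mu> - {#r#} = ?\<mu> (h - s - 1) s" "\<mu> - {#i1#} = ?\<mu> (h - s) (s - 1)"
        using uv \<mu> ri by auto
      ultimately have "(\<Sum>e\<in>set_mset \<mu>. of_nat e * z i ^ e * monom_sym (?J - {i}) (\<mu> - {#e#}) z)
        = of_nat r * z i ^ r * (z i ^ ((h - s - 1) * r + s * i1) * of_int a)
        + of_nat i1 * z i ^ i1 * (z i ^ ((h - s) * r + (s - 1) * i1) * of_int b)"
        using ri a(1)[OF i] b(1)[OF i] by simp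
      also have "\<dots> = of_nat r * (z i ^ r * z i ^ ((h - s - 1) * r + s * i1)) * of_int a
        + of_nat i1 * (z i ^ i1 * z i ^ ((h - s) * r + (s - 1) * i1)) * of_int b"
        by (simp only: mult_ac)
      also have "z i ^ r * z i ^ ((h - s - 1) * r + s * i1) = z i ^ ((h - s) * r + s * i1)"
        unfolding power_add[symmetric] by (rule arg_cong[of _ _ "(^) (z i)"]) (simp add: uv(1))
      also have "z i ^ i1 * z i ^ ((h - s) * r + (s - 1) * i1) = z i ^ ((h - s) * r + s * i1)"
        unfolding power_add[symmetric] by (rule arg_cong[of _ _ "(^) (z i)"]) (simp add: uv(2))
      also have "of_nat r * z i ^ ((h - s) * r + s * i1) * of_int a + of_nat i1 * z i ^ ((h - s) * r + s * i1) * of_int b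
        = z i ^ ((h - s) * r + s * i1) * of_int (int r * a + int i1 * b)"
        by (simp add: distrib_left distrib_right mult_ac)
      also have "z i ^ ((h - s) * r + s * i1) = z i ^ k"
        unfolding ww using zn[OF i] by (simp add: power_add mult.commute[of t n] power_mult)
      finally show ?thesis .
    qed
    moreover have "y i / z i * (z i ^ k * A) = A" if "i < n" for i A
      using z0[OF that] by (simp add: y_def power_inverse field_simps)
    ultimately have "(\<Sum>i\<in>?J. y i / z i * (\<Sum>e\<in>set_mset \<mu>. of_nat e * z i ^ e * monom_sym (?J - {i}) (\<mu> - {#e#}) z))
      = (\<Sum>i\<in>?J. of_int (int r * a + int i1 * b))" by (intro sum.cong) auto
    then show ?thesis
      using has_field_derivative_monom_sym[of ?J z \<mu> y] z0 \<mu>0[of "h - s" s, folded \<mu>] by (simp add: X_def[abs_def])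
  qed
  have X0: "X 0 = z" by (simp add: X_def fun_eq_iff)
  have De: "\<exists>D. ((\<lambda>t. elem_sym l ?J (X t)) has_field_derivative D) (at 0)" for l
    using has_field_derivative_elem_sym[of ?J z "l - 1" y] z0
    by (cases l) (auto simp: X_def[abs_def] elem_sym_0 intro: exI[of _ 0])
  have Dp: "\<exists>D. ((\<lambda>t. elem_prod ?J \<kappa> (X t)) has_field_derivative D) (at 0)" for \<kappa>
  proof (induction \<kappa>)
    case (add l \<kappa>)
    then obtain D where "((\<lambda>t. elem_prod ?J \<kappa> (X t)) has_field_derivative D) (at 0)" by blast
    moreover obtain D' where "((\<lambda>t. elem_sym l ?J (X t)) has_field_derivative D') (at 0)" using De by blast
    ultimately show ?case using DERIV_mult by (fastforce simp: elem_prod_def)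
  qed (auto simp: elem_prod_def intro: exI[of _ 0])
  \<comment> \<open>Two factors vanish at the roots of unity, so every summand of the product rule
    still contains a zero factor.\<close>
  have D0: "((\<lambda>t. elem_prod ?J \<kappa> (X t)) has_field_derivative 0) (at 0)"
    if \<kappa>: "\<kappa> \<in> partitions_le n (k + t * n)" "\<kappa> \<noteq> add_mset k (replicate_mset t n)" for \<kappa>
  proof -
    obtain l l' \<kappa>' where l: "\<kappa> = add_mset l (add_mset l' \<kappa>')" "0 < l" "l < n" "0 < l'" "l' < n"
      using partition_two_small_parts[OF \<kappa>(1) k \<kappa>(2)] by metis
    obtain D where D: "((\<lambda>t. elem_sym l ?J (X t)) has_field_derivative D) (at 0)" using De by blast
    obtain D' where D': "((\<lambda>t. elem_sym l' ?J (X t)) has_field_derivative D') (at 0)" using De by blast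
    obtain D'' where D'': "((\<lambda>t. elem_prod ?J \<kappa>' (X t)) has_field_derivative D'') (at 0)" using Dp by blast
    have "elem_sym l ?J z = 0" "elem_sym l' ?J z = 0" using l z[of l] z[of l'] by auto
    then show ?thesis using DERIV_mult[OF D DERIV_mult[OF D' D'']] X0 by (simp add: l(1) elem_prod_def)
  qed
  let ?\<kappa> = "add_mset k (replicate_mset t n)"
  have Dk: "((\<lambda>t'. elem_prod ?J ?\<kappa> (X t')) has_field_derivative
      of_nat n * of_int ((- 1) ^ (k - 1) * ((- 1) ^ (n + 1)) ^ t)) (at 0)"
  proof -
    obtain k' where k': "k = Suc k'" using k by (cases k) auto
    have "(\<Sum>i\<in>?J. y i * elem_sym k' (?J - {i}) z) = (\<Sum>i\<in>?J. (- 1) ^ k')"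
    proof (rule sum.cong[OF refl])
      fix i assume "i \<in> ?J"
      then have i: "i < n" by simp
      have "y i * elem_sym k' (?J - {i}) z = y i * ((- 1) ^ k' * z i ^ k')"
        using rem[OF i, of k'] k k' by (simp add: power_minus[of "z i"])
      also have "\<dots> = (- 1) ^ k' * (inverse (z i) * z i) ^ k"
        by (simp add: y_def k' power_mult_distrib mult_ac)
      also have "inverse (z i) * z i = 1" using z0[OF i] by simp
      also have "(- 1) ^ k' * 1 ^ k = (- 1 :: complex) ^ k'" by simp
      finally show "y i * elem_sym k' (?J - {i}) z = (- 1) ^ k'" .
    qed
    then have 1: "((\<lambda>t'. elem_sym k ?J (X t')) has_field_derivative of_nat n * (- 1) ^ k') (at 0)"
      using has_field_derivative_elem_sym[of ?J z k' y] z0 k' by (simp add: X_def[abs_def])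
    obtain D where D: "((\<lambda>t'. elem_prod ?J (replicate_mset t n) (X t')) has_field_derivative D) (at 0)" using Dp by blast
    have "elem_sym k ?J z = 0" using k z[of k] by simp
    moreover have "elem_prod ?J (replicate_mset t n) z = ((- 1) ^ (n + 1)) ^ t"
      using z[of n] n by (simp add: elem_prod_def)
    ultimately show ?thesis using DERIV_mult[OF 1 D] X0 k' by (simp add: elem_prod_def mult.assoc)
  qed
  have "((\<lambda>t'. elem_sum ?J (k + t * n) d (X t')) has_field_derivative
     (\<Sum>\<kappa>\<in>partitions_le n (k + t * n). of_int (d \<kappa>) *
        (if \<kappa> = ?\<kappa> then of_nat n * of_int ((- 1) ^ (k - 1) * ((- 1) ^ (n + 1)) ^ t) else 0))) (at 0)"
    unfolding elem_sum_def card_lessThan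
    by (intro DERIV_sum DERIV_cmult) (use D0 Dk in auto)
  moreover have "?\<kappa> \<in> partitions_le n (k + t * n)"
    using k by (auto simp: partitions_le_def sum_mset_replicate_mset split: if_splits)
  ultimately have "((\<lambda>t'. monom_sym ?J \<mu> (X t')) has_field_derivative
      of_int (d ?\<kappa>) * (of_nat n * of_int ((- 1) ^ (k - 1) * ((- 1) ^ (n + 1)) ^ t))) (at 0)"
    by (simp add: d w if_distrib[of "\<lambda>x. _ * x"] finite_partitions_le sum.delta cong: if_cong)
  \<comment> \<open>Both computations of the derivative contain the factor \<open>n\<close>. It is
    cancelled over the complex numbers, before reduction modulo \<open>p\<close>.\<close>
  from DERIV_unique[OF this Dm] have "of_nat n * complex_of_int (d ?\<kappa> * ((- 1) ^ (k - 1) * ((- 1) ^ (n + 1)) ^ t))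
    = of_nat n * of_int (int r * a + int i1 * b)" by (simp add: mult_ac)
  then have "complex_of_int (d ?\<kappa> * ((- 1) ^ (k - 1) * ((- 1) ^ (n + 1)) ^ t)) = of_int (int r * a + int i1 * b)"
    using n by (simp only: mult_cancel_left of_nat_eq_0_iff) auto
  then have eq: "d ?\<kappa> * ((- 1) ^ (k - 1) * ((- 1) ^ (n + 1)) ^ t) = int r * a + int i1 * b"
    by (simp only: of_int_eq_iff)
  have "[int r * a + int i1 * b = int r * ((- 1) ^ (h - 1) * int ((h - 1) choose s))
     + int i1 * ((- 1) ^ (h - 1) * int ((h - 1) choose (s - 1)))] (mod int p)"
    by (intro cong_add cong_mult cong_refl a(2) b(2))
  also have "int r * ((- 1) ^ (h - 1) * int ((h - 1) choose s)) + int i1 * ((- 1) ^ (h - 1) * int ((h - 1) choose (s - 1)))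
    = (- 1) ^ (h - 1) * (int r * int ((h - 1) choose s) + int i1 * int ((h - 1) choose (s - 1)))"
    by (simp add: algebra_simps)
  finally have cong: "[int r * a + int i1 * b = (- 1) ^ (h - 1) * (int r * int ((h - 1) choose s) + int i1 * int ((h - 1) choose (s - 1)))] (mod int p)" .
  show ?thesis
  proof
    assume "int p dvd d ?\<kappa>"
    then have "int p dvd int r * a + int i1 * b" unfolding eq[symmetric] by simp
    then have "int p dvd (- 1) ^ (h - 1) * (int r * int ((h - 1) choose s) + int i1 * int ((h - 1) choose (s - 1)))"
      using cong_dvd_iff[OF cong] by simp
    moreover have "(- 1 :: int) ^ (h - 1) = 1 \<or> (- 1 :: int) ^ (h - 1) = - 1" by (cases "even (h - 1)") auto
    ultimately show False using nd by (metis dvd_minus_iff mult_1 mult_minus1)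
  qed
qed

section \<open>Subfields, polynomials and linear dependence\<close>

text \<open>The product of \<open>v\<close> and the binomial coefficient is a multiple of
  \<open>p ^ j\<close>; if \<open>p\<close> did not divide the latter, \<open>p ^ j\<close> would
  divide \<open>v\<close>.\<close>

lemma prime_dvd_prime_power_choose:
  assumes p: "prime (p::nat)" and v: "0 < v" "v < p ^ j"
  shows "p dvd (p ^ j choose v)"
proof (rule ccontr)
  assume "\<not> p dvd (p ^ j choose v)"
  then have "coprime (p ^ j) (p ^ j choose v)"
    using p by (simp add: prime_imp_coprime coprime_power_left_iff)
  moreover have "p ^ j dvd v * (p ^ j choose v)"
    using times_binomial_minus1_eq[OF v(1), of "p ^ j"] by simp
  ultimately have "p ^ j dvd v" by (simp add: coprime_dvd_mult_left_iff)
  then show False using v by (auto dest: dvd_imp_le)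
qed

text \<open>By Pascal's rule consecutive values are negatives of each other modulo \<open>p\<close>,
  and the first one is 1.\<close>

lemma prime_not_dvd_prime_power_minus_1_choose:
  assumes p: "prime (p::nat)" and v: "v < p ^ j"
  shows "\<not> p dvd ((p ^ j - 1) choose v)"
  using v
proof (induction v)
  case 0
  then show ?case using p by (auto simp: prime_nat_iff)
next
  case (Suc v)
  have "p ^ j choose Suc v = ((p ^ j - 1) choose v) + ((p ^ j - 1) choose Suc v)"
    using Suc.prems by (cases "p ^ j") auto
  moreover have "p dvd (p ^ j choose Suc v)" using p Suc.prems by (intro prime_dvd_prime_power_choose) auto
  ultimately show ?case using Suc by (metis dvd_add_left_iff Suc_lessD)
qed

text \<open>Pascal's rule rewrites the expression as \<open>r\<close> times a multiple of
  \<open>p\<close> plus \<open>\<delta>\<close> times a number prime to \<open>p\<close>. This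
  supplies the last hypothesis of \<open>leading_coeff_not_dvd\<close> for \<open>h = p ^ j\<close>,
  \<open>s = p ^ m\<close> and \<open>i1 = r + \<delta>\<close>.\<close>

lemma leading_coeff_residue:
  assumes p: "prime (p::nat)" and mj: "m < j" and \<delta>: "\<not> p dvd \<delta>"
  shows "\<not> int p dvd int r * int ((p ^ j - 1) choose p ^ m) + int (r + \<delta>) * int ((p ^ j - 1) choose (p ^ m - 1))"
proof -
  have lt: "p ^ m < p ^ j" using prime_gt_1_nat[OF p] mj by simp
  have pos: "0 < p ^ m" using p prime_gt_0_nat by simp
  have pascal: "p ^ j choose p ^ m = ((p ^ j - 1) choose (p ^ m - 1)) + ((p ^ j - 1) choose p ^ m)"
    using lt pos by (metis One_nat_def choose_reduce_nat less_trans)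
  have "r * ((p ^ j - 1) choose p ^ m) + (r + \<delta>) * ((p ^ j - 1) choose (p ^ m - 1))
    = r * (p ^ j choose p ^ m) + \<delta> * ((p ^ j - 1) choose (p ^ m - 1))"
    unfolding pascal by (simp add: algebra_simps)
  moreover have "p dvd r * (p ^ j choose p ^ m)"
    using prime_dvd_prime_power_choose[OF p pos lt] by simp
  moreover have "\<not> p dvd \<delta> * ((p ^ j - 1) choose (p ^ m - 1))"
    using prime_not_dvd_prime_power_minus_1_choose[OF p, of "p ^ m - 1" j] lt \<delta> p
    by (auto simp: prime_dvd_mult_iff)
  ultimately have "\<not> p dvd r * ((p ^ j - 1) choose p ^ m) + (r + \<delta>) * ((p ^ j - 1) choose (p ^ m - 1))"
    by (metis dvd_add_right_iff)
  then have "\<not> int p dvd int (r * ((p ^ j - 1) choose p ^ m) + (r + \<delta>) * ((p ^ j - 1) choose (p ^ m - 1)))"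
    by (simp only: int_dvd_int_iff simp_thms)
  then show ?thesis by simp
qed

section \<open>Subfields, linear dependence and polynomials over a subfield\<close>

context
  fixes K :: "'a::field set"
  assumes K: "is_subfield K"
begin

lemma subfield_0: "0 \<in> K" and subfield_1: "1 \<in> K"
  using K by (auto simp: is_subfield_def)

lemma subfield_add: "x \<in> K \<Longrightarrow> y \<in> K \<Longrightarrow> x + y \<in> K"
  and subfield_mult: "x \<in> K \<Longrightarrow> y \<in> K \<Longrightarrow> x * y \<in> K"
  and subfield_uminus: "x \<in> K \<Longrightarrow> - x \<in> K"
  and subfield_inverse: "x \<in> K \<Longrightarrow> inverse x \<in> K"
  using K by (auto simp: is_subfield_def)

lemma subfield_diff: "x \<in> K \<Longrightarrow> y \<in> K \<Longrightarrow> x - y \<in> K"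
  using subfield_add[of x "- y"] subfield_uminus by simp

lemma subfield_divide: "x \<in> K \<Longrightarrow> y \<in> K \<Longrightarrow> x / y \<in> K"
  unfolding divide_inverse by (intro subfield_mult subfield_inverse)

lemma subfield_sum: "(\<And>i. i \<in> A \<Longrightarrow> f i \<in> K) \<Longrightarrow> sum f A \<in> K"
  by (induction A rule: infinite_finite_induct) (auto intro: subfield_0 subfield_add)

lemma subfield_power: "x \<in> K \<Longrightarrow> x ^ k \<in> K"
  by (induction k) (auto intro: subfield_1 subfield_mult)

lemma subfield_prod_mset: "(\<And>i. i \<in># A \<Longrightarrow> f i \<in> K) \<Longrightarrow> (\<Prod>i\<in>#A. f i) \<in> K"
  by (induction A) (auto intro: subfield_1 subfield_mult)

lemma subfield_of_nat: "of_nat k \<in> K"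
  by (induction k) (auto intro: subfield_0 subfield_1 subfield_add)

lemma subfield_of_int: "of_int k \<in> K"
  by (cases k) (auto intro: subfield_of_nat subfield_uminus subfield_diff simp del: of_nat_Suc)

text \<open>Gaussian elimination: a pivot \<open>j0\<close> in the last equation removes that
  equation together with one unknown.\<close>

lemma homogeneous_system_solution:
  fixes c :: "'i \<Rightarrow> nat \<Rightarrow> 'a"
  assumes "finite R" "n < card R" "\<And>j i. c j i \<in> K"
  shows "\<exists>a. (\<forall>j. a j \<in> K) \<and> (\<exists>j\<in>R. a j \<noteq> 0) \<and> (\<forall>i<n. (\<Sum>j\<in>R. a j * c j i) = 0)"
  using assms
proof (induction n arbitrary: R c)
  case 0
  then obtain j where "j \<in> R" by fastforce
  then show ?case using subfield_1 by (intro exI[of _ "\<lambda>_. 1"]) auto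
next
  case (Suc n)
  show ?case
  proof (cases "\<exists>j0\<in>R. c j0 n \<noteq> 0")
    case False
    obtain a where "\<forall>j. a j \<in> K" "\<exists>j\<in>R. a j \<noteq> 0" "\<forall>i<n. (\<Sum>j\<in>R. a j * c j i) = 0"
      using Suc.IH[of R c] Suc.prems by auto
    then show ?thesis using False by (intro exI[of _ a]) (auto simp: less_Suc_eq intro!: sum.neutral)
  next
    case True
    then obtain j0 where j0: "j0 \<in> R" "c j0 n \<noteq> 0" by blast
    define c' where "c' j i = c j i - c j n / c j0 n * c j0 i" for j i
    have "n < card (R - {j0})" using Suc.prems j0 by (simp add: card_Diff_singleton)
    moreover have "c' j i \<in> K" for j i
      unfolding c'_def by (intro subfield_diff subfield_mult subfield_divide Suc.prems)
    ultimately obtain a where a: "\<forall>j. a j \<in> K" "\<exists>j\<in>R - {j0}. a j \<noteq> 0" "\<forall>i<n. (\<Sum>j\<in>R - {j0}. a j * c' j i) = 0"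
      using Suc.IH[of "R - {j0}" c'] Suc.prems by auto
    define b where "b = a(j0 := - (\<Sum>j\<in>R - {j0}. a j * c j n / c j0 n))"
    have "b j \<in> K" for j
      unfolding b_def using a(1) Suc.prems(3)
      by (auto intro!: subfield_uminus subfield_sum subfield_divide subfield_mult)
    moreover have "\<exists>j\<in>R. b j \<noteq> 0" using a(2) by (auto simp: b_def)
    moreover have "(\<Sum>j\<in>R. b j * c j i) = 0" if "i < Suc n" for i
    proof -
      have "(\<Sum>j\<in>R. b j * c j i) = b j0 * c j0 i + (\<Sum>j\<in>R - {j0}. b j * c j i)"
        using Suc.prems j0 by (simp add: sum.remove)
      also have "(\<Sum>j\<in>R - {j0}. b j * c j i) = (\<Sum>j\<in>R - {j0}. a j * c j i)"
        by (rule sum.cong) (auto simp: b_def)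
      also have "b j0 * c j0 i = - (\<Sum>j\<in>R - {j0}. a j * (c j n / c j0 n * c j0 i))"
        unfolding b_def by (simp add: sum_distrib_right) (simp add: mult_ac)
      finally have "(\<Sum>j\<in>R. b j * c j i) = (\<Sum>j\<in>R - {j0}. a j * c' j i)"
        by (simp add: c'_def right_diff_distrib sum_subtractf)
      then show ?thesis
        using a(3) that j0 by (cases "i = n") (auto simp: c'_def less_Suc_eq)
    qed
    ultimately show ?thesis by blast
  qed
qed

lemma extension_degree_dependent:
  assumes L: "extension_degree K L n" and y: "\<And>j. j \<in> R \<Longrightarrow> y j \<in> L" and R: "finite R" "n < card R"
  shows "\<exists>a. (\<forall>j. a j \<in> K) \<and> (\<exists>j\<in>R. a j \<noteq> 0) \<and> (\<Sum>j\<in>R. a j * y j) = 0"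
proof -
  obtain b :: "nat \<Rightarrow> 'a" where "\<forall>x\<in>L. \<exists>!c. c \<in> {..<n} \<rightarrow>\<^sub>E K \<and> x = (\<Sum>i<n. c i * b i)"
    using L unfolding extension_degree_def by (elim exE conjE)
  then have b: "\<exists>c. c \<in> {..<n} \<rightarrow>\<^sub>E K \<and> x = (\<Sum>i<n. c i * b i)" if "x \<in> L" for x
    using that by (intro ex1_implies_ex) (rule bspec)
  have "\<forall>j. \<exists>c. (\<forall>i. c i \<in> K) \<and> (j \<in> R \<longrightarrow> y j = (\<Sum>i<n. c i * b i))"
  proof
    fix j
    show "\<exists>c. (\<forall>i. c i \<in> K) \<and> (j \<in> R \<longrightarrow> y j = (\<Sum>i<n. c i * b i))"
    proof (cases "j \<in> R")
      case True
      then obtain c where c: "c \<in> {..<n} \<rightarrow>\<^sub>E K" "y j = (\<Sum>i<n. c i * b i)" using b y by blast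
      then show ?thesis
        \<comment> \<open>Coordinate functions are \<open>undefined\<close> from \<open>n\<close>
          on; zeros are filled in so that all values lie in \<open>K\<close>.\<close>
        using subfield_0 by (intro exI[of _ "\<lambda>i. if i < n then c i else 0"]) (auto simp: PiE_def Pi_def)
    qed (use subfield_0 in \<open>auto intro: exI[of _ "\<lambda>_. 0"]\<close>)
  qed
  then obtain c where c: "\<And>j i. c j i \<in> K" "\<And>j. j \<in> R \<Longrightarrow> y j = (\<Sum>i<n. c j i * b i)" by metis
  obtain a where a: "\<forall>j. a j \<in> K" "\<exists>j\<in>R. a j \<noteq> 0" "\<forall>i<n. (\<Sum>j\<in>R. a j * c j i) = 0"
    using homogeneous_system_solution[OF R, of c] c by auto
  have "(\<Sum>j\<in>R. a j * y j) = (\<Sum>j\<in>R. \<Sum>i<n. a j * c j i * b i)"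
    by (rule sum.cong) (auto simp: c(2) sum_distrib_left mult_ac)
  also have "\<dots> = (\<Sum>i<n. \<Sum>j\<in>R. a j * c j i * b i)" by (rule sum.swap)
  also have "\<dots> = (\<Sum>i<n. (\<Sum>j\<in>R. a j * c j i) * b i)" by (simp add: sum_distrib_right)
  also have "\<dots> = 0" using a(3) by simp
  finally show ?thesis using a by blast
qed

lemma poly_over_add: "poly_over K f \<Longrightarrow> poly_over K g \<Longrightarrow> poly_over K (f + g)"
  and poly_over_diff: "poly_over K f \<Longrightarrow> poly_over K g \<Longrightarrow> poly_over K (f - g)"
  and poly_over_mult: "poly_over K f \<Longrightarrow> poly_over K g \<Longrightarrow> poly_over K (f * g)"
  and poly_over_monom: "a \<in> K \<Longrightarrow> poly_over K (monom a k)"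
  by (auto simp: poly_over_def coeff_mult subfield_0
      intro!: subfield_add subfield_diff subfield_mult subfield_sum)

lemma poly_over_sum: "(\<And>i. i \<in> A \<Longrightarrow> poly_over K (f i)) \<Longrightarrow> poly_over K (sum f A)"
  by (induction A rule: infinite_finite_induct) (auto simp: poly_over_def subfield_0 intro: subfield_add)

end

text \<open>Split off one root at a time. A common factor of the quotient and its derivative would
  divide both \<open>f\<close> and its derivative, and so would the linear factor of a repeated
  root.\<close>

lemma separable_poly_splits:
  fixes f :: "'a::field poly"
  assumes roots: "\<And>g :: 'a poly. 0 < degree g \<Longrightarrow> separable_poly g \<Longrightarrow> \<exists>x. poly g x = 0"
    and "separable_poly f" "lead_coeff f = 1"
  shows "\<exists>x :: nat \<Rightarrow> 'a. inj_on x {..<degree f} \<and> f = (\<Prod>i<degree f. [:- x i, 1:])"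
  using assms(2,3)
proof (induction "degree f" arbitrary: f)
  case 0
  then have "f = 1" by (metis coeff_pCons_0 degree_0_id lessI pCons_one of_nat_0 degree_eq_zeroE)
  then show ?case by simp
next
  case (Suc m)
  obtain y where y: "poly f y = 0" using roots[of f] Suc by auto
  then obtain g where g: "f = [:- y, 1:] * g" using poly_eq_0_iff_dvd by blast
  have g0: "g \<noteq> 0" using Suc.hyps(2) g by auto
  have dg: "degree g = m" using Suc.hyps(2) g0 unfolding g by (subst (asm) degree_mult_eq) auto
  have lg: "lead_coeff g = 1" using Suc.prems(2) unfolding g by (subst (asm) lead_coeff_mult) auto
  have cop: "coprime f (pderiv f)" using Suc.prems by (simp add: separable_poly_def)
  have df: "pderiv f = g + [:- y, 1:] * pderiv g" unfolding g pderiv_mult by (simp add: pderiv_pCons)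
  have "coprime g (pderiv g)"
  proof (rule coprimeI)
    fix c assume "c dvd g" "c dvd pderiv g"
    then have "c dvd f" "c dvd pderiv f" unfolding df by (metis g dvd_mult, metis dvd_add dvd_mult)
    then show "is_unit c" using cop coprime_common_divisor by blast
  qed
  then obtain x where x: "inj_on x {..<m}" "g = (\<Prod>i<m. [:- x i, 1:])"
    using Suc.hyps(1)[of g] dg lg by (auto simp: separable_poly_def)
  have "poly g y \<noteq> 0"
  proof
    assume "poly g y = 0"
    then have "[:- y, 1:] dvd g" by (simp add: poly_eq_0_iff_dvd)
    then have "[:- y, 1:] dvd f" "[:- y, 1:] dvd pderiv f"
      unfolding df by (metis g dvd_triv_left, metis dvd_add dvd_triv_left)
    then have "is_unit [:- y, 1:]" using cop coprime_common_divisor by blast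
    then show False by (simp add: is_unit_pCons_iff)
  qed
  then have ny: "x i \<noteq> y" if "i < m" for i using that by (auto simp: x(2) poly_prod)
  define x' where "x' = x(m := y)"
  have "inj_on x' {..<Suc m}" using x(1) ny unfolding x'_def inj_on_def
    by (auto simp: less_Suc_eq dest: ny)
  moreover have "f = (\<Prod>i<Suc m. [:- x' i, 1:])"
  proof -
    have "(\<Prod>i<m. [:- x' i, 1:]) = g" unfolding x(2) by (rule prod.cong) (auto simp: x'_def)
    then show ?thesis unfolding g by (simp add: x'_def)
  qed
  ultimately show ?case unfolding Suc.hyps(2)[symmetric] by blast
qed

lemma elem_sym_image:
  assumes "inj_on \<phi> I"
  shows "elem_sym h (\<phi> ` I) f = elem_sym h I (\<lambda>i. f (\<phi> i))"
proof -
  have "{S. S \<subseteq> \<phi> ` I \<and> card S = h} = image \<phi> ` {S. S \<subseteq> I \<and> card S = h}"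
  proof -
    have "card (\<phi> ` S) = card S" if "S \<subseteq> I" for S using assms that by (metis card_image inj_on_subset)
    then show ?thesis by (auto simp: subset_image_iff)
  qed
  moreover have "inj_on (image \<phi>) {S. S \<subseteq> I \<and> card S = h}"
    by (rule inj_on_subset[OF inj_on_image_Pow[OF assms]]) auto
  moreover have "prod f (\<phi> ` S) = (\<Prod>i\<in>S. f (\<phi> i))" if "S \<subseteq> I" for S
    using inj_on_subset[OF assms that] by (simp add: prod.reindex)
  ultimately show ?thesis unfolding elem_sym_def by (simp add: sum.reindex)
qed

section \<open>Valuations and totally ramified extensions\<close>

lemma nmul_Fin: "nmul k (Fin a) = Fin (int k * a)"
proof (induction k)
  case 0
  then show ?case by (simp add: nmul_def zero_extended_def)
next
  case (Suc k)
  have "nmul (Suc k) (Fin a) = nmul k (Fin a) + Fin a" by (simp add: nmul_def)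
  then show ?case using Suc by (simp add: algebra_simps)
qed

text \<open>Turns strict bounds into weak ones, the form in which the estimates for sums and
  products are stated.\<close>

lemma extended_Suc_le_iff: "Fin (a + 1) \<le> x \<longleftrightarrow> Fin a < (x :: int extended)"
  by (cases x) auto

locale valued_field =
  fixes F :: "'a::field set" and v :: "'a \<Rightarrow> int extended"
  assumes F: "is_subfield F" and v: "normalized_valuation F v"
begin

lemma val_0: "v 0 = Pinf"
  using v by (simp add: normalized_valuation_def)

lemma val_Fin: "x \<in> F \<Longrightarrow> x \<noteq> 0 \<Longrightarrow> \<exists>a. v x = Fin a"
  using v unfolding normalized_valuation_def by blast

lemma val_mult: "x \<in> F \<Longrightarrow> y \<in> F \<Longrightarrow> v (x * y) = v x + v y"
  using v by (simp add: normalized_valuation_def)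

lemma val_surj: "\<exists>x\<in>F. x \<noteq> 0 \<and> v x = Fin a"
proof -
  have "Fin a \<in> v ` (F - {0})" using v by (simp add: normalized_valuation_def)
  then show ?thesis by force
qed

lemma val_1: "v 1 = Fin 0"
proof -
  have 1: "1 \<in> F" using subfield_1[OF F] .
  then obtain a where a: "v 1 = Fin a" using val_Fin by force
  have "v (1 * 1) = v 1 + v 1" using val_mult 1 by blast
  then show ?thesis using a by simp
qed

lemma val_uminus: "x \<in> F \<Longrightarrow> v (- x) = v x"
proof -
  assume x: "x \<in> F"
  have 1: "- 1 \<in> F" using subfield_1[OF F] subfield_uminus[OF F] by blast
  then obtain a where a: "v (- 1) = Fin a" using val_Fin by force
  have "v (- 1 * - 1) = v (- 1) + v (- 1)" using val_mult 1 by blast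
  then have "a = 0" using a val_1 by simp
  then show ?thesis using val_mult[OF 1 x] a by (cases "v x") auto
qed

lemma val_ge_add: "x \<in> F \<Longrightarrow> y \<in> F \<Longrightarrow> Fin a \<le> v x \<Longrightarrow> Fin a \<le> v y \<Longrightarrow> Fin a \<le> v (x + y)"
  using v unfolding normalized_valuation_def by (meson min.boundedI order.trans)

lemma val_ge_sum: "(\<And>i. i \<in> A \<Longrightarrow> f i \<in> F \<and> Fin a \<le> v (f i)) \<Longrightarrow> Fin a \<le> v (sum f A)"
proof (induction A rule: infinite_finite_induct)
  case (insert i A)
  then show ?case using subfield_sum[OF F, of A f] by (auto intro!: val_ge_add)
qed (auto simp: val_0)

lemma val_ge_mult: "x \<in> F \<Longrightarrow> y \<in> F \<Longrightarrow> Fin a \<le> v x \<Longrightarrow> Fin b \<le> v y \<Longrightarrow> Fin (a + b) \<le> v (x * y)"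
  by (cases "v x"; cases "v y") (auto simp: val_mult)

lemma val_ge_prod_mset:
  "(\<And>i. i \<in># A \<Longrightarrow> f i \<in> F \<and> Fin (w i) \<le> v (f i)) \<Longrightarrow> Fin (\<Sum>i\<in>#A. w i) \<le> v (\<Prod>i\<in>#A. f i)"
proof (induction A)
  case (add i A)
  then show ?case using subfield_prod_mset[OF F, of A f] by (auto intro!: val_ge_mult)
qed (simp add: val_1)

lemma val_power: "x \<in> F \<Longrightarrow> v x = Fin a \<Longrightarrow> v (x ^ k) = Fin (int k * a)"
  by (induction k) (auto simp: val_1 val_mult subfield_power[OF F] algebra_simps)

text \<open>Otherwise \<open>x\<close>, as the difference of \<open>x + y\<close> and
  \<open>y\<close>, would have valuation greater than \<open>a\<close>.\<close>

lemma val_add_strict: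
  assumes x: "x \<in> F" and y: "y \<in> F" and vx: "v x = Fin a" and vy: "Fin a < v y"
  shows "v (x + y) = Fin a"
proof -
  have ge: "Fin a \<le> v (x + y)" using val_ge_add[OF x y] vx vy by simp
  have "\<not> Fin (a + 1) \<le> v (x + y)"
  proof
    assume "Fin (a + 1) \<le> v (x + y)"
    moreover have "Fin (a + 1) \<le> v (- y)" using vy y by (simp add: val_uminus extended_Suc_le_iff)
    ultimately have "Fin (a + 1) \<le> v (x + y + - y)"
      by (rule val_ge_add[rotated 2]) (use x y in \<open>auto intro: subfield_add[OF F] subfield_uminus[OF F]\<close>)
    then show False using vx by simp
  qed
  then show ?thesis using ge unfolding extended_Suc_le_iff by auto
qed

lemma val_inverse: "x \<in> F \<Longrightarrow> v x = Fin a \<Longrightarrow> v (inverse x) = Fin (- a)"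
proof -
  assume x: "x \<in> F" "v x = Fin a"
  then have "x \<noteq> 0" using val_0 by auto
  have i: "inverse x \<in> F" using x subfield_inverse[OF F] by blast
  then obtain b where b: "v (inverse x) = Fin b" using val_Fin \<open>x \<noteq> 0\<close> by force
  have "v (x * inverse x) = Fin (a + b)" using val_mult[OF x(1) i] x b by simp
  then have "a + b = 0" using val_1 \<open>x \<noteq> 0\<close> by simp
  then show ?thesis using b by (simp add: add_eq_0_iff)
qed

text \<open>Pairwise different finite valuations exclude cancellation, by repeated use of
  \<open>val_add_strict\<close>.\<close>

lemma val_sum_distinct:
  assumes "finite I" "I \<noteq> {}" "\<And>i. i \<in> I \<Longrightarrow> t i \<in> F \<and> t i \<noteq> 0" "inj_on (\<lambda>i. v (t i)) I"
  shows "\<exists>i0\<in>I. v (sum t I) = v (t i0) \<and> (\<forall>i\<in>I. v (t i0) \<le> v (t i))"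
  using assms
proof (induction I rule: finite_ne_induct)
  case (insert k I)
  then obtain i0 where i0: "i0 \<in> I" "v (sum t I) = v (t i0)" "\<forall>i\<in>I. v (t i0) \<le> v (t i)" by auto
  have tk: "t k \<in> F" "t k \<noteq> 0" and ti: "t i0 \<in> F" "t i0 \<noteq> 0" using insert.prems i0 by auto
  have sI: "sum t I \<in> F" using insert.prems by (auto intro: subfield_sum[OF F])
  have ne: "v (t k) \<noteq> v (t i0)" using insert.prems(2) insert.hyps i0(1) by (auto simp: inj_on_def)
  have s: "sum t (insert k I) = t k + sum t I" using insert.hyps by simp
  obtain a where a: "v (t k) = Fin a" using val_Fin tk by blast
  obtain b where b: "v (t i0) = Fin b" using val_Fin ti by blast
  show ?case
  proof (cases "a < b")
    case True
    then have "v (t k + sum t I) = Fin a" using a b i0 tk sI by (intro val_add_strict) auto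
    moreover have "Fin a \<le> v (t i)" if "i \<in> I" for i
    proof -
      have "Fin b \<le> v (t i)" using i0(3) b that by simp
      then show ?thesis using True by (cases "v (t i)") auto
    qed
    ultimately show ?thesis using s a by (auto intro!: bexI[of _ k])
  next
    case False
    then have "b < a" using ne a b by auto
    then have "v (sum t I + t k) = Fin b" using a b i0 tk sI by (intro val_add_strict) auto
    then show ?thesis using s a b i0 \<open>b < a\<close> by (auto intro!: bexI[of _ i0] simp: add.commute)
  qed
qed auto

end

section \<open>Expansions in powers of a uniformizer\<close>

locale tot_ram =
  fixes K L :: "'a::field set" and vK vL :: "'a \<Rightarrow> int extended" and n :: nat and \<pi> :: 'a
  assumes K: "is_subfield K" and vK: "normalized_valuation K vK"
    and LK: "totally_ramified K vK L vL n" and n: "0 < n"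
    and pi: "\<pi> \<in> L" and vpi: "vL \<pi> = 1"
begin

lemma L: "is_subfield L" and KL: "K \<subseteq> L" and deg: "extension_degree K L n"
  and vL: "normalized_valuation L vL" and vLK: "x \<in> K \<Longrightarrow> vL x = nmul n (vK x)"
  using LK by (auto simp: totally_ramified_def)

sublocale K: valued_field K vK by unfold_locales (rule K vK)+
sublocale L: valued_field L vL by unfold_locales (rule L vL)+

lemma val_K: "x \<in> K \<Longrightarrow> x \<noteq> 0 \<Longrightarrow> \<exists>b. vK x = Fin b \<and> vL x = Fin (int n * b)"
  using K.val_Fin[of x] by (auto simp: vLK nmul_Fin)

text \<open>On nonzero elements of \<open>K\<close> the values of \<open>vL\<close> are multiples of
  \<open>n\<close>, so a bound above \<open>n * (b - 1)\<close> rounds up to \<open>n * b\<close>.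
  This rounding is the source of the ceiling in the theorem.\<close>

lemma vL_ge_imp_vK_ge:
  assumes x: "x \<in> K" and a: "Fin a \<le> vL x" "int n * (b - 1) < a"
  shows "Fin b \<le> vK x"
proof (cases "x = 0")
  case False
  then obtain c where c: "vK x = Fin c" "vL x = Fin (int n * c)" using val_K x by blast
  then have "int n * (b - 1) < int n * c" using a by simp
  then have "b - 1 < c" using n by simp
  then show ?thesis using c by simp
qed (simp add: K.val_0)

lemma vK_ge_imp_vL_ge:
  assumes x: "x \<in> K" and b: "Fin b \<le> vK x"
  shows "Fin (int n * b) \<le> vL x"
proof (cases "x = 0")
  case False
  then obtain b' where "vK x = Fin b'" "vL x = Fin (int n * b')" using val_K x by blast
  then show ?thesis using b by (simp add: mult_left_mono)
qed (simp add: L.val_0)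

lemma vL_pi_power: "vL (\<pi> ^ k) = Fin (int k)"
  using L.val_power[OF pi, of 1 k] vpi by (simp add: one_extended_def)

lemma pi_power: "\<pi> ^ k \<in> L" "\<pi> \<noteq> 0"
  using subfield_power[OF L pi] vpi L.val_0 by (auto simp: one_extended_def)

lemma val_term: "a \<in> K \<Longrightarrow> a \<noteq> 0 \<Longrightarrow> \<exists>b. vK a = Fin b \<and> vL (a * \<pi> ^ k) = Fin (int n * b + int k)"
  using val_K[of a] KL pi_power(1)[of k] by (auto simp: L.val_mult vL_pi_power)

text \<open>The nonzero terms have valuations incongruent modulo \<open>n\<close>, so the smallest
  one determines the sum. The offset \<open>e\<close> allows expansions that start at any power of
  \<open>\<pi>\<close>.\<close>

lemma val_pi_sum:
  assumes a: "\<And>j. a j \<in> K" and ne: "\<exists>j<n. a j \<noteq> 0"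
  obtains j0 b0 where "j0 < n" "vK (a j0) = Fin b0" "vL (\<Sum>j<n. a j * \<pi> ^ (e + j)) = Fin (int n * b0 + int (e + j0))"
    "\<And>j b. j < n \<Longrightarrow> vK (a j) = Fin b \<Longrightarrow> int n * b0 + int j0 \<le> int n * b + int j"
proof -
  let ?I = "{j. j < n \<and> a j \<noteq> 0}"
  let ?t = "\<lambda>j. a j * \<pi> ^ (e + j)"
  have inj: "inj_on (\<lambda>j. vL (?t j)) ?I"
  proof (rule inj_onI)
    fix i j assume i: "i \<in> ?I" and j: "j \<in> ?I" and eq: "vL (?t i) = vL (?t j)"
    obtain b where b: "vL (?t i) = Fin (int n * b + int (e + i))" using val_term a i by blast
    obtain c where c: "vL (?t j) = Fin (int n * c + int (e + j))" using val_term a j by blast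
    have "int n * b + int i = int n * c + int j" using eq b c by simp
    then have "(int n * b + int i) mod int n = (int n * c + int j) mod int n" by simp
    then show "i = j" using i j by simp
  qed
  have "\<exists>i0\<in>?I. vL (sum ?t ?I) = vL (?t i0) \<and> (\<forall>i\<in>?I. vL (?t i0) \<le> vL (?t i))"
  proof (rule L.val_sum_distinct)
    have "a j \<in> L" for j using a KL by blast
    then show "?t i \<in> L \<and> ?t i \<noteq> 0" if "i \<in> ?I" for i
      using that pi_power by (auto intro: subfield_mult[OF L])
  qed (use ne inj in auto)
  then obtain j0 where j0: "j0 < n" "a j0 \<noteq> 0" "vL (sum ?t ?I) = vL (?t j0)"
    "\<And>i. i < n \<Longrightarrow> a i \<noteq> 0 \<Longrightarrow> vL (?t j0) \<le> vL (?t i)" by blast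
  have sm: "(\<Sum>j<n. ?t j) = sum ?t ?I"
    by (rule sum.mono_neutral_right) auto
  obtain b0 where b0: "vK (a j0) = Fin b0" "vL (?t j0) = Fin (int n * b0 + int (e + j0))"
    using val_term a j0 by blast
  show ?thesis
  proof (rule that[of j0 b0])
    fix j b assume j: "j < n" "vK (a j) = Fin b"
    then have "a j \<noteq> 0" using K.val_0 by auto
    moreover then obtain b' where "vK (a j) = Fin b'" "vL (?t j) = Fin (int n * b' + int (e + j))"
      using val_term a by blast
    ultimately show "int n * b0 + int j0 \<le> int n * b + int j" using j0(4)[of j] b0 j by simp
  qed (use j0 b0 sm in auto)
qed

lemma pi_powers_independent:
  assumes a: "\<And>j. a j \<in> K" and z: "(\<Sum>j<n. a j * \<pi> ^ (e + j)) = 0" and j: "j < n"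
  shows "a j = 0"
proof (rule ccontr)
  assume "a j \<noteq> 0"
  then have "\<exists>j<n. a j \<noteq> 0" using j by blast
  from val_pi_sum[OF a this, of e] show False using z L.val_0 by (metis extended.distinct(1))
qed

text \<open>The \<open>n\<close> powers together with \<open>\<alpha>\<close> are linearly
  dependent, and independence of the powers makes the coefficient of \<open>\<alpha>\<close>
  nonzero.\<close>

lemma pi_powers_span:
  assumes "\<alpha> \<in> L"
  shows "\<exists>a. (\<forall>j. a j \<in> K) \<and> \<alpha> = (\<Sum>j<n. a j * \<pi> ^ (e + j))"
proof -
  define y where "y j = (if j < n then \<pi> ^ (e + j) else \<alpha>)" for j
  have "\<exists>a. (\<forall>j. a j \<in> K) \<and> (\<exists>j\<in>{..n}. a j \<noteq> 0) \<and> (\<Sum>j\<in>{..n}. a j * y j) = 0"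
    by (rule extension_degree_dependent[OF K deg]) (use assms pi_power in \<open>auto simp: y_def\<close>)
  then obtain a where a: "\<And>j. a j \<in> K" "\<exists>j\<le>n. a j \<noteq> 0" "(\<Sum>j\<le>n. a j * y j) = 0" by auto
  have "(\<Sum>j\<le>n. a j * y j) = (\<Sum>j<n. a j * y j) + a n * \<alpha>"
    by (simp add: lessThan_Suc_atMost[symmetric] y_def)
  also have "(\<Sum>j<n. a j * y j) = (\<Sum>j<n. a j * \<pi> ^ (e + j))" by (rule sum.cong) (auto simp: y_def)
  finally have eq: "(\<Sum>j<n. a j * \<pi> ^ (e + j)) + a n * \<alpha> = 0" using a by simp
  have an: "a n \<noteq> 0"
  proof
    assume 0: "a n = 0"
    then have "a j = 0" if "j < n" for j using pi_powers_independent[of a e j] a eq that by simp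
    then show False using 0 a(2) by (metis le_neq_implies_less)
  qed
  have "a n * \<alpha> = - (\<Sum>j<n. a j * \<pi> ^ (e + j))" using eq by (simp add: eq_neg_iff_add_eq_0 add.commute)
  then have "\<alpha> = - (\<Sum>j<n. a j * \<pi> ^ (e + j)) / a n" using an by (simp add: field_simps)
  also have "\<dots> = (\<Sum>j<n. - a j / a n * \<pi> ^ (e + j))"
    by (simp add: sum_divide_distrib sum_negf)
  finally show ?thesis
    using a(1) by (intro exI[of _ "\<lambda>j. - a j / a n"]) (auto intro: subfield_divide[OF K] subfield_uminus[OF K])
qed

text \<open>The bound on the sum passes to every nonzero term, giving
  \<open>n * b + j \<ge> 0\<close> for \<open>b\<close> the valuation of the coefficient; as
  \<open>j < n\<close>, this forces \<open>b \<ge> 0\<close>.\<close>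

lemma pi_coeffs_integral:
  assumes a: "\<And>j. a j \<in> K" and ge: "Fin (int e) \<le> vL (\<Sum>j<n. a j * \<pi> ^ (e + j))" and j: "j < n"
  shows "Fin 0 \<le> vK (a j)"
proof (cases "a j = 0")
  case False
  then have ex: "\<exists>j<n. a j \<noteq> 0" using j by blast
  obtain j0 b0 where "j0 < n" "vK (a j0) = Fin b0" and
    *: "vL (\<Sum>j<n. a j * \<pi> ^ (e + j)) = Fin (int n * b0 + int (e + j0))"
    "\<And>j b. j < n \<Longrightarrow> vK (a j) = Fin b \<Longrightarrow> int n * b0 + int j0 \<le> int n * b + int j"
    by (rule val_pi_sum[OF a ex, of e]) (rule that; assumption)
  obtain b where b: "vK (a j) = Fin b" using K.val_Fin a False by blast
  have "0 \<le> int n * b + int j" using *(2)[OF j b] ge *(1) by simp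
  then have "0 < int n * (b + 1)" using j by (simp add: algebra_simps)
  then have "0 \<le> b" using n by (simp add: zero_less_mult_iff)
  then show ?thesis using b by simp
qed (simp add: K.val_0)

section \<open>The minimal polynomial of the uniformizer\<close>

lemma pi_poly_nonzero:
  assumes g: "poly_over K g" "poly g \<pi> = 0" "degree g < n"
  shows "g = 0"
proof -
  have "(\<Sum>j<n. coeff g j * \<pi> ^ (0 + j)) = poly g \<pi>"
    unfolding poly_altdef by (rule sum.mono_neutral_cong_right) (use g in \<open>auto simp: coeff_eq_0\<close>)
  then have "coeff g j = 0" if "j < n" for j
    using pi_powers_independent[of "coeff g" 0 j] g that by (auto simp: poly_over_def)
  moreover have "coeff g j = 0" if "\<not> j < n" for j using g(3) that by (intro coeff_eq_0) simp
  ultimately show ?thesis by (intro poly_eqI) auto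
qed

text \<open>Expressing the \<open>n\<close>-th power of \<open>\<pi>\<close> by lower powers gives a
  monic relation, and there is none of lower degree. Uniqueness then evaluates the description
  operator in \<open>min_poly\<close>.\<close>

lemma min_poly_pi:
  shows "poly_over K (min_poly K \<pi>)" "lead_coeff (min_poly K \<pi>) = 1"
    "poly (min_poly K \<pi>) \<pi> = 0" "degree (min_poly K \<pi>) = n"
proof -
  obtain a where a: "\<And>j. a j \<in> K" "\<pi> ^ n = (\<Sum>j<n. a j * \<pi> ^ (0 + j))"
    using pi_powers_span[OF pi_power(1), of n 0] by blast
  define s where "s = (\<Sum>j<n. monom (a j) j)"
  define f where "f = monom 1 n - s"
  have "degree s \<le> n - 1" unfolding s_def
    by (intro degree_sum_le) (auto intro: order.trans[OF degree_monom_le])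
  then have ds: "degree s < n" using n by simp
  have df: "degree f = n" 
    using degree_add_eq_left[of "- s" "monom 1 n"] ds by (simp add: f_def degree_monom_eq)
  have lf: "lead_coeff f = 1" using ds by (simp add: df) (simp add: f_def coeff_eq_0)
  have Kf: "poly_over K f" unfolding f_def s_def
    by (intro poly_over_diff poly_over_sum poly_over_monom K a subfield_1)
  have zf: "poly f \<pi> = 0" using a(2) by (simp add: f_def s_def poly_sum poly_monom)
  have min: "degree f \<le> degree g" if "poly_over K g" "g \<noteq> 0" "poly g \<pi> = 0" for g
    using pi_poly_nonzero[of g] that df by (meson not_le)
  have "min_poly K \<pi> = f"
    unfolding min_poly_def
  proof (rule the_equality)
    fix g assume g: "poly_over K g \<and> lead_coeff g = 1 \<and> poly g \<pi> = 0 \<and>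
         (\<forall>h. poly_over K h \<and> h \<noteq> 0 \<and> poly h \<pi> = 0 \<longrightarrow> degree g \<le> degree h)"
    have f0: "f \<noteq> 0" using lf by auto
    have g0: "g \<noteq> 0" using g by auto
    have "degree g \<le> degree f" using g Kf zf f0 by blast
    then have dg: "degree g = n" using min[of g] g g0 df by simp
    have "degree (g - f) < n"
    proof (cases "g - f = 0")
      case False
      have "coeff (g - f) n = 0" using g lf df dg by simp
      moreover have "degree (g - f) \<le> n" using degree_diff_le_max[of g f] df dg by simp
      ultimately show ?thesis using False by (metis le_neq_implies_less leading_coeff_0_iff)
    qed (use n in simp)
    then have "g - f = 0" using g Kf zf by (intro pi_poly_nonzero poly_over_diff K) auto
    then show "g = f" by simp
  qed (use Kf lf zf min in auto)
  then show "poly_over K (min_poly K \<pi>)" "lead_coeff (min_poly K \<pi>) = 1"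
    "poly (min_poly K \<pi>) \<pi> = 0" "degree (min_poly K \<pi>) = n" using Kf lf zf df by auto
qed

text \<open>Compare valuations in the expansion of the \<open>n\<close>-th power of
  \<open>\<pi>\<close>. The smallest term has valuation \<open>n\<close>, and an index below
  \<open>n\<close> that is divisible by \<open>n\<close> must be 0, so the constant term is the
  smallest.\<close>

lemma min_poly_eisenstein:
  shows "j < n \<Longrightarrow> Fin 1 \<le> vK (coeff (min_poly K \<pi>) j)" and "vK (coeff (min_poly K \<pi>) 0) = Fin 1"
proof -
  let ?f = "min_poly K \<pi>"
  define a where "a j = - coeff ?f j" for j
  have aK: "a j \<in> K" for j using min_poly_pi(1) by (auto simp: a_def poly_over_def intro: subfield_uminus[OF K])
  have "poly ?f \<pi> = (\<Sum>j<n. coeff ?f j * \<pi> ^ j) + \<pi> ^ n"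
    using min_poly_pi(2) by (simp add: poly_altdef min_poly_pi(4) lessThan_Suc_atMost[symmetric])
  then have eq: "\<pi> ^ n = (\<Sum>j<n. a j * \<pi> ^ (0 + j))"
    using min_poly_pi(3) by (simp add: a_def sum_negf eq_neg_iff_add_eq_0 add.commute)
  have ex: "\<exists>j<n. a j \<noteq> 0"
  proof (rule ccontr)
    assume "\<not> (\<exists>j<n. a j \<noteq> 0)"
    then have "\<pi> ^ n = 0" unfolding eq by (intro sum.neutral) auto
    then show False using pi_power(2) by simp
  qed
  obtain j0 b0 where
    *: "j0 < n" "vK (a j0) = Fin b0" "vL (\<Sum>j<n. a j * \<pi> ^ (0 + j)) = Fin (int n * b0 + int (0 + j0))"
    "\<And>j b. j < n \<Longrightarrow> vK (a j) = Fin b \<Longrightarrow> int n * b0 + int j0 \<le> int n * b + int j"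
    by (rule val_pi_sum[OF aK ex, of 0]) (rule that; assumption)
  have n_eq: "int n = int n * b0 + int j0" using *(3) vL_pi_power[of n] unfolding eq[symmetric] by simp
  have "int j0 = int n * (1 - b0)" using n_eq by (simp add: algebra_simps)
  then have "int n dvd int j0" by simp
  then have j0: "j0 = 0" using *(1) by (auto dest: dvd_imp_le)
  then have b0: "b0 = 1" using n_eq n by simp
  have va: "vK (a j) = vK (coeff ?f j)" for j
    using min_poly_pi(1) by (auto simp: a_def poly_over_def K.val_uminus)
  show "vK (coeff ?f 0) = Fin 1" using *(2) j0 b0 va by simp
  show "Fin 1 \<le> vK (coeff ?f j)" if j: "j < n"
  proof (cases "a j = 0")
    case False
    then obtain b where b: "vK (a j) = Fin b" using K.val_Fin aK by blast
    have "int n \<le> int n * b + int j" using *(4)[OF j b] j0 b0 by simp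
    then have "0 < int n * b" using j by simp
    then show ?thesis using b va n by (simp add: zero_less_mult_iff)
  qed (simp add: a_def K.val_0)
qed

section \<open>Embeddings and conjugates\<close>

text \<open>Division by the minimal polynomial, one leading term at a time, until the degree is
  below \<open>n\<close> and \<open>pi_poly_nonzero\<close> applies.\<close>

lemma conjugate_root:
  assumes y: "poly (min_poly K \<pi>) y = 0"
  shows "poly_over K g \<Longrightarrow> poly g \<pi> = 0 \<Longrightarrow> poly g y = 0"
proof (induction "degree g" arbitrary: g rule: less_induct)
  case less
  let ?f = "min_poly K \<pi>"
  show ?case
  proof (cases "degree g < n")
    case True
    then show ?thesis using pi_poly_nonzero[of g] less.prems by simp
  next
    case False
    define h where "h = monom (lead_coeff g) (degree g - n) * ?f"
    have Kh: "poly_over K h" unfolding h_def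
      using less.prems min_poly_pi(1) by (intro poly_over_mult poly_over_monom K) (auto simp: poly_over_def)
    have "degree h \<le> degree g"
      unfolding h_def using degree_mult_le[of "monom (lead_coeff g) (degree g - n)" ?f]
        degree_monom_le[of "lead_coeff g" "degree g - n"] False min_poly_pi(4) by simp
    moreover have "coeff h (degree g) = lead_coeff g"
      using False min_poly_pi(2,4) by (simp add: h_def coeff_monom_mult)
    ultimately have "degree (g - h) < degree g \<or> g - h = 0"
      using False n degree_diff_le_max[of g h]
      by (metis coeff_diff diff_self le_neq_implies_less leading_coeff_0_iff max.absorb1)
    moreover have "poly h \<pi> = 0" "poly h y = 0" using y min_poly_pi(3) by (auto simp: h_def)
    ultimately have "poly (g - h) y = 0"
      using less.hyps[of "g - h"] less.prems Kh poly_over_diff[OF K, of g h] by (auto simp: poly_diff)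
    then show ?thesis using \<open>poly h y = 0\<close> by simp
  qed
qed

lemma embedding_sum:
  assumes \<sigma>: "\<sigma> \<in> embeddings K L" and a: "\<And>j. j \<in> A \<Longrightarrow> a j \<in> K" and A: "finite A"
  shows "\<sigma> (\<Sum>j\<in>A. a j * \<pi> ^ g j) = (\<Sum>j\<in>A. a j * \<sigma> \<pi> ^ g j)"
proof -
  have add: "\<sigma> (x + y) = \<sigma> x + \<sigma> y" and mult: "\<sigma> (x * y) = \<sigma> x * \<sigma> y" if "x \<in> L" "y \<in> L" for x y
    using \<sigma> that by (auto simp: embeddings_def)
  have id: "\<sigma> x = x" if "x \<in> K" for x using \<sigma> that by (auto simp: embeddings_def)
  have pw: "\<sigma> (\<pi> ^ k) = \<sigma> \<pi> ^ k" for k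
    using id[OF subfield_1[OF K]] by (induction k) (auto simp: mult pi pi_power)
  from A a show ?thesis
  proof (induction A rule: finite_induct)
    case empty
    then show ?case using id[OF subfield_0[OF K]] by simp
  next
    case (insert i A)
    have t: "a j * \<pi> ^ g j \<in> L" if "j \<in> insert i A" for j
      using insert.prems[OF that] KL pi_power by (auto intro: subfield_mult[OF L])
    have "\<sigma> (\<Sum>j\<in>insert i A. a j * \<pi> ^ g j) = \<sigma> (a i * \<pi> ^ g i) + \<sigma> (\<Sum>j\<in>A. a j * \<pi> ^ g j)"
      using insert.hyps t by (simp add: add subfield_sum[OF L])
    also have "\<sigma> (a i * \<pi> ^ g i) = a i * \<sigma> \<pi> ^ g i"
      using insert.prems[of i] KL pi_power by (simp add: mult pw id subset_iff)
    finally show ?case using insert by simp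
  qed
qed

lemma embedding_poly:
  assumes \<sigma>: "\<sigma> \<in> embeddings K L" and g: "poly_over K g"
  shows "\<sigma> (poly g \<pi>) = poly g (\<sigma> \<pi>)"
  unfolding poly_altdef using embedding_sum[OF \<sigma>, of "{..degree g}" "coeff g" "\<lambda>j. j"] g
  by (auto simp: poly_over_def)

text \<open>Every element of \<open>L\<close> is a polynomial in \<open>\<pi>\<close>, so an
  embedding is determined by the image of \<open>\<pi>\<close>. Conversely, evaluating such
  polynomials at a root \<open>y\<close> is well defined by \<open>conjugate_root\<close>.\<close>

lemma embeddings_bij:
  "bij_betw (\<lambda>\<sigma>. \<sigma> \<pi>) (embeddings K L) {y. poly (min_poly K \<pi>) y = 0}"
proof -
  have rep: "\<exists>g. poly_over K g \<and> poly g \<pi> = \<alpha>" if \<alpha>: "\<alpha> \<in> L" for \<alpha>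
  proof -
    obtain a where a: "\<And>j. a j \<in> K" "\<alpha> = (\<Sum>j<n. a j * \<pi> ^ (0 + j))" using pi_powers_span[OF \<alpha>, of 0] by blast
    show ?thesis
      by (rule exI[of _ "\<Sum>j<n. monom (a j) j"])
         (auto simp: poly_sum poly_monom a(2) intro!: poly_over_sum poly_over_monom K a(1))
  qed
  show ?thesis
    unfolding bij_betw_def
  proof
    show "inj_on (\<lambda>\<sigma>. \<sigma> \<pi>) (embeddings K L)"
    proof (rule inj_onI)
      fix \<sigma> \<tau> assume \<sigma>: "\<sigma> \<in> embeddings K L" and \<tau>: "\<tau> \<in> embeddings K L" and eq: "\<sigma> \<pi> = \<tau> \<pi>"
      have "\<sigma> \<alpha> = \<tau> \<alpha>" if "\<alpha> \<in> L" for \<alpha>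
        using rep[OF that] embedding_poly[OF \<sigma>] embedding_poly[OF \<tau>] eq by auto
      then show "\<sigma> = \<tau>" using \<sigma> \<tau> by (intro extensionalityI[of _ L]) (auto simp: embeddings_def)
    qed
    show "(\<lambda>\<sigma>. \<sigma> \<pi>) ` embeddings K L = {y. poly (min_poly K \<pi>) y = 0}"
    proof (intro equalityI subsetI)
      fix y assume "y \<in> (\<lambda>\<sigma>. \<sigma> \<pi>) ` embeddings K L"
      then obtain \<sigma> where \<sigma>: "\<sigma> \<in> embeddings K L" "y = \<sigma> \<pi>" by blast
      have "\<sigma> 0 = 0" using \<sigma>(1) subfield_0[OF K] by (auto simp: embeddings_def)
      then show "y \<in> {y. poly (min_poly K \<pi>) y = 0}"
        using embedding_poly[OF \<sigma>(1) min_poly_pi(1)] \<sigma>(2) min_poly_pi(3) by simp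
    next
      fix y assume "y \<in> {y. poly (min_poly K \<pi>) y = 0}"
      then have y: "poly (min_poly K \<pi>) y = 0" by simp
      obtain G where G: "\<And>\<alpha>. \<alpha> \<in> L \<Longrightarrow> poly_over K (G \<alpha>) \<and> poly (G \<alpha>) \<pi> = \<alpha>" using rep by metis
      have ev: "poly g y = poly g' y" if "poly_over K g" "poly_over K g'" "poly g \<pi> = poly g' \<pi>" for g g'
        using conjugate_root[OF y, of "g - g'"] poly_over_diff[OF K that(1,2)] that(3) by simp
      define \<sigma> where "\<sigma> = restrict (\<lambda>\<alpha>. poly (G \<alpha>) y) L"
      have val: "\<sigma> \<alpha> = poly g y" if "poly_over K g" "poly g \<pi> = \<alpha>" "\<alpha> \<in> L" for g \<alpha>
        using ev[of "G \<alpha>" g] G[OF that(3)] that by (simp add: \<sigma>_def)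
      have const: "poly_over K [:c:]" if "c \<in> K" for c
        using poly_over_monom[OF K that, of 0] by (simp add: monom_0)
      have "\<sigma> c = c" if "c \<in> K" for c
        using val[OF const[OF that], of c] that KL by auto
      moreover have "\<sigma> (\<alpha> + \<beta>) = \<sigma> \<alpha> + \<sigma> \<beta>" "\<sigma> (\<alpha> * \<beta>) = \<sigma> \<alpha> * \<sigma> \<beta>" if "\<alpha> \<in> L" "\<beta> \<in> L" for \<alpha> \<beta>
        using val[of "G \<alpha> + G \<beta>" "\<alpha> + \<beta>"] val[of "G \<alpha> * G \<beta>" "\<alpha> * \<beta>"] G[OF that(1)] G[OF that(2)]
          val[of "G \<alpha>" \<alpha>] val[of "G \<beta>" \<beta>] that
          poly_over_add[OF K, of "G \<alpha>" "G \<beta>"] poly_over_mult[OF K, of "G \<alpha>" "G \<beta>"]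
          subfield_add[OF L that] subfield_mult[OF L that] by auto
      ultimately have "\<sigma> \<in> embeddings K L" by (auto simp: embeddings_def \<sigma>_def)
      moreover have "\<sigma> \<pi> = y"
        using val[of "monom 1 1" \<pi>] pi poly_over_monom[OF K subfield_1[OF K], of 1] by (simp add: poly_monom)
      ultimately show "y \<in> (\<lambda>\<sigma>. \<sigma> \<pi>) ` embeddings K L" by blast
    qed
  qed
qed

text \<open>The conjugates of an element expanded in powers of \<open>\<pi>\<close> are the values
  of the same expansion at the roots. From here on embeddings are replaced by the indices of the
  roots.\<close>

lemma E_sym_pi_sum:
  assumes x: "inj_on x {..<n}" "min_poly K \<pi> = (\<Prod>i<n. [:- x i, 1:])"
    and a: "\<And>j. j \<in> A \<Longrightarrow> a j \<in> K" and A: "finite A"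
  shows "E_sym K L h (\<Sum>j\<in>A. a j * \<pi> ^ g j) = elem_sym h {..<n} (\<lambda>i. \<Sum>j\<in>A. a j * x i ^ g j)"
proof -
  have "{y. poly (min_poly K \<pi>) y = 0} = x ` {..<n}" by (auto simp: x(2) poly_prod)
  then have b: "inj_on (\<lambda>\<sigma>. \<sigma> \<pi>) (embeddings K L)" "(\<lambda>\<sigma>. \<sigma> \<pi>) ` embeddings K L = x ` {..<n}"
    using embeddings_bij by (auto simp: bij_betw_def)
  let ?G = "\<lambda>y. \<Sum>j\<in>A. a j * y ^ g j"
  have "E_sym K L h (\<Sum>j\<in>A. a j * \<pi> ^ g j) = elem_sym h (embeddings K L) (\<lambda>\<sigma>. ?G (\<sigma> \<pi>))"
    unfolding E_sym_def elem_sym_def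
  proof (intro sum.cong prod.cong refl)
    fix S \<sigma> assume "S \<in> {S. S \<subseteq> embeddings K L \<and> card S = h}" "\<sigma> \<in> S"
    then show "\<sigma> (\<Sum>j\<in>A. a j * \<pi> ^ g j) = ?G (\<sigma> \<pi>)" by (intro embedding_sum a A) auto
  qed
  also have "\<dots> = elem_sym h (x ` {..<n}) ?G" using elem_sym_image[OF b(1), of h ?G] b(2) by simp
  also have "\<dots> = elem_sym h {..<n} (\<lambda>i. ?G (x i))" by (rule elem_sym_image[OF x(1)])
  finally show ?thesis .
qed

lemma min_poly_c_eq:
  assumes x: "min_poly K \<pi> = (\<Prod>i<n. [:- x i, 1:])" and h: "h \<le> n"
  shows "min_poly_c K n \<pi> h = elem_sym h {..<n} x"
  using coeff_prod_linear[of "{..<n}" h x] h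
  by (simp add: min_poly_c_def x flip: mult.assoc power_mult_distrib)

end

section \<open>Elementary symmetric polynomials of sums of powers\<close>

lemma posmset_extend:
  assumes J: "finite J" and S: "S \<subseteq> J" and g: "\<And>i. i \<in> S \<Longrightarrow> 0 < g i"
  shows "posmset J (\<lambda>i. if i \<in> S then g i else 0) = image_mset g (mset_set S)"
proof -
  let ?g = "\<lambda>i. if i \<in> S then g i else 0"
  have "{i\<in>J. 0 < ?g i} = S" using S g by auto
  then have "posmset J ?g = image_mset ?g (mset_set S)"
    using J by (simp add: posmset_def filter_mset_image_mset)
  also have "\<dots> = image_mset g (mset_set S)"
    by (rule image_mset_cong) (use finite_subset[OF S J] in auto)
  finally show ?thesis .
qed

text \<open>Multiply out by choosing an index set \<open>S\<close> and an exponent in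
  \<open>W\<close> for each of its elements. Exponents are positive, so \<open>S\<close> is
  recovered as the support of the exponent vector; grouping by type gives the result.\<close>

lemma elem_sym_sum_powers:
  fixes x :: "'i \<Rightarrow> 'a::comm_ring_1"
  assumes J: "finite J" and W: "finite W" "0 \<notin> W"
  shows "elem_sym h J (\<lambda>i. \<Sum>e\<in>W. a e * x i ^ e)
    = (\<Sum>\<mu> | size \<mu> = h \<and> set_mset \<mu> \<subseteq> W. (\<Prod>e\<in>#\<mu>. a e) * monom_sym J \<mu> x)"
proof -
  let ?Sub = "{S. S \<subseteq> J \<and> card S = h}"
  let ?M = "{\<mu>. size \<mu> = h \<and> set_mset \<mu> \<subseteq> W}"
  have fin: "finite S" if "S \<subseteq> J" for S using that J finite_subset by blast
  have "elem_sym h J (\<lambda>i. \<Sum>e\<in>W. a e * x i ^ e) = (\<Sum>S\<in>?Sub. \<Sum>g\<in>S \<rightarrow>\<^sub>E W. \<Prod>i\<in>S. a (g i) * x i ^ g i)"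
    unfolding elem_sym_def by (intro sum.cong refl prod_sum_PiE) (use fin W in auto)
  also have "\<dots> = (\<Sum>(S, g)\<in>Sigma ?Sub (\<lambda>S. S \<rightarrow>\<^sub>E W). \<Prod>i\<in>S. a (g i) * x i ^ g i)"
    by (rule sum.Sigma) (use J W fin in \<open>auto intro!: finite_PiE\<close>)
  also have "\<dots> = (\<Sum>(\<mu>, g)\<in>Sigma ?M (\<lambda>\<mu>. expos J \<mu>). (\<Prod>e\<in>#\<mu>. a e) * (\<Prod>i\<in>J. x i ^ g i))"
  proof (rule sum.reindex_bij_witness[of _ "\<lambda>(\<mu>, g). ({i\<in>J. 0 < g i}, restrict g {i\<in>J. 0 < g i})"
        "\<lambda>(S, g). (image_mset g (mset_set S), \<lambda>i. if i \<in> S then g i else 0)"], goal_cases)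
    case (1 y)
    then obtain S g where y: "y = (S, g)" "S \<subseteq> J" "g \<in> S \<rightarrow>\<^sub>E W" by auto
    then have "0 < g i" if "i \<in> S" for i using that W by (metis PiE_mem gr0I)
    then have "{i\<in>J. 0 < (if i \<in> S then g i else 0)} = S" using y(2) by auto
    moreover have "restrict (\<lambda>i. if i \<in> S then g i else 0) S = g"
      using y(3) by (auto simp: fun_eq_iff PiE_def extensional_def)
    ultimately show ?case using y(1) by simp
  next
    case (2 y)
    then obtain S g where y: "y = (S, g)" "S \<subseteq> J" "card S = h" "g \<in> S \<rightarrow>\<^sub>E W" by auto
    then have g: "0 < g i" if "i \<in> S" for i using that W by (metis PiE_mem gr0I)
    show ?case using y fin[OF y(2)] posmset_extend[OF J y(2), of g] g by (auto simp: expos_def)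
  next
    case (3 y)
    then obtain \<mu> g where y: "y = (\<mu>, g)" "g \<in> expos J \<mu>" by auto
    let ?S = "{i\<in>J. 0 < g i}"
    have "image_mset (restrict g ?S) (mset_set ?S) = image_mset g (mset_set ?S)"
      by (rule image_mset_cong) (use J in auto)
    also have "\<dots> = \<mu>" using y J by (auto simp: expos_def posmset_def filter_mset_image_mset)
    finally show ?case using y by (auto simp: expos_def fun_eq_iff)
  next
    case (4 y)
    then obtain \<mu> g where y: "y = (\<mu>, g)" "g \<in> expos J \<mu>" "size \<mu> = h" "set_mset \<mu> \<subseteq> W" by auto
    then have "posmset J g = \<mu>" by (simp add: expos_def)
    moreover have "g i \<in># posmset J g" if "i \<in> J" "0 < g i" for i using that J by (auto simp: posmset_def)
    ultimately show ?case using y size_posmset[OF J, of g] by auto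
  next
    case (5 y)
    then obtain S g where y: "y = (S, g)" "S \<subseteq> J" "g \<in> S \<rightarrow>\<^sub>E W" by auto
    have "(\<Prod>i\<in>J. x i ^ (if i \<in> S then g i else 0)) = (\<Prod>i\<in>S. x i ^ (if i \<in> S then g i else 0))"
      by (rule prod.mono_neutral_right) (use y J in auto)
    also have "\<dots> = (\<Prod>i\<in>S. x i ^ g i)" by (rule prod.cong) auto
    finally show ?case using y by (simp add: prod.distrib multiset.map_comp comp_def prod_unfold_prod_mset)
  qed
  also have "\<dots> = (\<Sum>\<mu>\<in>?M. \<Sum>g\<in>expos J \<mu>. (\<Prod>e\<in>#\<mu>. a e) * (\<Prod>i\<in>J. x i ^ g i))"
    by (rule sum.Sigma[symmetric]) (use J W in \<open>auto simp: finite_multisets_of_size finite_expos\<close>)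
  finally show ?thesis by (simp add: monom_sym_def sum_distrib_left)
qed

text \<open>Parametrizes the types occurring for two-term elements by the multiplicity
  \<open>s\<close> of \<open>r'\<close>, which becomes the exponent of \<open>b\<close> in
  \<open>E_sym_two_terms\<close>.\<close>

lemma multisets_two_values:
  assumes "r \<noteq> (r' :: nat)"
  shows "{\<mu>. size \<mu> = h \<and> set_mset \<mu> \<subseteq> {r, r'}} = (\<lambda>s. replicate_mset (h - s) r + replicate_mset s r') ` {..h}"
    and "inj_on (\<lambda>s. replicate_mset (h - s) r + replicate_mset s r') {..h}"
proof -
  have ex: "\<exists>s\<le>size \<mu>. \<mu> = replicate_mset (size \<mu> - s) r + replicate_mset s r'" if "set_mset \<mu> \<subseteq> {r, r'}" for \<mu>
    using that
  proof (induction \<mu>)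
    case (add e \<mu>)
    then obtain s where s: "s \<le> size \<mu>" "\<mu> = replicate_mset (size \<mu> - s) r + replicate_mset s r'" by auto
    show ?case
    proof (cases "e = r")
      case True
      have "Suc (size \<mu>) - s = Suc (size \<mu> - s)" using s(1) by simp
      then show ?thesis using True s by (intro exI[of _ s]) (metis (no_types) add_mset_add_single le_SucI replicate_mset_Suc size_add_mset union_mset_add_mset_left)
    next
      case False
      then have "e = r'" using add.prems by auto
      then show ?thesis using s by (intro exI[of _ "Suc s"]) (metis (no_types) Suc_le_mono diff_Suc_Suc replicate_mset_Suc size_add_mset union_mset_add_mset_right)
    qed
  qed simp
  show "{\<mu>. size \<mu> = h \<and> set_mset \<mu> \<subseteq> {r, r'}} = (\<lambda>s. replicate_mset (h - s) r + replicate_mset s r') ` {..h}"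
  proof (intro equalityI subsetI)
    fix \<mu> assume "\<mu> \<in> {\<mu>. size \<mu> = h \<and> set_mset \<mu> \<subseteq> {r, r'}}"
    then show "\<mu> \<in> (\<lambda>s. replicate_mset (h - s) r + replicate_mset s r') ` {..h}" using ex[of \<mu>] by auto
  next
    fix \<mu> assume "\<mu> \<in> (\<lambda>s. replicate_mset (h - s) r + replicate_mset s r') ` {..h}"
    then obtain s where "s \<le> h" "\<mu> = replicate_mset (h - s) r + replicate_mset s r'" by auto
    then show "\<mu> \<in> {\<mu>. size \<mu> = h \<and> set_mset \<mu> \<subseteq> {r, r'}}" by (auto split: if_splits)
  qed
  show "inj_on (\<lambda>s. replicate_mset (h - s) r + replicate_mset s r') {..h}"
  proof (rule inj_onI)
    fix s t assume "replicate_mset (h - s) r + replicate_mset s r' = replicate_mset (h - t) r + replicate_mset t r'"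
    then have "count (replicate_mset (h - s) r + replicate_mset s r') r' = count (replicate_mset (h - t) r + replicate_mset t r') r'" by simp
    then show "s = t" using assms by simp
  qed
qed

section \<open>The truncated p-adic valuation\<close>

lemma vp_trunc_le: "vp_trunc p \<nu> a \<le> \<nu>"
  by (simp add: vp_trunc_def)

lemma le_vp_trunc_iff:
  assumes p: "prime p" and t: "t \<le> \<nu>"
  shows "t \<le> vp_trunc p \<nu> a \<longleftrightarrow> int p ^ t dvd a"
proof (cases "a = 0")
  case False
  have "\<not> is_unit (int p)" using prime_gt_1_nat[OF p] by simp
  then have "int p ^ t dvd a \<longleftrightarrow> t \<le> multiplicity (int p) a"
    using False by (intro power_dvd_iff_le_multiplicity) auto
  then show ?thesis using False t by (simp add: vp_trunc_def)
qed (use t in \<open>simp add: vp_trunc_def\<close>)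

text \<open>Invariance modulo \<open>p ^ \<nu>\<close> and under a change of sign. The form with
  \<open>a + b\<close> fits the relation that \<open>n\<close> divides the sum of the index of
  inseparability and \<open>h\<close>.\<close>

lemma vp_trunc_cong:
  assumes p: "prime p" and ab: "int p ^ \<nu> dvd a + b"
  shows "vp_trunc p \<nu> a = vp_trunc p \<nu> b"
proof -
  have "t \<le> vp_trunc p \<nu> a \<longleftrightarrow> t \<le> vp_trunc p \<nu> b" if t: "t \<le> \<nu>" for t
  proof -
    have "int p ^ t dvd a + b" using ab t by (meson dvd_trans le_imp_power_dvd)
    then have "int p ^ t dvd a \<longleftrightarrow> int p ^ t dvd b" by (metis dvd_add_right_iff dvd_add_left_iff)
    then show ?thesis using le_vp_trunc_iff[OF p t] by simp
  qed
  then show ?thesis using vp_trunc_le by (meson order_antisym order_refl)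
qed

section \<open>Unit values of integral polynomials and units among the integers\<close>

context valued_field
begin

lemma val_ge_poly:
  assumes "\<And>i. coeff q i \<in> F \<and> Fin 0 \<le> v (coeff q i)" "b \<in> F" "Fin 0 \<le> v b"
  shows "poly q b \<in> F \<and> Fin 0 \<le> v (poly q b)"
  using assms(1)
proof (induction q)
  case 0
  then show ?case by (simp add: val_0 subfield_0[OF F])
next
  case (pCons a q)
  have a: "a \<in> F" "Fin 0 \<le> v a" using pCons.prems[of 0] by auto
  have "poly q b \<in> F \<and> Fin 0 \<le> v (poly q b)"
    using pCons.prems[of "Suc i" for i] by (intro pCons.IH) simp
  then show ?case
    using a assms(2,3) val_ge_mult[of b "poly q b" 0 0] subfield_mult[OF F, of b "poly q b"]
    by (auto intro: val_ge_add subfield_add[OF F])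
qed

lemma synthetic_div_integral:
  assumes "\<And>i. coeff q i \<in> F \<and> Fin 0 \<le> v (coeff q i)" "b \<in> F" "Fin 0 \<le> v b"
  shows "coeff (synthetic_div q b) i \<in> F \<and> Fin 0 \<le> v (coeff (synthetic_div q b) i)"
  using assms(1)
proof (induction q arbitrary: i)
  case 0
  then show ?case by (simp add: val_0 subfield_0[OF F])
next
  case (pCons a q)
  have "coeff q i \<in> F \<and> Fin 0 \<le> v (coeff q i)" for i using pCons.prems[of "Suc i"] by simp
  then show ?case using pCons.IH val_ge_poly[of q b] assms(2,3) by (cases i) auto
qed

text \<open>Over the residue field a nonzero polynomial has at most as many roots as its degree;
  here representatives with unit differences replace residue classes. If the value at
  \<open>b0\<close> is not a unit, a unit value of the quotient by \<open>X - b0\<close> at another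
  element of \<open>B\<close> gives a unit value of \<open>q\<close>.\<close>

lemma exists_unit_value:
  assumes "\<And>i. coeff q i \<in> F \<and> Fin 0 \<le> v (coeff q i)" "v (lead_coeff q) = Fin 0"
    and "finite B" "degree q < card B" "\<And>b. b \<in> B \<Longrightarrow> b \<in> F \<and> Fin 0 \<le> v b"
    and "\<And>b b'. b \<in> B \<Longrightarrow> b' \<in> B \<Longrightarrow> b \<noteq> b' \<Longrightarrow> v (b - b') = Fin 0"
  shows "\<exists>b\<in>B. v (poly q b) = Fin 0"
  using assms
proof (induction "degree q" arbitrary: q B)
  case 0
  then obtain b where "b \<in> B" by fastforce
  moreover obtain a where "q = [:a:]" using 0(1) degree_eq_zeroE by metis
  ultimately show ?case using 0 by auto
next
  case (Suc N)
  then obtain b0 where b0: "b0 \<in> B" by fastforce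
  define q' where "q' = synthetic_div q b0"
  have q: "q = [:- b0, 1:] * q' + [:poly q b0:]" unfolding q'_def by (rule synthetic_div_correct'[symmetric])
  have dq': "degree q' = N" using Suc.hyps(2) by (simp add: q'_def degree_synthetic_div)
  have "coeff q (Suc N) = coeff q' N"
    by (subst q) (simp add: coeff_eq_0 dq')
  then have lq': "v (lead_coeff q') = Fin 0" using Suc.prems(2) Suc.hyps(2) dq' by simp
  have cq': "coeff q' i \<in> F \<and> Fin 0 \<le> v (coeff q' i)" for i
    unfolding q'_def using Suc.prems(1,5) b0 by (intro synthetic_div_integral) auto
  have "\<exists>b\<in>B - {b0}. v (poly q' b) = Fin 0"
    using Suc.hyps(1)[of q' "B - {b0}"] dq' lq' cq' Suc.prems Suc.hyps(2) b0 by (auto simp: card_Diff_singleton)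
  then obtain b where b: "b \<in> B" "b \<noteq> b0" "v (poly q' b) = Fin 0" by blast
  have bF: "b \<in> F" "b0 \<in> F" using Suc.prems b b0 by auto
  have dF: "b - b0 \<in> F" "v (b - b0) = Fin 0" using Suc.prems(6) b b0 bF by (auto intro: subfield_diff[OF F])
  have "poly q' b \<in> F" using val_ge_poly[of q' b] cq' Suc.prems(5)[OF b(1)] by blast
  then have 1: "(b - b0) * poly q' b \<in> F" "v ((b - b0) * poly q' b) = Fin 0"
    using dF b(3) by (auto simp: val_mult intro: subfield_mult[OF F])
  have eq: "poly q b = (b - b0) * poly q' b + poly q b0" by (subst q) (simp add: algebra_simps)
  have qb: "poly q b0 \<in> F" "Fin 0 \<le> v (poly q b0)" using val_ge_poly[of q b0] Suc.prems(1,5) b0 by auto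
  show ?case
  proof (cases "v (poly q b0) = Fin 0")
    case False
    then have "Fin 0 < v (poly q b0)" using qb by (simp add: order_less_le)
    then have "v (poly q b) = Fin 0" unfolding eq using 1 qb by (intro val_add_strict)
    then show ?thesis using b by blast
  qed (use b0 in blast)
qed

text \<open>Representatives of different classes differ by a unit. One more than \<open>N\<close> of
  them are chosen, to be used with a polynomial of degree \<open>N\<close>.\<close>

lemma residue_representatives:
  assumes "infinite (residue_field F v) \<or> N < card (residue_field F v)"
  obtains B where "finite B" "card B = Suc N" "\<And>b. b \<in> B \<Longrightarrow> b \<in> F \<and> Fin 0 \<le> v b"
    "\<And>b b'. b \<in> B \<Longrightarrow> b' \<in> B \<Longrightarrow> b \<noteq> b' \<Longrightarrow> v (b - b') = Fin 0"
proof -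
  let ?O = "valuation_ring F v"
  define R where "R = {(x, y). x \<in> ?O \<and> y \<in> ?O \<and> x - y \<in> maximal_ideal F v}"
  have cls: "R `` {b} = R `` {b'}" if "b \<in> ?O" "b' \<in> ?O" "b - b' \<in> maximal_ideal F v" for b b'
  proof -
    have max: "y \<in> maximal_ideal F v \<longleftrightarrow> y \<in> F \<and> Fin 1 \<le> v y" for y
      using extended_Suc_le_iff[of 0 "v y"] by (auto simp: maximal_ideal_def zero_extended_def)
    have sub: "y - z \<in> maximal_ideal F v" if "y \<in> maximal_ideal F v" "z \<in> maximal_ideal F v" for y z
      using that val_ge_add[of y "- z" 1] by (auto simp: max val_uminus intro: subfield_diff[OF F] subfield_uminus[OF F])
    have "0 \<in> maximal_ideal F v" by (simp add: max val_0 subfield_0[OF F])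
    then have "b' - b \<in> maximal_ideal F v" using sub[of 0 "b - b'"] that by simp
    then show ?thesis using that sub[of "b - z" "b - b'" for z] sub[of "b' - z" "b' - b" for z] by (auto simp: R_def algebra_simps)
  qed
  obtain \<C> where C: "\<C> \<subseteq> residue_field F v" "finite \<C>" "card \<C> = Suc N"
    using assms obtain_subset_with_card_n[of "Suc N" "residue_field F v"] infinite_arbitrarily_large
    by (metis Suc_leI)
  have "\<forall>X\<in>\<C>. \<exists>b\<in>?O. X = R `` {b}" using C(1) unfolding residue_field_def quotient_def R_def[symmetric] by blast
  then obtain f where f: "\<And>X. X \<in> \<C> \<Longrightarrow> f X \<in> ?O \<and> X = R `` {f X}" by metis
  have inj: "inj_on f \<C>" using f by (metis inj_onI)
  show ?thesis
  proof (rule that[of "f ` \<C>"])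
    show "card (f ` \<C>) = Suc N" using inj C by (simp add: card_image)
    fix b assume b: "b \<in> f ` \<C>"
    then show bF: "b \<in> F \<and> Fin 0 \<le> v b" using f by (auto simp: valuation_ring_def zero_extended_def)
    fix b' assume b': "b' \<in> f ` \<C>" "b \<noteq> b'"
    then have bF': "b' \<in> F \<and> Fin 0 \<le> v b'" using f by (auto simp: valuation_ring_def zero_extended_def)
    have "Fin 0 \<le> v (b - b')" using val_ge_add[of b "- b'" 0] bF bF' by (simp add: val_uminus subfield_uminus[OF F])
    moreover have "\<not> Fin 0 < v (b - b')"
    proof
      assume "Fin 0 < v (b - b')"
      then have "b - b' \<in> maximal_ideal F v"
        using bF bF' by (auto simp: maximal_ideal_def zero_extended_def intro: subfield_diff[OF F])
      then have "R `` {b} = R `` {b'}" using b b' f by (intro cls) auto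
      then show False using b b' f by auto
    qed
    ultimately show "v (b - b') = Fin 0" by simp
  qed (use C in auto)
qed

lemma val_ge_of_int: "Fin 0 \<le> v (of_int a)"
proof -
  have nat: "Fin 0 \<le> v (of_nat b)" for b
    by (induction b) (auto simp: val_0 val_1 intro!: val_ge_add subfield_1[OF F] subfield_of_nat[OF F])
  show ?thesis
    using nat[of "nat a"] nat[of "nat (- a)"] val_uminus[OF subfield_of_nat[OF F], of "nat (- a)"]
    by (cases "0 \<le> a") auto
qed

text \<open>By Bezout 1 is a combination of \<open>p\<close> and \<open>a\<close>, so they cannot
  both have positive valuation.\<close>

lemma val_of_int_unit:
  assumes p: "prime p" "Fin 1 \<le> v (of_nat p)" and a: "\<not> int p dvd a"
  shows "v (of_int a) = Fin 0"
proof (rule ccontr)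
  assume "v (of_int a) \<noteq> Fin 0"
  then have ge: "Fin 1 \<le> v (of_int a)"
    using val_ge_of_int[of a] extended_Suc_le_iff[of 0 "v (of_int a)"] by (simp add: order_less_le)
  have "coprime (int p) a" using p(1) a by (simp add: prime_imp_coprime)
  then obtain s t where st: "s * int p + t * a = 1"
    using bezout_int[of "int p" a] by (auto simp: coprime_iff_gcd_eq_1)
  have "Fin (0 + 1) \<le> v (of_int s * of_nat p)" "Fin (0 + 1) \<le> v (of_int t * of_int a)"
    by (intro val_ge_mult val_ge_of_int p ge subfield_of_int[OF F] subfield_of_nat[OF F])+
  then have "Fin 1 \<le> v (of_int s * of_nat p + of_int t * of_int a)"
    by (intro val_ge_add subfield_mult[OF F] subfield_of_int[OF F] subfield_of_nat[OF F]) auto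
  also have "of_int s * of_nat p + of_int t * of_int a = (of_int (s * int p + t * a) :: 'a)" by simp
  finally show False using st val_1 by simp
qed

end

section \<open>Valuations of the terms\<close>

text \<open>In the application \<open>i\<close> is the index of inseparability and \<open>k\<close>
  is the only place where the minimum defining it is attained; \<open>insep_index_cases\<close>
  provides \<open>k\<close>. The \<open>+ 1\<close> in \<open>ne_k\<close> expresses strictness, and
  truncated subtraction gives exponent 0 when the truncated valuation of \<open>h\<close> is below
  \<open>j\<close>.\<close>

locale insep_ext = tot_ram K L vK vL n \<pi>
  for K L :: "'a::field set" and vK vL :: "'a \<Rightarrow> int extended" and n :: nat and \<pi> :: 'a +
  fixes x :: "nat \<Rightarrow> 'a" and p \<nu> j k m :: nat and i :: int
  assumes x: "inj_on x {..<n}" "min_poly K \<pi> = (\<Prod>i<n. [:- x i, 1:])"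
    and p: "prime p" "p ^ \<nu> dvd n" "Fin 1 \<le> vK (of_nat p)" and mj: "j \<le> \<nu>" "m < j"
    and k: "0 < k" "k < n" "vp_trunc p \<nu> (int k) = m" "vL (elem_sym k {..<n} x) = Fin (i + int k)"
    and ne_k: "\<And>h. h \<in> {1..n} \<Longrightarrow> h \<noteq> k \<Longrightarrow>
      Fin (i + int h + 1) \<le> vL (of_nat p ^ (vp_trunc p \<nu> (int h) - j) * elem_sym h {..<n} x)"
begin

abbreviation c :: "nat \<Rightarrow> 'a" where "c h \<equiv> elem_sym h {..<n} x"

lemma c_in_K: "c h \<in> K"
proof (cases "h \<le> n")
  case True
  then show ?thesis
    using min_poly_pi(1) subfield_1[OF K]
    unfolding min_poly_c_eq[OF x(2) True, symmetric] min_poly_c_def poly_over_def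
    by (intro subfield_mult[OF K] subfield_power[OF K] subfield_uminus[OF K]) auto
qed (simp add: elem_sym_gt_card subfield_0[OF K])

lemma c_in_L: "c h \<in> L"
  using c_in_K KL by blast

lemma val_c_eq: "h \<in> {1..n} \<Longrightarrow> vK (c h) = vK (coeff (min_poly K \<pi>) (n - h))"
proof -
  assume h: "h \<in> {1..n}"
  have co: "coeff (min_poly K \<pi>) (n - h) \<in> K" using min_poly_pi(1) by (simp add: poly_over_def)
  have "(- 1 :: 'a) ^ h = 1 \<or> (- 1 :: 'a) ^ h = - 1" by (cases "even h") auto
  moreover have "c h = (- 1) ^ h * coeff (min_poly K \<pi>) (n - h)"
    using min_poly_c_eq[OF x(2), of h] h by (simp add: min_poly_c_def)
  ultimately show ?thesis using K.val_uminus[OF co] by auto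
qed

lemma val_c_ge: "h \<in> {1..n} \<Longrightarrow> Fin (int n) \<le> vL (c h)"
proof -
  assume h: "h \<in> {1..n}"
  then have "Fin 1 \<le> vK (c h)" using min_poly_eisenstein(1)[of "n - h"] val_c_eq by simp
  then show ?thesis using vK_ge_imp_vL_ge[OF c_in_K] by force
qed

lemma val_c_n: "vL (c n) = Fin (int n)"
proof -
  have "vK (c n) = Fin 1" using min_poly_eisenstein(2) val_c_eq[of n] n by simp
  then show ?thesis using c_in_K[of n] by (simp add: vLK nmul_Fin)
qed

lemma elem_prod_in_L: "elem_prod {..<n} \<kappa> x \<in> L"
  unfolding elem_prod_def by (intro subfield_prod_mset[OF L] c_in_L)

lemma elem_prod_in_K: "elem_prod {..<n} \<kappa> x \<in> K"
  unfolding elem_prod_def by (intro subfield_prod_mset[OF K] c_in_K)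

lemma val_elem_prod:
  assumes "set_mset \<kappa> \<subseteq> {1..n}"
  shows "Fin (int (sum_mset \<kappa>)) \<le> vL (elem_prod {..<n} \<kappa> x)"
proof -
  have "Fin (\<Sum>h\<in>#\<kappa>. int h) \<le> vL (elem_prod {..<n} \<kappa> x)"
    unfolding elem_prod_def
  proof (rule L.val_ge_prod_mset)
    fix h assume "h \<in># \<kappa>"
    then have h: "h \<in> {1..n}" using assms by auto
    have "Fin (int h) \<le> Fin (int n)" using h by simp
    also have "\<dots> \<le> vL (c h)" using val_c_ge[OF h] .
    finally show "c h \<in> L \<and> Fin (int h) \<le> vL (c h)" using c_in_L by blast
  qed
  also have "(\<Sum>h\<in>#\<kappa>. int h) = int (sum_mset \<kappa>)" by (induction \<kappa>) auto
  finally show ?thesis .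
qed

text \<open>A part \<open>h < n\<close> contributes at least \<open>n\<close>, hence at least one
  more than its share \<open>h\<close> of the weight.\<close>

lemma val_elem_prod_strict:
  assumes \<kappa>: "set_mset \<kappa> \<subseteq> {1..n}" and ne: "\<kappa> \<noteq> replicate_mset (size \<kappa>) n"
  shows "Fin (int (sum_mset \<kappa>) + 1) \<le> vL (elem_prod {..<n} \<kappa> x)"
proof -
  obtain h where h: "h \<in># \<kappa>" "h \<noteq> n"
    using ne set_mset_subset_singletonD[of \<kappa> n] by blast
  then obtain \<kappa>' where \<kappa>': "\<kappa> = add_mset h \<kappa>'" by (metis mset_add)
  have hn: "h \<in> {1..n}" "h < n" using h \<kappa> by auto
  have "Fin (int h + 1) \<le> Fin (int n)" using hn by simp
  also have "\<dots> \<le> vL (c h)" using val_c_ge hn by blast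
  finally have "Fin ((int h + 1) + int (sum_mset \<kappa>')) \<le> vL (c h * elem_prod {..<n} \<kappa>' x)"
    using \<kappa> \<kappa>' by (intro L.val_ge_mult c_in_L elem_prod_in_L val_elem_prod) auto
  then show ?thesis by (simp add: \<kappa>' elem_prod_def algebra_simps)
qed

text \<open>One choice of integers for both rings: valuations are estimated in the given field,
  while divisibility is proved over the complex numbers.\<close>

definition d :: "nat multiset \<Rightarrow> nat multiset \<Rightarrow> int" where
  "d \<mu> = (SOME d. (\<forall>x :: nat \<Rightarrow> 'a. monom_sym {..<n} \<mu> x = elem_sum {..<n} (sum_mset \<mu>) d x) \<and>
     (\<forall>x :: nat \<Rightarrow> complex. monom_sym {..<n} \<mu> x = elem_sum {..<n} (sum_mset \<mu>) d x))"

lemma d: "monom_sym {..<n} \<mu> (y :: nat \<Rightarrow> 'a) = elem_sum {..<n} (sum_mset \<mu>) (d \<mu>) y"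
  "monom_sym {..<n} \<mu> (z :: nat \<Rightarrow> complex) = elem_sum {..<n} (sum_mset \<mu>) (d \<mu>) z"
proof -
  have "\<exists>d. (\<forall>x :: nat \<Rightarrow> 'a. monom_sym {..<n} \<mu> x = elem_sum {..<n} (sum_mset \<mu>) d x) \<and>
     (\<forall>x :: nat \<Rightarrow> complex. monom_sym {..<n} \<mu> x = elem_sum {..<n} (sum_mset \<mu>) d x)"
    by (rule monom_sym_eq_elem_sum[where ?'a = 'a and ?'b = complex, OF finite_lessThan]) blast
  from someI_ex[OF this] show "monom_sym {..<n} \<mu> y = elem_sum {..<n} (sum_mset \<mu>) (d \<mu>) y"
    "monom_sym {..<n} \<mu> z = elem_sum {..<n} (sum_mset \<mu>) (d \<mu>) z"
    unfolding d_def by blast+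
qed

text \<open>Let \<open>h\<close> be a part of least truncated p-adic valuation \<open>l\<close>.
  Since \<open>p ^ l\<close> divides all parts, \<open>p ^ (l - j)\<close> divides the coefficient;
  together with \<open>c h\<close> it contributes \<open>i + h\<close>, and the other parts
  contribute at least their weight. One of the two bounds is strict unless \<open>h = k\<close> and
  all other parts are \<open>n\<close>.\<close>

lemma val_term_ge:
  assumes \<mu>: "0 \<notin># \<mu>" "size \<mu> = p ^ j" and \<kappa>: "\<kappa> \<in> partitions_le n (sum_mset \<mu>)"
  shows "Fin (i + int (sum_mset \<mu>) + of_bool (\<nexists>t. \<kappa> = add_mset k (replicate_mset t n)))
    \<le> vL (of_int (d \<mu> \<kappa>) * elem_prod {..<n} \<kappa> x)"
proof -
  let ?l = "\<lambda>h. vp_trunc p \<nu> (int h)"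
  have \<kappa>n: "set_mset \<kappa> \<subseteq> {1..n}" and \<kappa>w: "sum_mset \<kappa> = sum_mset \<mu>" using \<kappa> by (auto simp: partitions_le_def)
  have "size \<mu> \<noteq> 0" using \<mu>(2) p(1) prime_gt_0_nat by simp
  then have "sum_mset \<mu> \<noteq> 0" using size_le_sum_mset[of \<mu>] \<mu>(1) by (metis le_zero_eq neq0_conv)
  then have "\<kappa> \<noteq> {#}" using \<kappa>w by auto
  then have "Min (?l ` set_mset \<kappa>) \<in> ?l ` set_mset \<kappa>" by (intro Min_in) auto
  then obtain h where h1: "h \<in># \<kappa>" "Min (?l ` set_mset \<kappa>) = ?l h" by (elim imageE)
  have h: "h \<in># \<kappa>" "\<And>h'. h' \<in># \<kappa> \<Longrightarrow> ?l h \<le> ?l h'"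
    using h1(1) by (auto simp: h1(2)[symmetric])
  have "\<forall>h'\<in>#\<kappa>. p ^ ?l h dvd h'"
  proof
    fix h' assume "h' \<in># \<kappa>"
    then have "int p ^ ?l h dvd int h'" using h(2) le_vp_trunc_iff[OF p(1) vp_trunc_le] by blast
    then show "p ^ ?l h dvd h'" by (metis int_dvd_int_iff of_nat_power)
  qed
  then have "int (p ^ ?l h) dvd int (size \<mu>) * d \<mu> \<kappa>"
    using \<mu> \<kappa> by (intro dvd_size_mult_coeff[OF d(2)])
  then have dv: "int p ^ ?l h dvd int p ^ j * d \<mu> \<kappa>" using \<mu>(2) by simp
  \<comment> \<open>Cancel \<open>p ^ j\<close>. For \<open>?l h < j\<close> the exponent is 0 and
    nothing is claimed.\<close>
  have "int p ^ (?l h - j) dvd d \<mu> \<kappa>"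
  proof (cases "j \<le> ?l h")
    case True
    then have "int p ^ ?l h = int p ^ j * int p ^ (?l h - j)" by (simp flip: power_add)
    then show ?thesis using dv p(1) by (simp add: prime_gt_0_nat)
  qed simp
  then obtain d' where d': "d \<mu> \<kappa> = int p ^ (?l h - j) * d'" by blast
  obtain \<kappa>' where \<kappa>': "\<kappa> = add_mset h \<kappa>'" using h(1) by (metis mset_add)
  have \<kappa>'n: "set_mset \<kappa>' \<subseteq> {1..n}" and hn: "h \<in> {1..n}" using \<kappa>n \<kappa>' by auto
  let ?a = "of_nat p ^ (?l h - j) * c h"
  have eq: "of_int (d \<mu> \<kappa>) * elem_prod {..<n} \<kappa> x = of_int d' * (?a * elem_prod {..<n} \<kappa>' x)"
    unfolding d' by (simp add: \<kappa>' elem_prod_def mult_ac)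
  have aL: "?a \<in> L" by (intro subfield_mult[OF L] subfield_power[OF L] subfield_of_nat[OF L] c_in_L)
  have va: "Fin (i + int h + of_bool (h \<noteq> k)) \<le> vL ?a"
    using ne_k[OF hn] k(3,4) mj(2) by (cases "h = k") auto
  have vk: "Fin (int (sum_mset \<kappa>') + of_bool (\<kappa>' \<noteq> replicate_mset (size \<kappa>') n)) \<le> vL (elem_prod {..<n} \<kappa>' x)"
    using val_elem_prod[OF \<kappa>'n] val_elem_prod_strict[OF \<kappa>'n] by auto
  let ?s = "of_bool (h \<noteq> k) :: int" and ?s' = "of_bool (\<kappa>' \<noteq> replicate_mset (size \<kappa>') n) :: int"
  have "Fin (0 + ((i + int h + ?s) + (int (sum_mset \<kappa>') + ?s'))) \<le> vL (of_int (d \<mu> \<kappa>) * elem_prod {..<n} \<kappa> x)"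
    unfolding eq
    by (intro L.val_ge_mult va vk L.val_ge_of_int aL elem_prod_in_L subfield_of_int[OF L] subfield_mult[OF L])
  moreover have "(of_bool (\<nexists>t. \<kappa> = add_mset k (replicate_mset t n)) :: int) \<le> ?s + ?s'"
    using \<kappa>' by (cases "h = k"; cases "\<kappa>' = replicate_mset (size \<kappa>') n") auto
  moreover have "sum_mset \<mu> = h + sum_mset \<kappa>'" using \<kappa>w \<kappa>' by simp
  then have "int (sum_mset \<mu>) = int h + int (sum_mset \<kappa>')" by (simp only: of_nat_add)
  ultimately show ?thesis by (elim order.trans[rotated]) simp
qed

lemma term_in_L: "of_int (d \<mu> \<kappa>) * elem_prod {..<n} \<kappa> x \<in> L"
  by (intro subfield_mult[OF L] elem_prod_in_L subfield_of_int[OF L])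

lemma monom_sym_in_K: "monom_sym {..<n} \<mu> x \<in> K"
  unfolding d elem_sum_def by (intro subfield_sum[OF K] subfield_mult[OF K] elem_prod_in_K subfield_of_int[OF K])

section \<open>The lower bound\<close>

lemma val_monom_sym_ge:
  assumes \<mu>: "0 \<notin># \<mu>" "size \<mu> = p ^ j"
  shows "Fin (i + int (sum_mset \<mu>)) \<le> vL (monom_sym {..<n} \<mu> x)"
  unfolding d elem_sum_def card_lessThan
proof (rule L.val_ge_sum, intro conjI term_in_L)
  fix \<kappa> assume "\<kappa> \<in> partitions_le n (sum_mset \<mu>)"
  from val_term_ge[OF \<mu> this] show "Fin (i + int (sum_mset \<mu>)) \<le> vL (of_int (d \<mu> \<kappa>) * elem_prod {..<n} \<kappa> x)"
    by (elim order.trans[rotated]) simp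
qed

text \<open>Expanded from the power \<open>r\<close> on, \<open>\<alpha>\<close> has integral
  coefficients. Every type \<open>\<mu>\<close> that occurs has \<open>p ^ j\<close> parts, all at
  least \<open>r\<close>, so its weight is at least \<open>r * p ^ j\<close>.\<close>

lemma E_sym_lower_bound:
  assumes r: "0 < r" and \<alpha>: "\<alpha> \<in> L" "Fin (int r) \<le> vL \<alpha>"
  shows "E_sym K L (p ^ j) \<alpha> \<in> K" "Fin (i + int r * int p ^ j) \<le> vL (E_sym K L (p ^ j) \<alpha>)"
proof -
  obtain a where a: "\<And>l. a l \<in> K" "\<alpha> = (\<Sum>l<n. a l * \<pi> ^ (r + l))" using pi_powers_span[OF \<alpha>(1), of r] by blast
  have a0: "Fin 0 \<le> vK (a l)" if "l < n" for l
    using pi_coeffs_integral[of a r l] a \<alpha>(2) that by simp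
  let ?W = "{r..<r + n}"
  have sh: "(\<Sum>l<n. a l * y ^ (r + l)) = (\<Sum>e\<in>?W. a (e - r) * y ^ e)" for y :: 'a
    by (rule sum.reindex_bij_witness[of _ "\<lambda>e. e - r" "\<lambda>l. r + l"]) auto
  have "E_sym K L (p ^ j) \<alpha> = elem_sym (p ^ j) {..<n} (\<lambda>q. \<Sum>e\<in>?W. a (e - r) * x q ^ e)"
    unfolding a(2) sh[symmetric] by (rule E_sym_pi_sum[OF x]) (use a in auto)
  also have "\<dots> = (\<Sum>\<mu> | size \<mu> = p ^ j \<and> set_mset \<mu> \<subseteq> ?W. (\<Prod>e\<in>#\<mu>. a (e - r)) * monom_sym {..<n} \<mu> x)"
    by (rule elem_sym_sum_powers) (use r in auto)
  finally have E: "E_sym K L (p ^ j) \<alpha> = \<dots>" .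
  have aK: "(\<Prod>e\<in>#\<mu>. a (e - r)) \<in> K" for \<mu> by (intro subfield_prod_mset[OF K] a(1))
  show "E_sym K L (p ^ j) \<alpha> \<in> K"
    unfolding E by (intro subfield_sum[OF K] subfield_mult[OF K] aK monom_sym_in_K)
  show "Fin (i + int r * int p ^ j) \<le> vL (E_sym K L (p ^ j) \<alpha>)"
    unfolding E
  proof (rule L.val_ge_sum, intro conjI)
    fix \<mu> assume "\<mu> \<in> {\<mu>. size \<mu> = p ^ j \<and> set_mset \<mu> \<subseteq> ?W}"
    then have \<mu>: "size \<mu> = p ^ j" "set_mset \<mu> \<subseteq> ?W" by auto
    have L': "(\<Prod>e\<in>#\<mu>. a (e - r)) \<in> L" "monom_sym {..<n} \<mu> x \<in> L" using aK monom_sym_in_K KL by auto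
    then show "(\<Prod>e\<in>#\<mu>. a (e - r)) * monom_sym {..<n} \<mu> x \<in> L" by (rule subfield_mult[OF L])
    have "Fin (\<Sum>e\<in>#\<mu>. 0) \<le> vL (\<Prod>e\<in>#\<mu>. a (e - r))"
    proof (rule L.val_ge_prod_mset)
      fix e assume "e \<in># \<mu>"
      then have "Fin 0 \<le> vK (a (e - r))" using \<mu>(2) by (intro a0) force
      then show "a (e - r) \<in> L \<and> Fin 0 \<le> vL (a (e - r))"
        using vK_ge_imp_vL_ge[OF a(1), of 0] a(1) KL by auto
    qed
    then have 0: "Fin 0 \<le> vL (\<Prod>e\<in>#\<mu>. a (e - r))" by simp
    have "0 \<notin># \<mu>" using \<mu>(2) r by auto
    then have "Fin (0 + (i + int (sum_mset \<mu>))) \<le> vL ((\<Prod>e\<in>#\<mu>. a (e - r)) * monom_sym {..<n} \<mu> x)"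
      using \<mu>(1) by (intro L.val_ge_mult L' 0 val_monom_sym_ge)
    moreover have "r * size \<mu> \<le> sum_mset \<mu>"
    proof -
      have "\<forall>e\<in>#\<mu>. r \<le> e" using \<mu>(2) by force
      then show ?thesis by (induction \<mu>) auto
    qed
    then have "int r * int p ^ j \<le> int (sum_mset \<mu>)" using \<mu>(1) by (metis of_nat_le_iff of_nat_mult of_nat_power)
    ultimately show "Fin (i + int r * int p ^ j) \<le> vL ((\<Prod>e\<in>#\<mu>. a (e - r)) * monom_sym {..<n} \<mu> x)"
      by (elim order.trans[rotated]) simp
  qed
qed

section \<open>Attaining the lower bound\<close>

text \<open>Among the products of this weight only the one for \<open>(k, n, ..., n)\<close> does
  not exceed the lower bound, and its coefficient is prime to \<open>p\<close>, hence a
  unit.\<close>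

lemma val_leading_monom_sym:
  assumes r: "0 < r" and \<delta>: "\<not> p dvd \<delta>" and w: "r * p ^ j + p ^ m * \<delta> = k + t * n"
    and \<mu>: "\<mu> = replicate_mset (p ^ j - p ^ m) r + replicate_mset (p ^ m) (r + \<delta>)"
  shows "vL (monom_sym {..<n} \<mu> x) = Fin (i + int (k + t * n))"
proof -
  have lt: "p ^ m < p ^ j" using mj(2) prime_gt_1_nat[OF p(1)] by simp
  have "0 < \<delta>" using \<delta> by (cases \<delta>) auto
  have "(p ^ j - p ^ m) * r + p ^ m * (r + \<delta>) = r * p ^ j + p ^ m * \<delta>"
    using lt by (simp add: algebra_simps diff_mult_distrib2)
  then have sm: "sum_mset \<mu> = k + t * n" unfolding \<mu> w[symmetric] by (simp add: sum_mset_replicate_mset)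
  have \<mu>0: "0 \<notin># \<mu>" "size \<mu> = p ^ j" using r lt by (auto simp: \<mu> split: if_splits)
  let ?\<kappa> = "add_mset k (replicate_mset t n)"
  let ?t = "\<lambda>\<kappa>. of_int (d \<mu> \<kappa>) * elem_prod {..<n} \<kappa> x"
  have "\<not> int p dvd d \<mu> ?\<kappa>"
  proof (rule leading_coeff_not_dvd[OF d(2) \<mu> p(1,2) k(1,2) r])
    show "\<not> int p dvd int r * int ((p ^ j - 1) choose p ^ m) + int (r + \<delta>) * int ((p ^ j - 1) choose (p ^ m - 1))"
      by (rule leading_coeff_residue[OF p(1) mj(2) \<delta>])
    show "p ^ j \<le> p ^ \<nu>" using mj(1) prime_gt_0_nat[OF p(1)] by (intro power_increasing) auto
  qed (use \<open>0 < \<delta>\<close> lt sm prime_gt_0_nat[OF p(1)] in auto)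
  moreover have "Fin 1 \<le> vL (of_nat p)"
    using vK_ge_imp_vL_ge[OF subfield_of_nat[OF K] p(3)] n by (elim order.trans[rotated]) simp
  ultimately have v0: "vL (of_int (d \<mu> ?\<kappa>)) = Fin 0" using p(1) by (intro L.val_of_int_unit)
  have "vL (c n ^ t) = Fin (int t * int n)" by (rule L.val_power[OF c_in_L val_c_n])
  then have "vL (c k * c n ^ t) = Fin (i + int k + int t * int n)"
    using k(4) by (simp add: L.val_mult c_in_L subfield_power[OF L])
  then have main: "vL (?t ?\<kappa>) = Fin (i + int (k + t * n))"
    using v0 L.val_mult[OF subfield_of_int[OF L] elem_prod_in_L, of "d \<mu> ?\<kappa>" ?\<kappa>]
    by (simp add: elem_prod_def)
  have "?\<kappa> \<in> partitions_le n (sum_mset \<mu>)"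
    using k sm by (auto simp: partitions_le_def sum_mset_replicate_mset split: if_splits)
  then have "monom_sym {..<n} \<mu> x = ?t ?\<kappa> + (\<Sum>\<kappa>\<in>partitions_le n (sum_mset \<mu>) - {?\<kappa>}. ?t \<kappa>)"
    unfolding d elem_sum_def card_lessThan by (intro sum.remove finite_partitions_le)
  moreover have "Fin (i + int (k + t * n) + 1) \<le> vL (\<Sum>\<kappa>\<in>partitions_le n (sum_mset \<mu>) - {?\<kappa>}. ?t \<kappa>)"
  proof (rule L.val_ge_sum, intro conjI term_in_L)
    fix \<kappa> assume \<kappa>: "\<kappa> \<in> partitions_le n (sum_mset \<mu>) - {?\<kappa>}"
    have "\<nexists>t'. \<kappa> = add_mset k (replicate_mset t' n)"
    proof
      assume "\<exists>t'. \<kappa> = add_mset k (replicate_mset t' n)"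
      then obtain t' where t': "\<kappa> = add_mset k (replicate_mset t' n)" by blast
      then have "t' = t" using \<kappa> sm n by (auto simp: partitions_le_def sum_mset_replicate_mset)
      then show False using t' \<kappa> by simp
    qed
    then show "Fin (i + int (k + t * n) + 1) \<le> vL (?t \<kappa>)"
      using val_term_ge[OF \<mu>0, of \<kappa>] \<kappa> sm by simp
  qed
  ultimately show ?thesis
    using main by (auto intro!: L.val_add_strict term_in_L subfield_sum[OF L] simp: extended_Suc_le_iff)
qed

lemma E_sym_two_terms:
  assumes r: "0 < r" "0 < \<delta>" and b: "b \<in> K"
  shows "E_sym K L h (\<pi> ^ r + b * \<pi> ^ (r + \<delta>))
    = (\<Sum>s\<le>h. b ^ s * monom_sym {..<n} (replicate_mset (h - s) r + replicate_mset s (r + \<delta>)) x)"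
proof -
  define a where "a e = (if e = r then 1 else b)" for e
  have s2: "(\<Sum>e\<in>{r, r + \<delta>}. a e * y ^ e) = y ^ r + b * y ^ (r + \<delta>)" for y
    using r by (simp add: a_def)
  let ?\<mu> = "\<lambda>s. replicate_mset (h - s) r + replicate_mset s (r + \<delta>)"
  have ne: "r \<noteq> r + \<delta>" using r by simp
  have "E_sym K L h (\<pi> ^ r + b * \<pi> ^ (r + \<delta>)) = elem_sym h {..<n} (\<lambda>q. \<Sum>e\<in>{r, r + \<delta>}. a e * x q ^ e)"
    unfolding s2[symmetric] using b subfield_1[OF K] by (intro E_sym_pi_sum[OF x]) (auto simp: a_def)
  also have "\<dots> = (\<Sum>\<mu> | size \<mu> = h \<and> set_mset \<mu> \<subseteq> {r, r + \<delta>}. (\<Prod>e\<in>#\<mu>. a e) * monom_sym {..<n} \<mu> x)"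
    by (rule elem_sym_sum_powers) (use r in auto)
  also have "\<dots> = (\<Sum>s\<le>h. (\<Prod>e\<in>#?\<mu> s. a e) * monom_sym {..<n} (?\<mu> s) x)"
    unfolding multisets_two_values(1)[OF ne] by (subst sum.reindex[OF multisets_two_values(2)[OF ne]]) simp
  also have "\<dots> = (\<Sum>s\<le>h. b ^ s * monom_sym {..<n} (?\<mu> s) x)"
    using r by (simp add: a_def)
  finally show ?thesis .
qed

text \<open>For an element with two terms and parameter \<open>b\<close>, divide by
  \<open>\<omega>\<close> of valuation \<open>g\<close>. The result is an integral polynomial in
  \<open>b\<close> whose coefficient at \<open>p ^ m\<close> is a unit and whose higher coefficients
  have positive valuation.\<close>

lemma E_sym_attained:
  assumes r: "0 < r" and g: "int n * (g - 1) < i + int r * int p ^ j" "i + int r * int p ^ j \<le> int n * g"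
    and res: "infinite (residue_field K vK) \<or> p ^ m < card (residue_field K vK)"
  shows "\<exists>\<alpha>\<in>L. Fin (int r) \<le> vL \<alpha> \<and> vK (E_sym K L (p ^ j) \<alpha>) = Fin g"
proof -
  let ?h = "p ^ j" and ?s = "p ^ m"
  have p1: "1 < p" using prime_gt_1_nat[OF p(1)] .
  have lt: "?s < ?h" using mj(2) p1 by simp
  obtain b0 where b0: "i + int k = int n * b0"
  proof -
    have "c k \<noteq> 0" using k(4) L.val_0 by auto
    then show ?thesis using val_K[OF c_in_K, of k] k(4) that by auto
  qed
  have m\<nu>: "Suc m \<le> \<nu>" using mj by simp
  have pn: "int p ^ Suc m dvd int n"
  proof -
    have "p ^ Suc m dvd n" using p(2) m\<nu> by (meson dvd_trans le_imp_power_dvd)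
    then show ?thesis by (metis int_dvd_int_iff of_nat_power)
  qed
  have pk: "int p ^ m dvd int k" "\<not> int p ^ Suc m dvd int k"
    using le_vp_trunc_iff[OF p(1), of m \<nu> "int k"] le_vp_trunc_iff[OF p(1) m\<nu>, of "int k"] k(3) m\<nu> by auto
  \<comment> \<open>The weight for which the bound \<open>i + w\<close> is exactly
    \<open>n * g\<close>; it has the form \<open>k + t * n\<close> because \<open>n\<close> divides
    \<open>i + k\<close>.\<close>
  define w where "w = int n * g - i"
  have w: "w = int k + int n * (g - b0)" using b0 by (simp add: w_def algebra_simps)
  have w0: "int r * int p ^ j \<le> w" using g(2) by (simp add: w_def)
  have "0 < int r * int p ^ j" using r p1 by simp
  then have "int n * (-1) < int n * (g - b0)" using w0 w k(2) by simp
  \<comment> \<open>As \<open>w\<close> is positive and \<open>k < n\<close>, the multiple of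
    \<open>n\<close> exceeds \<open>- n\<close>.\<close>
  then have t0: "0 \<le> g - b0" using mult_less_cancel_left_pos[of "int n" "-1" "g - b0"] n by simp
  define t where "t = nat (g - b0)"
  have wt: "w = int (k + t * n)" using w t0 by (simp add: t_def mult.commute)
  have pj: "int p ^ Suc m dvd int r * int p ^ j" using mj(2) by (intro dvd_mult le_imp_power_dvd) simp
  have pw: "int p ^ Suc m dvd (w - int r * int p ^ j) - int k"
    unfolding w using pn pj by (auto intro!: dvd_diff dvd_mult2)
  have "int p ^ m dvd w - int r * int p ^ j"
  proof -
    have "int p ^ m dvd (w - int r * int p ^ j) - int k" using pw by (meson dvd_trans le_imp_power_dvd lessI less_imp_le)
    then have "int p ^ m dvd ((w - int r * int p ^ j) - int k) + int k" using pk(1) by (rule dvd_add)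
    then show ?thesis by simp
  qed
  \<comment> \<open>The excess of \<open>w\<close> over \<open>r * p ^ j\<close>, shared by
    \<open>p ^ m\<close> parts. Because \<open>m < j \<le> \<nu>\<close>, the excess is congruent to
    \<open>k\<close> modulo \<open>p ^ Suc m\<close>, so \<open>D\<close> is prime to
    \<open>p\<close>.\<close>
  then obtain D where D: "w - int r * int p ^ j = int p ^ m * D" by blast
  have D0: "0 \<le> D" using D w0 p1 by (metis diff_ge_0_iff_ge of_nat_0_less_iff of_nat_power zero_le_mult_iff zero_less_power not_le order.strict_trans zero_less_one)
  have Dp: "\<not> int p dvd D"
  proof
    assume "int p dvd D"
    then have "int p ^ Suc m dvd w - int r * int p ^ j" unfolding D by (simp add: mult.commute[of "int p"] mult_dvd_mono)
    then have "int p ^ Suc m dvd (w - int r * int p ^ j) - ((w - int r * int p ^ j) - int k)" using pw by (rule dvd_diff)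
    then show False using pk(2) by simp
  qed
  define \<delta> where "\<delta> = nat D"
  have \<delta>D: "int \<delta> = D" using D0 by (simp add: \<delta>_def)
  have \<delta>p: "\<not> p dvd \<delta>" using Dp by (metis \<delta>D int_dvd_int_iff)
  then have \<delta>0: "0 < \<delta>" by (cases \<delta>) auto
  have "int (r * p ^ j + p ^ m * \<delta>) = int (k + t * n)" using D \<delta>D wt by simp
  then have wn: "r * p ^ j + p ^ m * \<delta> = k + t * n" by (simp only: of_nat_eq_iff)
  define M where "M s = monom_sym {..<n} (replicate_mset (?h - s) r + replicate_mset s (r + \<delta>)) x" for s
  have MK: "M s \<in> K" for s unfolding M_def by (rule monom_sym_in_K)
  have vM: "Fin (i + int r * int p ^ j + int s * int \<delta>) \<le> vL (M s)" if s: "s \<le> ?h" for s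
  proof -
    let ?\<mu> = "replicate_mset (?h - s) r + replicate_mset s (r + \<delta>)"
    have "(?h - s) * r + s * (r + \<delta>) = r * ?h + s * \<delta>" using s by (simp add: algebra_simps diff_mult_distrib2)
    then have "sum_mset ?\<mu> = r * ?h + s * \<delta>" by (simp add: sum_mset_replicate_mset)
    moreover have "0 \<notin># ?\<mu>" "size ?\<mu> = ?h" using r s by (auto split: if_splits)
    ultimately show ?thesis using val_monom_sym_ge[of ?\<mu>] by (simp add: M_def algebra_simps)
  qed
  have vMs: "vL (M ?s) = Fin (int n * g)"
    using val_leading_monom_sym[OF r \<delta>p wn refl] unfolding M_def wt[symmetric] w_def by simp
  obtain \<omega> where \<omega>: "\<omega> \<in> K" "\<omega> \<noteq> 0" "vK \<omega> = Fin g" using K.val_surj by blast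
  have vi: "inverse \<omega> \<in> K" "vK (inverse \<omega>) = Fin (- g)"
    using \<omega> K.val_inverse subfield_inverse[OF K] by auto
  define \<gamma> where "\<gamma> s = M s * inverse \<omega>" for s
  have M\<gamma>: "M s = \<omega> * \<gamma> s" for s using \<omega>(2) by (simp add: \<gamma>_def)
  have \<gamma>K: "\<gamma> s \<in> K" for s unfolding \<gamma>_def by (intro subfield_mult[OF K] MK vi)
  have g0: "Fin 0 \<le> vK (\<gamma> s)" if "s \<le> ?h" for s
  proof -
    have "int n * (g - 1) < i + int r * int p ^ j + int s * int \<delta>" using g(1) mult_nonneg_nonneg[of "int s" "int \<delta>"] by linarith
    then have "Fin g \<le> vK (M s)" by (rule vL_ge_imp_vK_ge[OF MK vM[OF that]])
    then have "Fin (g + - g) \<le> vK (\<gamma> s)" unfolding \<gamma>_def using vi by (intro K.val_ge_mult MK) auto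
    then show ?thesis by simp
  qed
  \<comment> \<open>Beyond \<open>s = p ^ m\<close> the weight exceeds \<open>w\<close>, so the
    bound passes \<open>n * g\<close> and rounds up to \<open>g + 1\<close>.\<close>
  have g1: "Fin 1 \<le> vK (\<gamma> s)" if "s \<le> ?h" "?s < s" for s
  proof -
    have "int n * g = i + int r * int p ^ j + int ?s * int \<delta>" using wt wn by (simp add: w_def algebra_simps flip: of_nat_mult of_nat_add of_nat_power)
    moreover have "int ?s * int \<delta> < int s * int \<delta>" using that \<delta>0 by (simp add: mult_strict_right_mono flip: of_nat_power)
    ultimately have "int n * ((g + 1) - 1) < i + int r * int p ^ j + int s * int \<delta>" by simp
    then have "Fin (g + 1) \<le> vK (M s)" by (rule vL_ge_imp_vK_ge[OF MK vM[OF that(1)]])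
    then have "Fin (g + 1 + - g) \<le> vK (\<gamma> s)" unfolding \<gamma>_def using vi by (intro K.val_ge_mult MK) auto
    then show ?thesis by simp
  qed
  have gs: "vK (\<gamma> ?s) = Fin 0"
  proof -
    have "M ?s \<noteq> 0" using vMs L.val_0 by auto
    then have "vK (M ?s) = Fin g" using val_K[OF MK, of ?s] vMs n by auto
    then show ?thesis unfolding \<gamma>_def using K.val_mult[OF MK vi(1)] vi by simp
  qed
  \<comment> \<open>The part of degree at most \<open>p ^ m\<close>; by \<open>g1\<close> the
    remaining terms cannot change a value that is a unit.\<close>
  define q where "q = (\<Sum>s\<le>?s. monom (\<gamma> s) s)"
  have cq: "coeff q s = (if s \<le> ?s then \<gamma> s else 0)" for s
    by (simp add: q_def coeff_sum)
  have "degree q = ?s"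
  proof (rule antisym)
    show "degree q \<le> ?s" by (rule degree_le) (simp add: cq)
    have "\<gamma> ?s \<noteq> 0" using gs K.val_0 by auto
    then show "?s \<le> degree q" by (intro le_degree) (simp add: cq)
  qed
  obtain B where B: "finite B" "card B = Suc ?s" "\<And>b. b \<in> B \<Longrightarrow> b \<in> K \<and> Fin 0 \<le> vK b"
    "\<And>b b'. b \<in> B \<Longrightarrow> b' \<in> B \<Longrightarrow> b \<noteq> b' \<Longrightarrow> vK (b - b') = Fin 0"
    using K.residue_representatives[OF res] by metis
  have "\<exists>b\<in>B. vK (poly q b) = Fin 0"
  proof (rule K.exists_unit_value)
    show "coeff q s \<in> K \<and> Fin 0 \<le> vK (coeff q s)" for s
      using \<gamma>K g0[of s] lt by (simp add: cq subfield_0[OF K] K.val_0)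
    show "vK (lead_coeff q) = Fin 0" using gs by (simp add: \<open>degree q = ?s\<close> cq)
  qed (use B \<open>degree q = ?s\<close> in auto)
  then obtain b where b: "b \<in> K" "Fin 0 \<le> vK b" "vK (poly q b) = Fin 0" using B(3) by blast
  define \<alpha> where "\<alpha> = \<pi> ^ r + b * \<pi> ^ (r + \<delta>)"
  have bL: "b \<in> L" using b(1) KL by blast
  have "Fin 0 \<le> vL b" using vK_ge_imp_vL_ge[OF b(1,2)] by simp
  then have "Fin (0 + int (r + \<delta>)) \<le> vL (b * \<pi> ^ (r + \<delta>))"
    by (intro L.val_ge_mult bL pi_power(1)) (simp_all add: vL_pi_power)
  then have "Fin (int r) \<le> vL (b * \<pi> ^ (r + \<delta>))" by (elim order.trans[rotated]) simp
  then have v\<alpha>: "Fin (int r) \<le> vL \<alpha>"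
    unfolding \<alpha>_def by (intro L.val_ge_add subfield_mult[OF L] bL pi_power(1)) (simp_all add: vL_pi_power)
  have \<alpha>L: "\<alpha> \<in> L" unfolding \<alpha>_def by (intro subfield_add[OF L] subfield_mult[OF L] bL pi_power(1))
  have "E_sym K L ?h \<alpha> = (\<Sum>s\<le>?h. b ^ s * M s)"
    unfolding \<alpha>_def M_def by (rule E_sym_two_terms[OF r \<delta>0 b(1)])
  also have "\<dots> = (\<Sum>s\<le>?s. b ^ s * M s) + (\<Sum>s\<in>{?s<..?h}. b ^ s * M s)"
  proof -
    have "{..?h} = {..?s} \<union> {?s<..?h}" using lt by auto
    then show ?thesis by (simp only:) (rule sum.union_disjoint, auto)
  qed
  also have "(\<Sum>s\<le>?s. b ^ s * M s) = \<omega> * poly q b"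
    by (simp add: q_def poly_sum poly_monom M\<gamma> sum_distrib_left mult_ac)
  also have "(\<Sum>s\<in>{?s<..?h}. b ^ s * M s) = \<omega> * (\<Sum>s\<in>{?s<..?h}. b ^ s * \<gamma> s)"
    by (simp add: M\<gamma> sum_distrib_left mult_ac)
  finally have E: "E_sym K L ?h \<alpha> = \<omega> * (poly q b + (\<Sum>s\<in>{?s<..?h}. b ^ s * \<gamma> s))"
    by (simp add: distrib_left)
  have bs: "b ^ s \<in> K" "Fin 0 \<le> vK (b ^ s)" for s
  proof -
    show "b ^ s \<in> K" using b(1) by (rule subfield_power[OF K])
    show "Fin 0 \<le> vK (b ^ s)"
    proof (induction s)
      case (Suc s)
      have "Fin (0 + 0) \<le> vK (b * b ^ s)" using Suc b by (intro K.val_ge_mult subfield_power[OF K])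
      then show ?case by simp
    qed (simp add: K.val_1)
  qed
  have "Fin 1 \<le> vK (\<Sum>s\<in>{?s<..?h}. b ^ s * \<gamma> s)"
  proof (rule K.val_ge_sum, intro conjI)
    fix s assume s: "s \<in> {?s<..?h}"
    show "b ^ s * \<gamma> s \<in> K" by (intro subfield_mult[OF K] bs \<gamma>K)
    have "Fin (0 + 1) \<le> vK (b ^ s * \<gamma> s)" using s by (intro K.val_ge_mult bs \<gamma>K g1) auto
    then show "Fin 1 \<le> vK (b ^ s * \<gamma> s)" by simp
  qed
  moreover have sK: "(\<Sum>s\<in>{?s<..?h}. b ^ s * \<gamma> s) \<in> K" by (intro subfield_sum[OF K] subfield_mult[OF K] bs \<gamma>K)
  moreover have qK: "poly q b \<in> K"
    using K.val_ge_poly[of q b] b(1,2) \<gamma>K g0 lt by (simp add: cq subfield_0[OF K] K.val_0)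
  ultimately have "vK (poly q b + (\<Sum>s\<in>{?s<..?h}. b ^ s * \<gamma> s)) = Fin 0"
    using b(3) extended_Suc_le_iff[of 0] by (intro K.val_add_strict) auto
  then have "vK (E_sym K L ?h \<alpha>) = Fin g"
    unfolding E using K.val_mult[OF \<omega>(1) subfield_add[OF K qK sK]] \<omega>(3) by simp
  then show ?thesis using \<alpha>L v\<alpha> by blast
qed

end

section \<open>The theorem\<close>

lemma the_Fin_Fin: "the_Fin (Fin a) = a"
  by (simp add: the_Fin_def)

lemma (in valued_field) val_power_nmul: "x \<in> F \<Longrightarrow> v (x ^ t) = nmul t (v x)"
proof (induction t)
  case 0
  then show ?case by (simp add: val_1 nmul_def zero_extended_def)
next
  case (Suc t)
  have "nmul (Suc t) (v x) = nmul t (v x) + v x" by (simp add: nmul_def)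
  then show ?case using Suc by (simp add: val_mult subfield_power[OF F] add.commute)
qed

context tot_ram
begin

text \<open>Homogeneity, used to pass between an arbitrary integer \<open>r\<close> and a positive
  exponent.\<close>

lemma E_sym_scale:
  assumes \<omega>: "\<omega> \<in> K" and \<alpha>: "\<alpha> \<in> L"
  shows "E_sym K L h (\<omega> * \<alpha>) = \<omega> ^ h * E_sym K L h \<alpha>"
proof -
  have "\<sigma> (\<omega> * \<alpha>) = \<omega> * \<sigma> \<alpha>" if "\<sigma> \<in> embeddings K L" for \<sigma>
    using that \<omega> \<alpha> KL by (auto simp: embeddings_def)
  then have "(\<Prod>\<sigma>\<in>S. \<sigma> (\<omega> * \<alpha>)) = \<omega> ^ h * (\<Prod>\<sigma>\<in>S. \<sigma> \<alpha>)"
    if "S \<subseteq> embeddings K L" "card S = h" for S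
  proof -
    have "(\<Prod>\<sigma>\<in>S. \<sigma> (\<omega> * \<alpha>)) = (\<Prod>\<sigma>\<in>S. \<omega> * \<sigma> \<alpha>)"
      by (rule prod.cong) (use that \<open>\<And>\<sigma>. \<sigma> \<in> embeddings K L \<Longrightarrow> \<sigma> (\<omega> * \<alpha>) = \<omega> * \<sigma> \<alpha>\<close> in auto)
    then show ?thesis using that by (simp add: prod.distrib)
  qed
  then show ?thesis by (simp add: E_sym_def elem_sym_def sum_distrib_left)
qed

text \<open>The attained minimum comes from the valuation of an element of \<open>K\<close>, so
  \<open>n\<close> divides \<open>i + h\<close> at the minimizing \<open>h\<close>. This gives
  \<open>h\<close> the truncated valuation \<open>m\<close> and determines it modulo
  \<open>n\<close>. The assumption \<open>m < j\<close> then excludes \<open>h = n\<close>.\<close>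

lemma insep_index_cases:
  assumes sep: "separable_poly (min_poly K \<pi>)"
    and p: "prime p" "p ^ \<nu> dvd n" "Fin 1 \<le> vK (of_nat p)" and j: "j \<le> \<nu>"
    and i: "i = insep_index K vK vL p n \<nu> \<pi> j" and m: "m = vp_trunc p \<nu> i" "m < j"
  obtains k where "0 < k" "k < n" "vp_trunc p \<nu> (int k) = m" "vL (min_poly_c K n \<pi> k) = Fin (i + int k)"
    "\<And>h. h \<in> {1..n} \<Longrightarrow> h \<noteq> k \<Longrightarrow>
      Fin (i + int h + 1) \<le> vL (of_nat p ^ (vp_trunc p \<nu> (int h) - j) * min_poly_c K n \<pi> h)"
proof -
  let ?l = "\<lambda>h. vp_trunc p \<nu> (int h)"
  define c where "c h = min_poly_c K n \<pi> h" for h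
  \<comment> \<open>An element of \<open>K\<close> whose \<open>vL\<close>-value minus
    \<open>h\<close> is the candidate \<open>e j' h\<close>; the candidate is infinite exactly when
    this element is zero.\<close>
  define y where "y j' h = of_nat p ^ (j' - j) * c h" for j' h
  have cK: "c h \<in> K" for h
    using min_poly_pi(1) subfield_1[OF K] unfolding c_def min_poly_c_def poly_over_def
    by (intro subfield_mult[OF K] subfield_power[OF K] subfield_uminus[OF K]) auto
  have pK: "of_nat p ^ t \<in> K" for t by (intro subfield_power[OF K] subfield_of_nat[OF K])
  have yK: "y j' h \<in> K" for j' h unfolding y_def by (intro subfield_mult[OF K] pK cK)
  have cL: "c h \<in> L" and pL: "of_nat p ^ t \<in> L" for h t using cK pK KL by auto
  define A where "A j' = {h \<in> {1..n}. ?l h \<le> j'}" for j'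
  define e where "e j' h = vL (c h) - Fin (int h) + nmul (j' - j) (vL (of_nat p))" for j' h
  define T where "T j' = Min ((\<lambda>h. vL (c h) - Fin (int h)) ` A j') + nmul (j' - j) (vL (of_nat p))" for j'
  have fA: "finite (A j')" "1 \<in> A j'" for j'
    using n by (auto simp: A_def vp_trunc_def)
  have ii: "i = the_Fin (Min (T ` {j..\<nu>}))"
    unfolding i insep_index_def insep_index_at_def T_def A_def c_def
    using vLK[OF cK[unfolded c_def]] by simp
  have le: "Min (T ` {j..\<nu>}) \<le> e j' h" if "j' \<in> {j..\<nu>}" "h \<in> A j'" for j' h
  proof -
    have "Min (T ` {j..\<nu>}) \<le> T j'" using that by (intro Min_le) auto
    also have "T j' \<le> e j' h" unfolding T_def e_def
      using that fA by (intro add_right_mono Min_le) auto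
    finally show ?thesis .
  qed
  have at: "\<exists>j'\<in>{j..\<nu>}. \<exists>h\<in>A j'. Min (T ` {j..\<nu>}) = e j' h"
  proof -
    have "Min (T ` {j..\<nu>}) \<in> T ` {j..\<nu>}" using j by (intro Min_in) auto
    then obtain j' where j': "j' \<in> {j..\<nu>}" "Min (T ` {j..\<nu>}) = T j'" by (elim imageE)
    have "Min ((\<lambda>h. vL (c h) - Fin (int h)) ` A j') \<in> (\<lambda>h. vL (c h) - Fin (int h)) ` A j'"
      using fA by (intro Min_in) auto
    then obtain h where "h \<in> A j'" "T j' = e j' h" unfolding T_def e_def by (elim imageE) simp
    then show ?thesis using j' by auto
  qed
  have y_val: "vL (y j' h) = nmul (j' - j) (vL (of_nat p)) + vL (c h)" for j' h
    unfolding y_def using L.val_mult[OF pL cL] L.val_power_nmul pL[of 1] by simp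
  have fin: "\<exists>a. e j' h = Fin (a - int h) \<and> vL (y j' h) = Fin a" if "y j' h \<noteq> 0" for j' h
  proof -
    have "of_nat p ^ (j' - j) \<noteq> (0::'a)" "c h \<noteq> 0" using that by (auto simp: y_def)
    then obtain a b where ab: "vL (of_nat p ^ (j' - j)) = Fin a" "vL (c h) = Fin b"
      using L.val_Fin pL cL by metis
    then have "nmul (j' - j) (vL (of_nat p)) = Fin a"
      using L.val_power_nmul[of "of_nat p" "j' - j"] pL[of 1] by simp
    then show ?thesis using ab by (intro exI[of _ "a + b"]) (simp add: e_def y_val)
  qed
  have inf: "e j' h = Pinf" if "y j' h = 0" for j' h
  proof -
    have "nmul (j' - j) (vL (of_nat p)) + vL (c h) = Pinf" using that y_val[of j' h] L.val_0 by simp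
    moreover have "vL (c h) \<noteq> Minf" using L.val_Fin[OF cL] L.val_0 by (metis extended.distinct(3,5))
    ultimately show ?thesis
      by (cases "nmul (j' - j) (vL (of_nat p))"; cases "vL (c h)") (auto simp: e_def)
  qed
  \<comment> \<open>The minimum is finite. If \<open>p\<close> is nonzero in the field, take
    \<open>h = n\<close> and level \<open>\<nu>\<close>. Otherwise separability gives a nonzero
    coefficient of the derivative; its index is prime to \<open>p\<close>, and so is
    \<open>h\<close> because \<open>p\<close> divides \<open>n\<close>.\<close>
  have "\<exists>j'\<in>{j..\<nu>}. \<exists>h\<in>A j'. y j' h \<noteq> 0"
  proof (cases "of_nat p = (0::'a)")
    case False
    have "c n \<noteq> 0" using min_poly_eisenstein(2) K.val_0 by (auto simp: c_def min_poly_c_def)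
    then have "y \<nu> n \<noteq> 0" using False by (simp add: y_def)
    moreover have "n \<in> A \<nu>" using n vp_trunc_le by (auto simp: A_def)
    ultimately show ?thesis using j by auto
  next
    case True
    let ?f = "min_poly K \<pi>"
    have "pderiv ?f \<noteq> 0"
    proof
      assume "pderiv ?f = 0"
      then have "is_unit ?f" using sep by (simp add: separable_poly_def)
      then obtain a where "?f = [:a:]" by (rule is_unit_polyE)
      then show False using min_poly_pi(4) n by (metis degree_pCons_0 less_irrefl)
    qed
    then obtain t where "coeff (pderiv ?f) t \<noteq> 0" by (metis leading_coeff_0_iff)
    then have t: "of_nat (Suc t) \<noteq> (0::'a)" "coeff ?f (Suc t) \<noteq> 0" by (auto simp: coeff_pderiv)
    have tn: "Suc t \<le> n" using t(2) min_poly_pi(4) by (metis le_degree)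
    have pt: "\<not> p dvd Suc t"
    proof
      assume "p dvd Suc t"
      then obtain q where "Suc t = p * q" by blast
      then have "of_nat (Suc t) = (of_nat p * of_nat q :: 'a)" by (simp only: of_nat_mult)
      then show False using t(1) True by simp
    qed
    have pn: "p dvd n" using p(2) j m(2) by (metis dvd_power dvd_trans gr_zeroI le_zero_eq not_less_zero)
    define h where "h = n - Suc t"
    have "Suc t \<noteq> n" using pt pn by auto
    then have h: "h \<in> {1..n}" "n - h = Suc t" using tn by (auto simp: h_def)
    have "\<not> p dvd h" using pt pn h by (metis dvd_diff_nat)
    then have "\<not> 1 \<le> ?l h" using le_vp_trunc_iff[OF p(1), of 1 \<nu> "int h"] j m(2)
      by (auto simp: int_dvd_int_iff)
    then have "h \<in> A j" using h by (auto simp: A_def)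
    moreover have "y j h \<noteq> 0" using t(2) h by (simp add: y_def c_def min_poly_c_def)
    ultimately show ?thesis using j by auto
  qed
  then obtain j1 h1 where 1: "j1 \<in> {j..\<nu>}" "h1 \<in> A j1" "y j1 h1 \<noteq> 0" by blast
  obtain j2 h2 where 2: "j2 \<in> {j..\<nu>}" "h2 \<in> A j2" "Min (T ` {j..\<nu>}) = e j2 h2" using at by blast
  have y2: "y j2 h2 \<noteq> 0"
  proof
    assume "y j2 h2 = 0"
    then have "Pinf \<le> e j1 h1" using le[OF 1(1,2)] 2(3) inf by simp
    then show False using fin[OF 1(3)] by auto
  qed
  obtain a where a: "e j2 h2 = Fin (a - int h2)" "vL (y j2 h2) = Fin a" using fin[OF y2] by blast
  have Mi: "Min (T ` {j..\<nu>}) = Fin i" and ai: "a = i + int h2"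
    using ii 2(3) a(1) by (auto simp: the_Fin_Fin)
  have ge: "Fin (i + int h) \<le> vL (y j' h)" if "j' \<in> {j..\<nu>}" "h \<in> A j'" for j' h
  proof (cases "y j' h = 0")
    case False
    then show ?thesis using le[OF that] fin[OF False] Mi by auto
  qed (simp add: L.val_0)
  obtain b where b: "vL (y j2 h2) = Fin (int n * b)" using val_K[OF yK y2] by blast
  have nb: "i + int h2 = int n * b" using a ai b by simp
  have p\<nu>: "int p ^ \<nu> dvd int n" using p(2) by (metis int_dvd_int_iff of_nat_power)
  then have lm: "?l h2 = m" unfolding m(1) using nb by (intro vp_trunc_cong[symmetric] p) simp
  have h2A: "h2 \<in> A j" "h2 \<in> {1..n}" using 2 lm m(2) by (auto simp: A_def)
  \<comment> \<open>For \<open>j2 > j\<close> the factor \<open>p ^ (j2 - j)\<close> would raise the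
    valuation above the bound that \<open>c h2\<close> already satisfies at level
    \<open>j\<close>.\<close>
  have c2: "vL (c h2) = Fin (i + int h2)"
  proof (cases "j2 = j")
    case True
    then show ?thesis using a ai by (simp add: y_def)
  next
    case False
    have "Fin (i + int h2) \<le> vL (c h2)" using ge[of j h2] h2A j by (simp add: y_def)
    moreover have "Fin 1 \<le> vL (of_nat p ^ (j2 - j))"
    proof -
      obtain t where t: "j2 - j = Suc t" using False 2(1) by (metis Suc_diff_Suc atLeastAtMost_iff order_le_less)
      have "Fin (1 + 0) \<le> vK (of_nat p * of_nat p ^ t)"
        using K.val_ge_of_int[of "int p ^ t"] pK by (intro K.val_ge_mult p(3) subfield_of_nat[OF K]) auto
      then have "Fin (int n * 1) \<le> vL (of_nat p ^ (j2 - j))" using t pK[of "Suc t"] by (intro vK_ge_imp_vL_ge) auto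
      then show ?thesis using n by (elim order.trans[rotated]) simp
    qed
    ultimately have "Fin (1 + (i + int h2)) \<le> vL (y j2 h2)" unfolding y_def by (intro L.val_ge_mult pL cL)
    then show ?thesis using a ai by simp
  qed
  have "?l n = \<nu>" using le_vp_trunc_iff[OF p(1), of \<nu> \<nu> "int n"] p\<nu> vp_trunc_le[of p \<nu> "int n"] by simp
  then have "h2 \<noteq> n" using lm m(2) j by auto
  show ?thesis
  proof (rule that[of h2])
    show "0 < h2" "h2 < n" using h2A \<open>h2 \<noteq> n\<close> by auto
    show "?l h2 = m" by (rule lm)
    show "vL (min_poly_c K n \<pi> h2) = Fin (i + int h2)" using c2 by (simp add: c_def)
    fix h assume h: "h \<in> {1..n}" "h \<noteq> h2"
    \<comment> \<open>The smallest level at or above \<open>j\<close> that admits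
      \<open>h\<close>.\<close>
    let ?j = "max j (?l h)"
    have "?j \<in> {j..\<nu>}" "h \<in> A ?j" using h j vp_trunc_le by (auto simp: A_def)
    then have 0: "Fin (i + int h) \<le> vL (y ?j h)" by (rule ge)
    \<comment> \<open>Equality would make \<open>i + h\<close> a multiple of \<open>n\<close> too,
      hence \<open>h\<close> congruent to \<open>h2\<close> modulo \<open>n\<close>.\<close>
    have "vL (y ?j h) \<noteq> Fin (i + int h)"
    proof
      assume eq: "vL (y ?j h) = Fin (i + int h)"
      then have "y ?j h \<noteq> 0" using L.val_0 by auto
      from val_K[OF yK this] obtain b' where "i + int h = int n * b'" using eq by auto
      then have "int h - int h2 = int n * (b' - b)" using nb by (simp add: algebra_simps)
      then have "int n dvd int h - int h2" by simp
      then have "int h mod int n = int h2 mod int n" by (simp add: mod_eq_dvd_iff)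
      moreover have "h2 mod n = h2" using \<open>h2 \<noteq> n\<close> h2A by simp
      ultimately have hm: "h mod n = h2" by (metis of_nat_eq_iff zmod_int)
      then show False using h h2A by (cases "h = n") auto
    qed
    then have "Fin (i + int h) < vL (y ?j h)" using 0 by (simp add: order_less_le)
    moreover have "?j - j = ?l h - j" by simp
    ultimately show "Fin (i + int h + 1) \<le> vL (of_nat p ^ (?l h - j) * min_poly_c K n \<pi> h)"
      by (simp add: extended_Suc_le_iff y_def c_def)
  qed
qed

end

theorem theorem5p2:
  fixes K L :: "'a::field set"
    and vK vL :: "'a \<Rightarrow> int extended"
    and \<pi>L :: 'a
    and p n u \<nu> j m :: nat
    and r :: int
  assumes "is_subfield K"
    and "normalized_valuation K vK"
    and "valuation_complete K vK"
    and "perfect_residue_field_char p K vK"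
    and "UNIV_separable_closure K"
    and "totally_ramified K vK L vL n"
    and "n = u * p ^ \<nu>"
    and "\<not> p dvd u"
    and "\<pi>L \<in> L"
    and "vL \<pi>L = 1"
    and "j \<le> \<nu>"
    and "m = vp_trunc p \<nu> (insep_index K vK vL p n \<nu> \<pi>L j)"
    and "m < j"
    and "infinite (residue_field K vK) \<or> p ^ m < card (residue_field K vK)"
  shows "{c * E_sym K L (p ^ j) \<alpha> | c \<alpha>. c \<in> valuation_ring K vK \<and> \<alpha> \<in> maximal_ideal_pow L vL r}
           = maximal_ideal_pow K vK
               \<lceil>real_of_int (insep_index K vK vL p n \<nu> \<pi>L j + r * int p ^ j) / real n\<rceil>
       \<and> g_min K vK L vL (p ^ j) r
           = Fin \<lceil>real_of_int (insep_index K vK vL p n \<nu> \<pi>L j + r * int p ^ j) / real n\<rceil>"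
proof -
  let ?i = "insep_index K vK vL p n \<nu> \<pi>L j"
  let ?h = "p ^ j"
  define G where "G = \<lceil>real_of_int (?i + r * int p ^ j) / real n\<rceil>"
  have p: "prime p" "of_nat p \<in> maximal_ideal K vK" using assms(4) by (auto simp: perfect_residue_field_char_def)
  have u: "0 < u" using assms(8) by (cases u) auto
  have n: "0 < n" using assms(7) u prime_gt_0_nat[OF p(1)] by simp
  interpret tot_ram K L vK vL n \<pi>L
    using assms n by unfold_locales auto
  have vp: "Fin 1 \<le> vK (of_nat p)"
    using p(2) extended_Suc_le_iff[of 0 "vK (of_nat p)"] by (simp add: maximal_ideal_def zero_extended_def)
  have sep: "separable_poly (min_poly K \<pi>L)"
    using assms(5) by (auto simp: UNIV_separable_closure_def separable_over_def)
  obtain x where x: "inj_on x {..<n}" "min_poly K \<pi>L = (\<Prod>i<n. [:- x i, 1:])"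
    using separable_poly_splits[of "min_poly K \<pi>L"] sep min_poly_pi assms(5)
    by (auto simp: UNIV_separable_closure_def)
  have pn: "p ^ \<nu> dvd n" using assms(7) by simp
  obtain k where k: "0 < k" "k < n" "vp_trunc p \<nu> (int k) = m" "vL (min_poly_c K n \<pi>L k) = Fin (?i + int k)"
    "\<And>h. h \<in> {1..n} \<Longrightarrow> h \<noteq> k \<Longrightarrow>
      Fin (?i + int h + 1) \<le> vL (of_nat p ^ (vp_trunc p \<nu> (int h) - j) * min_poly_c K n \<pi>L h)"
    by (rule insep_index_cases[OF sep p(1) pn vp assms(11) refl assms(12,13)]) (rule that; assumption)
  interpret insep_ext K L vK vL n \<pi>L x p \<nu> j k m ?i
    using x p(1) pn vp assms(11,13) k min_poly_c_eq[OF x(2)] by unfold_locales auto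
  obtain \<omega>\<^sub>1 where \<omega>\<^sub>1: "\<omega>\<^sub>1 \<in> K" "\<omega>\<^sub>1 \<noteq> 0" "vK \<omega>\<^sub>1 = Fin 1" using K.val_surj by blast
  \<comment> \<open>Large enough to make \<open>R = r + n * N\<close> positive, since the expansions
    start at a positive power of the uniformizer. Scaling by \<open>\<omega>\<close> shifts the
    exponent by \<open>n * N\<close> and the predicted minimum by \<open>N * p ^ j\<close>.\<close>
  define N where "N = nat (1 - r)"
  define \<omega> where "\<omega> = \<omega>\<^sub>1 ^ N"
  have \<omega>: "\<omega> \<in> K" "\<omega> \<noteq> 0" "vK \<omega> = Fin (int N)"
    using \<omega>\<^sub>1 K.val_power[OF \<omega>\<^sub>1(1,3), of N] by (auto simp: \<omega>_def subfield_power[OF K])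
  have \<omega>L: "\<omega> \<in> L" "vL \<omega> = Fin (int n * int N)" using \<omega> KL by (auto simp: vLK nmul_Fin)
  have "1 - r \<le> int N" by (simp add: N_def)
  also have "int N \<le> int n * int N" using n mult_right_mono[of 1 "int n" "int N"] by simp
  finally have r': "0 < r + int n * int N" by simp
  define R where "R = nat (r + int n * int N)"
  have R: "0 < R" "int R = r + int n * int N" using r' by (auto simp: R_def)
  have real_n: "0 < real n" using n by simp
  \<comment> \<open>The ceiling characterized by integer inequalities, as
    \<open>vL_ge_imp_vK_ge\<close> and \<open>E_sym_attained\<close> require.\<close>
  have G: "int n * (G - 1) < ?i + r * int p ^ j" "?i + r * int p ^ j \<le> int n * G"
  proof -
    have "real_of_int G - 1 < real_of_int (?i + r * int p ^ j) / real n"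
      "real_of_int (?i + r * int p ^ j) / real n \<le> real_of_int G" unfolding G_def by linarith+
    then have "real_of_int (int n * (G - 1)) < real_of_int (?i + r * int p ^ j)"
      "real_of_int (?i + r * int p ^ j) \<le> real_of_int (int n * G)"
      using real_n by (simp_all add: field_simps)
    then show "int n * (G - 1) < ?i + r * int p ^ j" "?i + r * int p ^ j \<le> int n * G"
      by (simp_all only: of_int_less_iff of_int_le_iff)
  qed
  have \<omega>h: "\<omega> ^ ?h \<in> K" "\<omega> ^ ?h \<noteq> 0" "vK (\<omega> ^ ?h) = Fin (int N * int p ^ j)"
    using \<omega> K.val_power[OF \<omega>(1,3), of ?h] by (auto simp: subfield_power[OF K] mult.commute)
  have lower: "E_sym K L ?h \<alpha> \<in> K \<and> Fin G \<le> vK (E_sym K L ?h \<alpha>)"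
    if "\<alpha> \<in> maximal_ideal_pow L vL r" for \<alpha>
  proof -
    have \<alpha>: "\<alpha> \<in> L" "Fin r \<le> vL \<alpha>" using that by (auto simp: maximal_ideal_pow_def)
    have "Fin (int n * int N + r) \<le> vL (\<omega> * \<alpha>)" using \<alpha> \<omega>L by (intro L.val_ge_mult) auto
    then have ge: "Fin (int R) \<le> vL (\<omega> * \<alpha>)" using R by (simp add: add.commute)
    have wL: "\<omega> * \<alpha> \<in> L" using \<alpha> \<omega>L subfield_mult[OF L] by blast
    let ?E = "E_sym K L ?h (\<omega> * \<alpha>)"
    have E: "?E = \<omega> ^ ?h * E_sym K L ?h \<alpha>" using \<omega>(1) \<alpha>(1) by (rule E_sym_scale)
    have EK: "?E \<in> K" "Fin (?i + int R * int p ^ j) \<le> vL ?E"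
      using E_sym_lower_bound[OF R(1) wL ge] by auto
    have "int n * ((G + int N * int p ^ j) - 1) < ?i + int R * int p ^ j"
      using G(1) unfolding R(2) by (simp add: algebra_simps)
    then have vE: "Fin (G + int N * int p ^ j) \<le> vK ?E" by (rule vL_ge_imp_vK_ge[OF EK])
    have eq: "E_sym K L ?h \<alpha> = inverse (\<omega> ^ ?h) * ?E" using E \<omega>h(2) by simp
    have iK: "inverse (\<omega> ^ ?h) \<in> K" "vK (inverse (\<omega> ^ ?h)) = Fin (- (int N * int p ^ j))"
      using \<omega>h K.val_inverse subfield_inverse[OF K] by blast+
    have "Fin (- (int N * int p ^ j) + (G + int N * int p ^ j)) \<le> vK (E_sym K L ?h \<alpha>)"
      unfolding eq using iK EK vE by (intro K.val_ge_mult) auto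
    moreover have "E_sym K L ?h \<alpha> \<in> K" unfolding eq using iK EK by (intro subfield_mult[OF K])
    ultimately show ?thesis by simp
  qed
  have attained: "\<exists>\<alpha>\<in>maximal_ideal_pow L vL r. vK (E_sym K L ?h \<alpha>) = Fin G"
  proof -
    have "int n * ((G + int N * int p ^ j) - 1) < ?i + int R * int p ^ j"
      "?i + int R * int p ^ j \<le> int n * (G + int N * int p ^ j)"
      using G unfolding R(2) by (simp_all add: algebra_simps)
    then obtain \<beta> where \<beta>: "\<beta> \<in> L" "Fin (int R) \<le> vL \<beta>" "vK (E_sym K L ?h \<beta>) = Fin (G + int N * int p ^ j)"
      using E_sym_attained[OF R(1) _ _ assms(14)] by blast
    define \<alpha> where "\<alpha> = inverse \<omega> * \<beta>"
    have iL: "inverse \<omega> \<in> L" "vL (inverse \<omega>) = Fin (- (int n * int N))"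
      using \<omega>L L.val_inverse subfield_inverse[OF L] by blast+
    have "Fin (- (int n * int N) + int R) \<le> vL \<alpha>" unfolding \<alpha>_def using iL \<beta> by (intro L.val_ge_mult) auto
    then have \<alpha>: "\<alpha> \<in> maximal_ideal_pow L vL r"
      using R(2) iL \<beta> subfield_mult[OF L] by (simp add: maximal_ideal_pow_def \<alpha>_def)
    have "\<beta> = \<omega> * \<alpha>" using \<omega>(2) by (simp add: \<alpha>_def)
    then have "E_sym K L ?h \<beta> = \<omega> ^ ?h * E_sym K L ?h \<alpha>"
      using E_sym_scale[OF \<omega>(1)] \<alpha> by (simp add: maximal_ideal_pow_def)
    then have "Fin (G + int N * int p ^ j) = Fin (int N * int p ^ j) + vK (E_sym K L ?h \<alpha>)"
      using \<beta>(3) K.val_mult[OF \<omega>h(1)] lower[OF \<alpha>] \<omega>h(3) by simp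
    then have "vK (E_sym K L ?h \<alpha>) = Fin G" by (cases "vK (E_sym K L ?h \<alpha>)") auto
    then show ?thesis using \<alpha> by blast
  qed
  \<comment> \<open>One value of valuation exactly \<open>G\<close> already generates the ideal, so
    the set of multiples of single values is the whole ideal.\<close>
  have "{c * E_sym K L ?h \<alpha> | c \<alpha>. c \<in> valuation_ring K vK \<and> \<alpha> \<in> maximal_ideal_pow L vL r}
      = maximal_ideal_pow K vK G" (is "?A = _")
  proof (intro equalityI subsetI)
    fix y assume "y \<in> ?A"
    then obtain c \<alpha> where y: "y = c * E_sym K L ?h \<alpha>" "c \<in> K" "Fin 0 \<le> vK c" "\<alpha> \<in> maximal_ideal_pow L vL r"
      by (auto simp: valuation_ring_def zero_extended_def)
    have "Fin (0 + G) \<le> vK y" unfolding y(1) using lower[OF y(4)] y by (intro K.val_ge_mult) auto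
    then show "y \<in> maximal_ideal_pow K vK G"
      using y lower[OF y(4)] subfield_mult[OF K] by (simp add: maximal_ideal_pow_def)
  next
    fix y assume "y \<in> maximal_ideal_pow K vK G"
    then have y: "y \<in> K" "Fin G \<le> vK y" by (auto simp: maximal_ideal_pow_def)
    obtain \<alpha> where \<alpha>: "\<alpha> \<in> maximal_ideal_pow L vL r" "vK (E_sym K L ?h \<alpha>) = Fin G" using attained by blast
    let ?E = "E_sym K L ?h \<alpha>"
    have E: "?E \<in> K" "?E \<noteq> 0" using lower[OF \<alpha>(1)] \<alpha>(2) K.val_0 by auto
    have iE: "inverse ?E \<in> K" "vK (inverse ?E) = Fin (- G)"
      using E \<alpha>(2) K.val_inverse subfield_inverse[OF K] by blast+
    have "Fin (G + - G) \<le> vK (y * inverse ?E)" using y iE by (intro K.val_ge_mult) auto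
    then have "y * inverse ?E \<in> valuation_ring K vK"
      using y iE subfield_mult[OF K] by (simp add: valuation_ring_def zero_extended_def)
    moreover have "y = (y * inverse ?E) * ?E" using E by simp
    ultimately show "y \<in> ?A" using \<alpha>(1) by blast
  qed
  moreover have "g_min K vK L vL ?h r = Fin G"
    unfolding g_min_def
  proof (rule Least_equality)
    show "Fin G \<in> (\<lambda>\<alpha>. vK (E_sym K L ?h \<alpha>)) ` maximal_ideal_pow L vL r" using attained by force
  qed (use lower in auto)
  ultimately show ?thesis unfolding G_def by blast
qed

end
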